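(* Let $\Sigma$ be a finite CW complex of dimension $d$ and suppose $\Sigma$ has a cellular spanning forest $\Upsilon$ such that $\tilde H_{d-1}(\Upsilon;\mathbb{Z})$ is torsion-free. For $\sigma\in\Upsilon$ let $$\chi(\Upsilon,\sigma)=\sum_{\rho\in\operatorname{bond}(\Upsilon,\sigma)}\varepsilon^{\Upsilon\setminus\sigma}_{\sigma,\rho}\,\mathbf{t}_{d-1}(\Upsilon\setminus\sigma\cup\rho)\,\rho.$$ Then $\{\chi(\Upsilon,\sigma):\sigma\in\Upsilon\}$ is an integral basis of the cut lattice $\mathcal{C}(\Sigma)=\operatorname{im}_{\mathbb{Z}}\partial_d^*$.
   Context: $\Sigma$ has the convention of a unique $(-1)$-cell (reduced homology); $d$-cells are facets, oriented, identified with the standard basis of $C_d(\Sigma;\mathbb{Z})\cong\mathbb{Z}^n$; $\partial_d$ is the cellular boundary map and $\partial_d^*$ its transpose. Subcomplexes of dimension $d$ contain the full $(d-1)$-skeleton and are identified with their facet sets. A cellular spanning forest (CSF) is such a subcomplex whose facets index a basis of the column space of $\partial_d$ over $\mathbb{R}$. For a CSF $\Upsilon$ and $\sigma\in\Upsilon$, $\operatorname{bond}(\Upsilon,\sigma)=\{\sigma\}\cup\{\rho\notin\Upsilon:\Upsilon\setminus\sigma\cup\rho\text{ is a CSF}\}$. $\mathbf{t}_{d-1}(X)=|\operatorname{tor}(\tilde H_{d-1}(X;\mathbb{Z}))|$. For a set $A$ of facets and $\rho,\rho'$ with $A\cup\rho$, $A\cup\rho'$ CSFs, $\varepsilon^A_{\rho,\rho'}$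 is $+1$ or $-1$ according as $\partial\rho,\partial\rho'$ lie on the same or opposite sides of the hyperplane in $\operatorname{im}_{\mathbb{R}}\partial_d$ spanned by $\{\partial\tau:\tau\in A\}$. *)

theory Defs
  imports "HOL-Homology.Homology"
begin

section \<open>Finite CW complexes\<close>

text \<open>The closed unit ball of dimension \<open>n\<close>, its boundary sphere and its interior live in the
  library's \<^const>\<open>Euclidean_space\<close>, whose points are functions \<open>nat \<Rightarrow> real\<close> vanishing from
  index \<open>n\<close> on. For \<open>n = 0\<close> the ball is a point and its boundary sphere is empty; for
  \<open>n > 0\<close> the boundary sphere is the carrier of \<open>nsphere (n - 1)\<close>.\<close>

definition nball :: "nat \<Rightarrow> (nat \<Rightarrow> real) topology" where
  "nball n = subtopology (Euclidean_space n) {x. (\<Sum>i<n. x i ^ 2) \<le> 1}"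

definition ball_boundary :: "nat \<Rightarrow> (nat \<Rightarrow> real) set" where
  "ball_boundary n = {x \<in> topspace (nball n). (\<Sum>i<n. x i ^ 2) = 1}"

definition ball_interior :: "nat \<Rightarrow> (nat \<Rightarrow> real) set" where
  "ball_interior n = {x \<in> topspace (nball n). (\<Sum>i<n. x i ^ 2) < 1}"

text \<open>Cells are named by elements of an index type; each comes with its dimension and its
  characteristic map. The \<open>(-1)\<close>-cell is not among them; it enters with the boundary matrix.\<close>

record ('a, 'c) cell_structure =
  cw_space :: "'a topology"
  cells :: "'c set"
  cell_dim :: "'c \<Rightarrow> nat"
  char_map :: "'c \<Rightarrow> (nat \<Rightarrow> real) \<Rightarrow> 'a"

definition open_cell :: "('a, 'c) cell_structure \<Rightarrow> 'c \<Rightarrow> 'a set" where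
  "open_cell S c = char_map S c ` ball_interior (cell_dim S c)"

definition cells_of_dim :: "('a, 'c) cell_structure \<Rightarrow> int \<Rightarrow> 'c set" where
  "cells_of_dim S n = {c \<in> cells S. int (cell_dim S c) = n}"

definition skeleton :: "('a, 'c) cell_structure \<Rightarrow> int \<Rightarrow> 'a set" where
  "skeleton S n = (\<Union>c \<in> {c \<in> cells S. int (cell_dim S c) \<le> n}. open_cell S c)"

text \<open>The weak-topology axiom is omitted, because it is automatic here: the space is Hausdorff and
  the union of the finitely many compact images of the characteristic maps.\<close>

definition finite_CW_complex :: "('a, 'c) cell_structure \<Rightarrow> bool" where
  "finite_CW_complex S \<longleftrightarrow>
     Hausdorff_space (cw_space S) \<and>
     finite (cells S) \<and>
     (\<forall>c \<in> cells S.
        continuous_map (nball (cell_dim S c)) (cw_space S) (char_map S c) \<and>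
        embedding_map (subtopology (nball (cell_dim S c)) (ball_interior (cell_dim S c)))
          (cw_space S) (char_map S c) \<and>
        char_map S c ` ball_boundary (cell_dim S c) \<subseteq> skeleton S (int (cell_dim S c) - 1)) \<and>
     disjoint_family_on (open_cell S) (cells S) \<and>
     (\<Union>c \<in> cells S. open_cell S c) = topspace (cw_space S)"

definition CW_dimension :: "('a, 'c) cell_structure \<Rightarrow> nat \<Rightarrow> bool" where
  "CW_dimension S d \<longleftrightarrow>
     (\<forall>c \<in> cells S. cell_dim S c \<le> d) \<and> (\<exists>c \<in> cells S. cell_dim S c = d)"

section \<open>Cellular chains and the cellular boundary map\<close>

text \<open>Cells are oriented by their characteristic maps, once a generator of the infinite cyclic
  group \<open>H\<^sub>n(D\<^sup>n, S\<^sup>n\<^sup>-\<^sup>1)\<close> has been fixed for each \<open>n\<close>: precomposing the characteristic map with a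
  reflection reverses the orientation of a cell of positive dimension. Vertices are all positively
  oriented.\<close>

definition ball_orientation :: "nat \<Rightarrow> (nat \<Rightarrow> real) chain set" where
  "ball_orientation n =
     (let G = relative_homology_group (int n) (nball n) (ball_boundary n)
      in SOME g. g \<in> carrier G \<and> subgroup_generated G {g} = G)"

definition cellular_chain_group :: "('a, 'c) cell_structure \<Rightarrow> int \<Rightarrow> 'a chain set monoid" where
  "cellular_chain_group S n =
     relative_homology_group n (subtopology (cw_space S) (skeleton S n)) (skeleton S (n - 1))"

definition cell_class :: "('a, 'c) cell_structure \<Rightarrow> 'c \<Rightarrow> 'a chain set" where
  "cell_class S c =
     (let n = cell_dim S c
      in hom_induced (int n) (nball n) (ball_boundary n)
           (subtopology (cw_space S) (skeleton S (int n))) (skeleton S (int n - 1))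
           (char_map S c) (ball_orientation n))"

text \<open>The map \<open>H\<^sub>n(X\<^sup>n, X\<^sup>n\<^sup>-\<^sup>1) \<rightarrow> H\<^sub>n\<^sub>-\<^sub>1(X\<^sup>n\<^sup>-\<^sup>1, X\<^sup>n\<^sup>-\<^sup>2)\<close>.\<close>

definition cellular_boundary ::
    "('a, 'c) cell_structure \<Rightarrow> int \<Rightarrow> 'a chain set \<Rightarrow> 'a chain set" where
  "cellular_boundary S n =
     hom_relboundary n (subtopology (cw_space S) (skeleton S n))
       (skeleton S (n - 1)) (skeleton S (n - 2))"

text \<open>Coordinates of an \<open>n\<close>-chain with respect to the basis of cell classes. The homology groups
  of the library are written multiplicatively, so a linear combination is a product of powers.\<close>

definition cell_coeffs :: "('a, 'c) cell_structure \<Rightarrow> int \<Rightarrow> 'a chain set \<Rightarrow> 'c \<Rightarrow> int" where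
  "cell_coeffs S n z =
     (let G = cellular_chain_group S n
      in THE k. (\<forall>c. c \<notin> cells_of_dim S n \<longrightarrow> k c = 0) \<and>
                z = finprod G (\<lambda>c. cell_class S c [^]\<^bsub>G\<^esub> k c) (cells_of_dim S n))"

text \<open>The matrix of \<open>\<partial>\<^sub>d\<close>. Its rows are indexed by the \<open>(d - 1)\<close>-cells, where \<open>Some \<tau>\<close> is an
  ordinary cell and \<open>None\<close> is the unique \<open>(-1)\<close>-cell, which is present only when \<open>d = 0\<close>;
  in that case \<open>\<partial>\<^sub>0\<close> is the augmentation.\<close>

definition faces :: "('a, 'c) cell_structure \<Rightarrow> nat \<Rightarrow> 'c option set" where
  "faces S d = (if d = 0 then {None} else Some ` cells_of_dim S (int d - 1))"

definition facets :: "('a, 'c) cell_structure \<Rightarrow> nat \<Rightarrow> 'c set" where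
  "facets S d = cells_of_dim S (int d)"

definition bd :: "('a, 'c) cell_structure \<Rightarrow> nat \<Rightarrow> 'c option \<Rightarrow> 'c \<Rightarrow> int" where
  "bd S d \<tau> \<sigma> =
     (if \<tau> \<in> faces S d
      then (case \<tau> of
              None \<Rightarrow> 1
            | Some t \<Rightarrow> cell_coeffs S (int d - 1) (cellular_boundary S (int d) (cell_class S \<sigma>)) t)
      else 0)"

section \<open>Cellular spanning forests and bonds\<close>

definition real_column :: "('a, 'c) cell_structure \<Rightarrow> nat \<Rightarrow> 'c \<Rightarrow> 'c option \<Rightarrow> real" where
  "real_column S d \<sigma> \<tau> = real_of_int (bd S d \<tau> \<sigma>)"

text \<open>The real span of a finite family of vectors.\<close>

definition real_span :: "('i \<Rightarrow> 'r \<Rightarrow> real) \<Rightarrow> 'i set \<Rightarrow> ('r \<Rightarrow> real) set" where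
  "real_span f A = {v. \<exists>a. v = (\<lambda>\<tau>. \<Sum>i\<in>A. a i * f i \<tau>)}"

definition real_independent :: "('i \<Rightarrow> 'r \<Rightarrow> real) \<Rightarrow> 'i set \<Rightarrow> bool" where
  "real_independent f A \<longleftrightarrow>
     (\<forall>a. (\<forall>\<tau>. (\<Sum>i\<in>A. a i * f i \<tau>) = 0) \<longrightarrow> (\<forall>i\<in>A. a i = 0))"

text \<open>A \<open>d\<close>-dimensional subcomplex containing the \<open>(d - 1)\<close>-skeleton is represented by its set of
  facets.\<close>

definition CSF :: "('a, 'c) cell_structure \<Rightarrow> nat \<Rightarrow> 'c set \<Rightarrow> bool" where
  "CSF S d A \<longleftrightarrow>
     A \<subseteq> facets S d \<and>
     real_independent (real_column S d) A \<and>
     real_span (real_column S d) A = real_span (real_column S d) (facets S d)"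

definition bond :: "('a, 'c) cell_structure \<Rightarrow> nat \<Rightarrow> 'c set \<Rightarrow> 'c \<Rightarrow> 'c set" where
  "bond S d A \<sigma> =
     {\<sigma>} \<union> {\<rho> \<in> facets S d. \<rho> \<notin> A \<and> CSF S d (insert \<rho> (A - {\<sigma>}))}"

section \<open>Torsion\<close>

definition subcomplex :: "('a, 'c) cell_structure \<Rightarrow> nat \<Rightarrow> 'c set \<Rightarrow> 'a topology" where
  "subcomplex S d A =
     subtopology (cw_space S) (skeleton S (int d - 1) \<union> (\<Union>\<sigma>\<in>A. open_cell S \<sigma>))"

definition torsion :: "('g, 'm) monoid_scheme \<Rightarrow> 'g set" where
  "torsion G = {x \<in> carrier G. \<exists>k::nat. k > 0 \<and> x [^]\<^bsub>G\<^esub> k = \<one>\<^bsub>G\<^esub>}"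

definition torsion_number :: "('a, 'c) cell_structure \<Rightarrow> nat \<Rightarrow> 'c set \<Rightarrow> nat" where
  "torsion_number S d A = card (torsion (reduced_homology_group (int d - 1) (subcomplex S d A)))"

section \<open>Signs\<close>

text \<open>The two sides of a hyperplane \<open>H\<close> of a space \<open>V\<close> of real vectors with coordinates in \<open>R\<close>
  are the half-spaces cut out by a linear functional on \<open>V\<close> with kernel \<open>H\<close>.\<close>

definition same_side ::
    "'r set \<Rightarrow> ('r \<Rightarrow> real) set \<Rightarrow> ('r \<Rightarrow> real) set \<Rightarrow> ('r \<Rightarrow> real) \<Rightarrow> ('r \<Rightarrow> real) \<Rightarrow> bool" where
  "same_side R V H u v \<longleftrightarrow>
     (\<exists>y. H = {x \<in> V. (\<Sum>\<tau>\<in>R. y \<tau> * x \<tau>) = 0} \<and>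
          (\<Sum>\<tau>\<in>R. y \<tau> * u \<tau>) > 0 \<and> (\<Sum>\<tau>\<in>R. y \<tau> * v \<tau>) > 0)"

text \<open>Meant only for \<open>\<rho>\<close>, \<open>\<rho>'\<close> such that adding either one to \<open>A\<close> gives a spanning forest; then
  neither boundary lies on the hyperplane, so "not on the same side" means "on opposite sides".\<close>

definition relative_sign ::
    "('a, 'c) cell_structure \<Rightarrow> nat \<Rightarrow> 'c set \<Rightarrow> 'c \<Rightarrow> 'c \<Rightarrow> int" where
  "relative_sign S d A \<rho> \<rho>' =
     (if same_side (faces S d) (real_span (real_column S d) (facets S d))
           (real_span (real_column S d) A) (real_column S d \<rho>) (real_column S d \<rho>')
      then 1 else -1)"

section \<open>Calibrated characteristic vectors and the cut lattice\<close>

text \<open>Elements of \<open>\<int>\<^sup>n\<close> are functions on the cell index type vanishing outside the facets.\<close>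

definition std_basis :: "'c \<Rightarrow> 'c \<Rightarrow> int" where
  "std_basis \<rho> = (\<lambda>\<sigma>. if \<sigma> = \<rho> then 1 else 0)"

definition char_vector :: "('a, 'c) cell_structure \<Rightarrow> nat \<Rightarrow> 'c set \<Rightarrow> 'c \<Rightarrow> 'c \<Rightarrow> int" where
  "char_vector S d A \<sigma> =
     (\<lambda>\<kappa>. \<Sum>\<rho> \<in> bond S d A \<sigma>.
        relative_sign S d (A - {\<sigma>}) \<sigma> \<rho> *
        int (torsion_number S d (insert \<rho> (A - {\<sigma>}))) * std_basis \<rho> \<kappa>)"

definition cut_lattice :: "('a, 'c) cell_structure \<Rightarrow> nat \<Rightarrow> ('c \<Rightarrow> int) set" where
  "cut_lattice S d =
     {v. \<exists>y. v = (\<lambda>\<sigma>. if \<sigma> \<in> facets S d then \<Sum>\<tau>\<in>faces S d. bd S d \<tau> \<sigma> * y \<tau> else 0)}"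

definition integral_basis :: "('i \<Rightarrow> 'r \<Rightarrow> int) \<Rightarrow> 'i set \<Rightarrow> ('r \<Rightarrow> int) set \<Rightarrow> bool" where
  "integral_basis b I L \<longleftrightarrow>
     (\<forall>a. (\<forall>\<kappa>. (\<Sum>i\<in>I. a i * b i \<kappa>) = 0) \<longrightarrow> (\<forall>i\<in>I. a i = 0)) \<and>
     L = {v. \<exists>a. v = (\<lambda>\<kappa>. \<Sum>i\<in>I. a i * b i \<kappa>)}"

end

theory Submission
  imports Defs
begin

text \<open>Write \<open>L(A)\<close> for the lattice spanned by the columns of \<open>\<partial>\<^sub>d\<close> indexed by \<open>A\<close>. The torsion of the
  homology of the subcomplex \<open>A\<close> in degree \<open>d - 1\<close> is the quotient of the saturation of \<open>L(A)\<close> by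
  \<open>L(A)\<close>, so the hypothesis says that \<open>L(\<Upsilon>)\<close> is saturated. Hence every column is an integral
  combination \<open>\<partial>\<rho> = \<Sum>\<sigma>. c(\<sigma>, \<rho>) \<partial>\<sigma>\<close> over \<open>\<sigma> \<in> \<Upsilon>\<close>. Exchanging \<open>\<sigma>\<close> for \<open>\<rho>\<close> gives a spanning forest iff
  \<open>c(\<sigma>, \<rho>) \<noteq> 0\<close>; the new lattice then has index \<open>\<bar>c(\<sigma>, \<rho>)\<bar>\<close> in its saturation \<open>L(\<Upsilon>)\<close>, and
  the sign of \<open>c(\<sigma>, \<rho>)\<close> tells on which side of the hyperplane \<open>\<partial>\<rho>\<close> lies. So the calibrated vectors are
  the rows of the matrix \<open>c\<close>. They are independent because \<open>c\<close> is the identity on \<open>\<Upsilon>\<close>, and they span the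
  row lattice of \<open>\<partial>\<^sub>d = \<partial>\<^sub>\<Upsilon> c\<close> because a matrix whose independent columns span a saturated
  lattice has a left inverse over the integers.\<close>

text \<open>The topological input is that a characteristic map induces an isomorphism
  \<open>H\<^sub>k(D\<^sup>n, S\<^sup>n\<^sup>-\<^sup>1) \<rightarrow> H\<^sub>k(Y \<union> e, Y)\<close>. Expanding the ball radially deforms a collar
  of the sphere onto the sphere, on the ball and on \<open>Y \<union> e\<close> alike; enlarging the subspaces by the
  collar permits excision of the sphere and of \<open>Y\<close>, which leaves a homeomorphism of pairs.\<close>

section \<open>Integer lattices spanned by columns\<close>

text \<open>The forest is given over the reals, the conclusion concerns integer lattices. The bridge
  is an alternative that stays within the integers: an integer vector either has a positive multiple
  in a column lattice or is detected by an integer functional that kills this lattice. It yields the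
  coefficients c, because a detecting functional would contradict the equality of real spans, and
  also the functionals that cut out the hyperplanes of the signs.

  No quotient group is formed. Torsion is reached through a map \<open>\<theta>\<close> on the
  saturation whose fibres are the cosets of the lattice, and a torsion number counts its values. The
  algebra sees only \<open>\<theta>\<close>; the topology must supply it for every set of facets,
  not only for forests.

  The boundary matrix consists of coordinates in the cell classes, so these must be shown to form a
  basis before the matrix has any meaning. Cells are attached one at a time, each to a base that has
  absorbed the earlier ones; in the top degree every step is a short exact sequence with infinite
  cyclic quotient. In dimension 0 the boundary is the augmentation, and the torsion statement is
  checked by hand.\<close>

definition column_lattice :: "('r \<Rightarrow> 'c \<Rightarrow> int) \<Rightarrow> 'c set \<Rightarrow> ('r \<Rightarrow> int) set" where
  "column_lattice M A = {u. \<exists>a. u = (\<lambda>\<tau>. \<Sum>\<sigma>\<in>A. a \<sigma> * M \<tau> \<sigma>)}"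

text \<open>For a lattice \<open>L\<close> of vectors supported on \<open>T\<close>, this is the
  inverse image of the torsion subgroup of the quotient of all such integer vectors by
  \<open>L\<close>.\<close>

definition saturation :: "'r set \<Rightarrow> ('r \<Rightarrow> int) set \<Rightarrow> ('r \<Rightarrow> int) set" where
  "saturation T L = {u. (\<forall>\<tau>. \<tau> \<notin> T \<longrightarrow> u \<tau> = 0) \<and> (\<exists>k>0. (\<lambda>\<tau>. k * u \<tau>) \<in> L)}"

lemma column_latticeI: "u = (\<lambda>\<tau>. \<Sum>\<sigma>\<in>A. a \<sigma> * M \<tau> \<sigma>) \<Longrightarrow> u \<in> column_lattice M A"
  by (auto simp: column_lattice_def)

lemma column_latticeE:
  assumes "u \<in> column_lattice M A"
  obtains a where "\<And>\<tau>. u \<tau> = (\<Sum>\<sigma>\<in>A. a \<sigma> * M \<tau> \<sigma>)"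
  using assms by (auto simp: column_lattice_def)

lemma column_lattice_zero: "(\<lambda>\<tau>. 0) \<in> column_lattice M A"
  by (rule column_latticeI[where a = "\<lambda>_. 0"]) simp

lemma column_lattice_add:
  assumes "u \<in> column_lattice M A" "v \<in> column_lattice M A"
  shows "(\<lambda>\<tau>. u \<tau> + v \<tau>) \<in> column_lattice M A"
proof -
  obtain a where "\<And>\<tau>. u \<tau> = (\<Sum>\<sigma>\<in>A. a \<sigma> * M \<tau> \<sigma>)" by (rule column_latticeE[OF assms(1)]) blast
  moreover obtain b where "\<And>\<tau>. v \<tau> = (\<Sum>\<sigma>\<in>A. b \<sigma> * M \<tau> \<sigma>)" by (rule column_latticeE[OF assms(2)]) blast
  ultimately show ?thesis
    by (intro column_latticeI[where a = "\<lambda>\<sigma>. a \<sigma> + b \<sigma>"]) (simp add: distrib_right sum.distrib)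
qed

lemma column_lattice_scale:
  assumes "u \<in> column_lattice M A"
  shows "(\<lambda>\<tau>. k * u \<tau>) \<in> column_lattice M A"
proof -
  obtain a where "\<And>\<tau>. u \<tau> = (\<Sum>\<sigma>\<in>A. a \<sigma> * M \<tau> \<sigma>)" by (rule column_latticeE[OF assms(1)]) blast
  then show ?thesis
    by (intro column_latticeI[where a = "\<lambda>\<sigma>. k * a \<sigma>"]) (simp add: sum_distrib_left mult.assoc)
qed

lemma column_lattice_diff:
  assumes "u \<in> column_lattice M A" "v \<in> column_lattice M A"
  shows "(\<lambda>\<tau>. u \<tau> - v \<tau>) \<in> column_lattice M A"
  using column_lattice_add[OF assms(1) column_lattice_scale[OF assms(2), of "-1"]] by simp

lemma column_lattice_column:
  assumes "finite A" "\<sigma> \<in> A"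
  shows "(\<lambda>\<tau>. M \<tau> \<sigma>) \<in> column_lattice M A"
proof (rule column_latticeI[where a = "\<lambda>\<rho>. if \<rho> = \<sigma> then 1 else 0"])
  show "(\<lambda>\<tau>. M \<tau> \<sigma>) = (\<lambda>\<tau>. \<Sum>\<rho>\<in>A. (if \<rho> = \<sigma> then 1 else 0) * M \<tau> \<rho>)"
    using assms by (simp add: if_distrib[where f = "\<lambda>x. x * _"] cong: if_cong)
qed

lemma column_lattice_sum:
  assumes "finite I" "\<And>i. i \<in> I \<Longrightarrow> u i \<in> column_lattice M A"
  shows "(\<lambda>\<tau>. \<Sum>i\<in>I. u i \<tau>) \<in> column_lattice M A"
  using assms
proof (induction I)
  case empty
  show ?case using column_lattice_zero by simp
next
  case (insert i I)
  then have "(\<lambda>\<tau>. u i \<tau> + (\<Sum>i\<in>I. u i \<tau>)) \<in> column_lattice M A"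
    by (intro column_lattice_add) auto
  with insert.hyps show ?case by simp
qed

lemma column_lattice_least:
  assumes "\<And>\<sigma>. \<sigma> \<in> A \<Longrightarrow> (\<lambda>\<tau>. M \<tau> \<sigma>) \<in> column_lattice M B" "finite A"
  shows "column_lattice M A \<subseteq> column_lattice M B"
proof
  fix u assume "u \<in> column_lattice M A"
  then obtain a where u: "\<And>\<tau>. u \<tau> = (\<Sum>\<sigma>\<in>A. a \<sigma> * M \<tau> \<sigma>)" by (rule column_latticeE) blast
  have "(\<lambda>\<tau>. \<Sum>\<sigma>\<in>A. a \<sigma> * M \<tau> \<sigma>) \<in> column_lattice M B"
    using assms by (intro column_lattice_sum[where u = "\<lambda>\<sigma> \<tau>. a \<sigma> * M \<tau> \<sigma>"] column_lattice_scale) auto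
  moreover have "u = (\<lambda>\<tau>. \<Sum>\<sigma>\<in>A. a \<sigma> * M \<tau> \<sigma>)" using u by (rule ext)
  ultimately show "u \<in> column_lattice M B" by simp
qed

lemma column_lattice_mono:
  assumes "A \<subseteq> B" "finite B"
  shows "column_lattice M A \<subseteq> column_lattice M B"
  using assms finite_subset by (intro column_lattice_least column_lattice_column) auto

text \<open>By elimination of one column at a time: a functional that separates the new column from
  the old ones is used to clear it from \<open>v\<close>.\<close>

lemma integral_Fredholm:
  fixes M :: "'r \<Rightarrow> 'c \<Rightarrow> int"
  assumes "finite A" "finite T" "\<And>\<tau>. \<tau> \<notin> T \<Longrightarrow> v \<tau> = 0"
    and supp: "\<And>\<tau> \<sigma>. \<tau> \<notin> T \<Longrightarrow> M \<tau> \<sigma> = 0"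
  shows "(\<exists>k>0. (\<lambda>\<tau>. k * v \<tau>) \<in> column_lattice M A) \<or>
         (\<exists>y. (\<forall>\<sigma>\<in>A. (\<Sum>\<tau>\<in>T. y \<tau> * M \<tau> \<sigma>) = 0) \<and> (\<Sum>\<tau>\<in>T. y \<tau> * v \<tau>) \<noteq> 0)"
  using assms(1,3)
proof (induction A arbitrary: v rule: finite_induct)
  case empty
  show ?case
  proof (cases "\<exists>t\<in>T. v t \<noteq> 0")
    case True
    then obtain t where "t \<in> T" "v t \<noteq> 0" by blast
    then have "(\<Sum>\<tau>\<in>T. (if \<tau> = t then 1 else 0) * v \<tau>) \<noteq> 0"
      using \<open>finite T\<close> by (simp add: if_distrib[where f = "\<lambda>x. x * _"] cong: if_cong)
    then show ?thesis by (intro disjI2 exI[of _ "\<lambda>\<tau>. if \<tau> = t then 1 else 0"]) simp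
  next
    case False
    then have "v = (\<lambda>\<tau>. 0)" using empty by blast
    then have "(\<lambda>\<tau>. 1 * v \<tau>) \<in> column_lattice M {}" using column_lattice_zero by simp
    then show ?thesis using zero_less_one by blast
  qed
next
  case (insert \<sigma> A)
  let ?p = "\<lambda>y u. \<Sum>\<tau>\<in>T. y \<tau> * u \<tau>"
  let ?c = "\<lambda>\<tau>. M \<tau> \<sigma>"
  have sub: "column_lattice M A \<subseteq> column_lattice M (insert \<sigma> A)"
    using insert.hyps by (intro column_lattice_mono) auto
  from insert.IH[of ?c] supp consider
    (dep) k where "k > 0" "(\<lambda>\<tau>. k * ?c \<tau>) \<in> column_lattice M A"
    | (sep) y where "\<forall>\<sigma>\<in>A. ?p y (\<lambda>\<tau>. M \<tau> \<sigma>) = 0" "?p y ?c \<noteq> 0" by blast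
  then show ?case
  proof cases
    case dep
    from insert.IH[of v] insert.prems consider
      (d) l where "l > 0" "(\<lambda>\<tau>. l * v \<tau>) \<in> column_lattice M A"
      | (s) y where "\<forall>\<sigma>\<in>A. ?p y (\<lambda>\<tau>. M \<tau> \<sigma>) = 0" "?p y v \<noteq> 0" by blast
    then show ?thesis
    proof cases
      case d then show ?thesis using sub by blast
    next
      case s
      obtain a where a: "\<And>\<tau>. k * ?c \<tau> = (\<Sum>\<sigma>\<in>A. a \<sigma> * M \<tau> \<sigma>)"
        by (rule column_latticeE[OF dep(2)]) blast
      \<comment> \<open>A positive multiple of the new column lies in the lattice of the old ones,
        so \<open>y\<close>, which kills those, kills the new column too and still separates
        \<open>v\<close>.\<close>
      have "k * ?p y ?c = (\<Sum>\<tau>\<in>T. y \<tau> * (k * ?c \<tau>))"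
        by (simp add: sum_distrib_left mult_ac)
      also have "\<dots> = (\<Sum>\<tau>\<in>T. \<Sum>\<sigma>\<in>A. a \<sigma> * (y \<tau> * M \<tau> \<sigma>))"
        unfolding a by (simp add: sum_distrib_left mult_ac)
      also have "\<dots> = (\<Sum>\<sigma>\<in>A. a \<sigma> * ?p y (\<lambda>\<tau>. M \<tau> \<sigma>))"
        by (subst sum.swap) (simp add: sum_distrib_left)
      finally have "?p y ?c = 0" using s(1) dep(1) by simp
      with s show ?thesis by auto
    qed
  next
    case sep
    \<comment> \<open>Elimination by cross-multiplication keeps the entries integral;
      \<open>y\<close> vanishes on the result.\<close>
    let ?v = "\<lambda>\<tau>. ?p y ?c * v \<tau> - ?p y v * ?c \<tau>"
    have "\<And>\<tau>. \<tau> \<notin> T \<Longrightarrow> ?v \<tau> = 0" using insert.prems supp by simp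
    from insert.IH[of ?v, OF this] consider
      (d) l where "l > 0" "(\<lambda>\<tau>. l * ?v \<tau>) \<in> column_lattice M A"
      | (s) z where "\<forall>\<sigma>\<in>A. ?p z (\<lambda>\<tau>. M \<tau> \<sigma>) = 0" "?p z ?v \<noteq> 0" by blast
    then show ?thesis
    proof cases
      case d
      have c: "?c \<in> column_lattice M (insert \<sigma> A)"
        using insert.hyps by (intro column_lattice_column) auto
      have "(\<lambda>\<tau>. l * ?v \<tau> + (l * ?p y v) * ?c \<tau>) \<in> column_lattice M (insert \<sigma> A)"
        using sub by (rule column_lattice_add[OF subsetD[OF _ d(2)] column_lattice_scale[OF c]])
      then have "(\<lambda>\<tau>. (l * ?p y ?c) * v \<tau>) \<in> column_lattice M (insert \<sigma> A)"
        by (simp add: algebra_simps)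
      then have "(\<lambda>\<tau>. sgn (?p y ?c) * ((l * ?p y ?c) * v \<tau>)) \<in> column_lattice M (insert \<sigma> A)"
        by (rule column_lattice_scale)
      then have "(\<lambda>\<tau>. (l * \<bar>?p y ?c\<bar>) * v \<tau>) \<in> column_lattice M (insert \<sigma> A)"
        by (simp add: abs_sgn mult_ac)
      moreover have "l * \<bar>?p y ?c\<bar> > 0" using d(1) sep(2) by simp
      ultimately show ?thesis by blast
    next
      case s
      \<comment> \<open>The adjoint elimination: the multiple of \<open>y\<close> is chosen so that
        \<open>?z\<close> also kills the new column, and the value of \<open>?z\<close> on
        \<open>v\<close> is that of \<open>z\<close> on \<open>?v\<close>.\<close>
      let ?z = "\<lambda>\<tau>. ?p y ?c * z \<tau> - ?p z ?c * y \<tau>"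
      have lin: "?p ?z u = ?p y ?c * ?p z u - ?p z ?c * ?p y u" for u
        by (simp only: left_diff_distrib sum_subtractf sum_distrib_left mult.assoc)
      have "?p z (\<lambda>\<tau>. \<alpha> * u \<tau> - \<beta> * w \<tau>) = \<alpha> * ?p z u - \<beta> * ?p z w" for \<alpha> \<beta> u w
        by (simp add: right_diff_distrib sum_subtractf sum_distrib_left mult_ac)
      then have "?p z ?v = ?p y ?c * ?p z v - ?p y v * ?p z ?c" .
      then have "?p ?z v \<noteq> 0" using s(2) lin[of v] by (simp add: mult.commute)
      moreover have "\<forall>\<rho>\<in>insert \<sigma> A. ?p ?z (\<lambda>\<tau>. M \<tau> \<rho>) = 0"
        using lin s(1) sep(1) by simp
      ultimately show ?thesis by (intro disjI2 exI[of _ ?z] conjI)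
    qed
  qed
qed

text \<open>Induction on the index set: the projection of the lattice to all coordinates but one is
  everything, and pairing with the vector \<open>x\<close> orthogonal to the lifts of the unit vectors shows
  that the multiples of the last unit vector in the lattice cannot be proper.\<close>

lemma unimodular_lattice_full:
  fixes L :: "('c \<Rightarrow> int) set"
  assumes "finite F"
    and "\<And>u v. u \<in> L \<Longrightarrow> v \<in> L \<Longrightarrow> (\<lambda>\<sigma>. u \<sigma> + v \<sigma>) \<in> L"
    and "\<And>u k. u \<in> L \<Longrightarrow> (\<lambda>\<sigma>. k * u \<sigma>) \<in> L"
    and "(\<lambda>\<sigma>. 0) \<in> L"
    and "\<And>k x. \<lbrakk>\<And>u. u \<in> L \<Longrightarrow> k dvd (\<Sum>\<sigma>\<in>F. u \<sigma> * x \<sigma>)\<rbrakk> \<Longrightarrow> \<forall>\<sigma>\<in>F. k dvd x \<sigma>"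
  shows "\<exists>u\<in>L. \<forall>\<sigma>\<in>F. u \<sigma> = w \<sigma>"
  using assms(1,5)
proof (induction F arbitrary: w rule: finite_induct)
  case empty
  then show ?case using assms(4) by blast
next
  case (insert s F)
  have full: "\<exists>u\<in>L. \<forall>\<sigma>\<in>F. u \<sigma> = w' \<sigma>" for w'
  proof (rule insert.IH)
    fix k x assume k: "\<And>u. u \<in> L \<Longrightarrow> k dvd (\<Sum>\<sigma>\<in>F. u \<sigma> * x \<sigma>)"
    \<comment> \<open>Extending a test vector by 0 at \<open>s\<close> passes the divisibility
      hypothesis on to \<open>F\<close>.\<close>
    have "(\<Sum>\<sigma>\<in>insert s F. u \<sigma> * (if \<sigma> = s then 0 else x \<sigma>)) = (\<Sum>\<sigma>\<in>F. u \<sigma> * x \<sigma>)" for u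
      using insert.hyps by (subst sum.insert) (auto intro!: sum.cong)
    then have "\<forall>\<sigma>\<in>insert s F. k dvd (if \<sigma> = s then 0 else x \<sigma>)"
      using k by (intro insert.prems) simp
    then show "\<forall>\<sigma>\<in>F. k dvd x \<sigma>" using insert.hyps(2) by (metis insertCI)
  qed
  have "\<forall>t. \<exists>u\<in>L. \<forall>\<sigma>\<in>F. u \<sigma> = (if \<sigma> = t then 1 else 0)"
    by (intro allI full)
  then obtain e where e: "\<And>t. e t \<in> L" "\<And>t \<sigma>. \<sigma> \<in> F \<Longrightarrow> e t \<sigma> = (if \<sigma> = t then 1 else 0)" by metis
  have sumL: "(\<lambda>\<sigma>. \<Sum>t\<in>B. a t * e t \<sigma>) \<in> L" if "finite B" for B a
    using that
  proof (induction B)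
    case empty
    then show ?case using assms(4) by simp
  next
    case (insert t B)
    then show ?case using assms(2)[OF assms(3)[OF e(1)] insert.IH, of "a t" t] by simp
  qed
  \<comment> \<open>Subtracting lifts of the unit vectors clears all coordinates in \<open>F\<close>
    without leaving the lattice, so that only the coordinate at \<open>s\<close> carries
    information.\<close>
  define red where "red = (\<lambda>u \<sigma>. u \<sigma> - (\<Sum>t\<in>F. u t * e t \<sigma>))"
  have redL: "red u \<in> L" if "u \<in> L" for u
  proof -
    have "(\<lambda>\<sigma>. u \<sigma> + (-1) * (\<Sum>t\<in>F. u t * e t \<sigma>)) \<in> L"
      using that insert.hyps by (intro assms(2) assms(3) sumL) auto
    then show ?thesis by (simp add: red_def)
  qed
  have red0: "red u \<sigma> = 0" if "\<sigma> \<in> F" for u \<sigma>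
  proof -
    have "(\<Sum>t\<in>F. u t * e t \<sigma>) = (\<Sum>t\<in>F. if \<sigma> = t then u t else 0)"
      using e(2)[OF that] by (intro sum.cong) auto
    also have "\<dots> = u \<sigma>" using that insert.hyps by simp
    finally show ?thesis by (simp add: red_def)
  qed
  define I where "I = {u s | u. u \<in> L \<and> (\<forall>\<sigma>\<in>F. u \<sigma> = 0)}"
  define g where "g = Gcd I"
  \<comment> \<open>\<open>I\<close> is an ideal of the integers; its least positive element, if
    there is one, divides all others and hence is their gcd.\<close>
  have gI: "g \<in> I"
  proof -
    have I_diff: "a - b * k \<in> I" if "a \<in> I" "b \<in> I" for a b k
    proof -
      obtain u where u: "a = u s" "u \<in> L" "\<forall>\<sigma>\<in>F. u \<sigma> = 0"
        using \<open>a \<in> I\<close> by (auto simp: I_def)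
      obtain v where v: "b = v s" "v \<in> L" "\<forall>\<sigma>\<in>F. v \<sigma> = 0"
        using \<open>b \<in> I\<close> by (auto simp: I_def)
      moreover have "(\<lambda>\<sigma>. u \<sigma> + (-k) * v \<sigma>) \<in> L" by (rule assms(2)[OF u(2) assms(3)[OF v(2)]])
      ultimately show ?thesis using u v unfolding I_def by (intro CollectI exI[of _ "\<lambda>\<sigma>. u \<sigma> + (-k) * v \<sigma>"]) (simp add: mult.commute)
    qed
    have I0: "0 \<in> I" unfolding I_def using assms(4) by (intro CollectI exI[of _ "\<lambda>\<sigma>. 0"]) simp
    show ?thesis
    proof (cases "I \<subseteq> {0}")
      case True
      then have "I = {0}" using I0 by blast
      then show ?thesis by (simp add: g_def)
    next
      case False
      then obtain b where "b \<in> I" "b \<noteq> 0" by blast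
      then have "\<exists>n. n > 0 \<and> int n \<in> I"
        using I_diff[OF I0 \<open>b \<in> I\<close>, of 1] \<open>b \<in> I\<close> by (intro exI[of _ "nat \<bar>b\<bar>"]) (cases "b > 0"; simp)
      define m where "m = (LEAST n. n > 0 \<and> int n \<in> I)"
      have m: "m > 0" "int m \<in> I"
        using LeastI_ex[OF \<open>\<exists>n. n > 0 \<and> int n \<in> I\<close>] unfolding m_def by auto
      have "int m dvd a" if "a \<in> I" for a
      proof -
        have "a mod int m \<in> I" using I_diff[OF that m(2), of "a div int m"] by (simp add: minus_mult_div_eq_mod)
        moreover have "nat (a mod int m) < m" "a mod int m \<ge> 0" using m(1) by (auto simp: nat_less_iff)
        ultimately have "\<not> nat (a mod int m) > 0"
          using not_less_Least[of "nat (a mod int m)" "\<lambda>n. n > 0 \<and> int n \<in> I"] unfolding m_def by auto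
        then show ?thesis using \<open>a mod int m \<ge> 0\<close> by auto
      qed
      then have "int m dvd g" "g dvd int m" using m(2) by (auto simp: g_def Gcd_greatest)
      then have "g = int m" using m(1) by (simp add: g_def zdvd_antisym_nonneg)
      then show ?thesis using m by simp
    qed
  qed
  define x where "x = (\<lambda>\<sigma>. if \<sigma> = s then 1 else - e \<sigma> s)"
  have pair: "(\<Sum>\<sigma>\<in>insert s F. u \<sigma> * x \<sigma>) = red u s" for u
  proof -
    have "(\<Sum>\<sigma>\<in>insert s F. u \<sigma> * x \<sigma>) = u s + (\<Sum>\<sigma>\<in>F. u \<sigma> * x \<sigma>)"
      using insert.hyps by (simp add: x_def)
    also have "(\<Sum>\<sigma>\<in>F. u \<sigma> * x \<sigma>) = (\<Sum>\<sigma>\<in>F. - (u \<sigma> * e \<sigma> s))"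
      using insert.hyps by (intro sum.cong) (auto simp: x_def)
    finally show ?thesis by (simp add: red_def sum_negf)
  qed
  have "red u s \<in> I" if "u \<in> L" for u unfolding I_def using redL[OF that] red0
    by (intro CollectI exI[of _ "red u"]) simp
  then have "g dvd (\<Sum>\<sigma>\<in>insert s F. u \<sigma> * x \<sigma>)" if "u \<in> L" for u
    using that unfolding pair by (simp add: g_def)
  then have "\<forall>\<sigma>\<in>insert s F. g dvd x \<sigma>" by (rule insert.prems)
  \<comment> \<open>The coordinate of \<open>x\<close> at \<open>s\<close> is 1. This makes
    \<open>g\<close> a unit and at the same time excludes \<open>I = {0}\<close>, where
    \<open>g\<close> would be 0.\<close>
  then have "g dvd 1" by (simp add: x_def)
  then obtain h where h: "g * h = 1" by (metis dvdE)
  from gI obtain q where q: "q \<in> L" "\<forall>\<sigma>\<in>F. q \<sigma> = 0" "g = q s" unfolding I_def by blast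
  obtain u where u: "u \<in> L" "\<forall>\<sigma>\<in>F. u \<sigma> = w \<sigma>" using full by blast
  \<comment> \<open>\<open>h * q\<close> vanishes on \<open>F\<close> and is 1 at \<open>s\<close>,
    so it repairs the last coordinate of \<open>u\<close> alone.\<close>
  let ?r = "\<lambda>\<sigma>. u \<sigma> + ((w s - u s) * h) * q \<sigma>"
  have "?r \<in> L" by (rule assms(2)[OF u(1) assms(3)[OF q(1)]])
  moreover have "h * q s = 1" using h q(3) by (simp add: mult.commute)
  then have "?r s = w s" by (simp add: mult.assoc)
  moreover have "\<forall>\<sigma>\<in>F. ?r \<sigma> = w \<sigma>" using u q by simp
  ultimately show ?case by (intro bexI[of _ ?r]) auto
qed

section \<open>Real spans\<close>

lemma real_spanI: "v = (\<lambda>\<tau>. \<Sum>i\<in>A. a i * f i \<tau>) \<Longrightarrow> v \<in> real_span f A"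
  by (auto simp: real_span_def)

lemma real_spanE:
  assumes "v \<in> real_span f A"
  obtains a where "\<And>\<tau>. v \<tau> = (\<Sum>i\<in>A. a i * f i \<tau>)"
  using assms by (auto simp: real_span_def)

lemma real_span_add:
  assumes "u \<in> real_span f A" "v \<in> real_span f A"
  shows "(\<lambda>\<tau>. u \<tau> + v \<tau>) \<in> real_span f A"
proof -
  obtain a where "\<And>\<tau>. u \<tau> = (\<Sum>i\<in>A. a i * f i \<tau>)" by (rule real_spanE[OF assms(1)]) blast
  moreover obtain b where "\<And>\<tau>. v \<tau> = (\<Sum>i\<in>A. b i * f i \<tau>)" by (rule real_spanE[OF assms(2)]) blast
  ultimately show ?thesis
    by (intro real_spanI[where a = "\<lambda>i. a i + b i"]) (simp add: distrib_right sum.distrib)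
qed

lemma real_span_scale:
  assumes "u \<in> real_span f A"
  shows "(\<lambda>\<tau>. k * u \<tau>) \<in> real_span f A"
proof -
  obtain a where "\<And>\<tau>. u \<tau> = (\<Sum>i\<in>A. a i * f i \<tau>)" by (rule real_spanE[OF assms(1)]) blast
  then show ?thesis
    by (intro real_spanI[where a = "\<lambda>i. k * a i"]) (simp add: sum_distrib_left mult.assoc)
qed

lemma real_span_base:
  assumes "finite A" "j \<in> A"
  shows "f j \<in> real_span f A"
proof (rule real_spanI[where a = "\<lambda>i. if i = j then 1 else 0"])
  show "f j = (\<lambda>\<tau>. \<Sum>i\<in>A. (if i = j then 1 else 0) * f i \<tau>)"
    using assms by (simp add: if_distrib[where f = "\<lambda>x. x * _"] cong: if_cong)
qed

lemma real_span_sum: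
  assumes "finite I" "\<And>i. i \<in> I \<Longrightarrow> u i \<in> real_span f A"
  shows "(\<lambda>\<tau>. \<Sum>i\<in>I. u i \<tau>) \<in> real_span f A"
  using assms
proof (induction I)
  case empty
  show ?case by (rule real_spanI[where a = "\<lambda>_. 0"]) simp
next
  case (insert i I)
  then have "(\<lambda>\<tau>. u i \<tau> + (\<Sum>i\<in>I. u i \<tau>)) \<in> real_span f A"
    by (intro real_span_add) auto
  with insert.hyps show ?case by simp
qed

lemma real_span_least:
  assumes "finite A" "\<And>i. i \<in> A \<Longrightarrow> f i \<in> real_span f B"
  shows "real_span f A \<subseteq> real_span f B"
proof
  fix u assume "u \<in> real_span f A"
  then obtain a where u: "\<And>\<tau>. u \<tau> = (\<Sum>i\<in>A. a i * f i \<tau>)" by (rule real_spanE) blast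
  have "(\<lambda>\<tau>. \<Sum>i\<in>A. a i * f i \<tau>) \<in> real_span f B"
    using assms by (intro real_span_sum[where u = "\<lambda>i \<tau>. a i * f i \<tau>"] real_span_scale) auto
  moreover have "u = (\<lambda>\<tau>. \<Sum>i\<in>A. a i * f i \<tau>)" using u by (rule ext)
  ultimately show "u \<in> real_span f B" by simp
qed

section \<open>Forests with a saturated column lattice\<close>

text \<open>The interface to topology. \<open>\<theta> A\<close> stands for the map from the
  saturation onto the torsion of the homology of the subcomplex \<open>A\<close>; as its fibres are
  the cosets of the lattice, \<open>t A\<close> is the index of the lattice in its saturation. The
  torsion hypothesis of the theorem becomes \<open>t F = 1\<close>.\<close>

locale saturated_forest =
  fixes M :: "'r \<Rightarrow> 'c \<Rightarrow> int" and T :: "'r set" and E F :: "'c set"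
    and \<theta> :: "'c set \<Rightarrow> ('r \<Rightarrow> int) \<Rightarrow> 'g" and t :: "'c set \<Rightarrow> nat"
  assumes finite_T: "finite T" and finite_E: "finite E"
    and supp: "\<And>\<tau> \<sigma>. \<tau> \<notin> T \<Longrightarrow> M \<tau> \<sigma> = 0"
    and F_subset: "F \<subseteq> E"
    and indep: "real_independent (\<lambda>\<sigma> \<tau>. real_of_int (M \<tau> \<sigma>)) F"
    and span: "real_span (\<lambda>\<sigma> \<tau>. real_of_int (M \<tau> \<sigma>)) F = real_span (\<lambda>\<sigma> \<tau>. real_of_int (M \<tau> \<sigma>)) E"
    and t_eq: "\<And>A. A \<subseteq> E \<Longrightarrow> t A = card (\<theta> A ` saturation T (column_lattice M A))"
    and \<theta>_eq: "\<And>A u v. \<lbrakk>A \<subseteq> E; u \<in> saturation T (column_lattice M A); v \<in> saturation T (column_lattice M A)\<rbrakk>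
      \<Longrightarrow> \<theta> A u = \<theta> A v \<longleftrightarrow> (\<lambda>\<tau>. u \<tau> - v \<tau>) \<in> column_lattice M A"
    and t_F: "t F = 1"
begin

abbreviation R :: "'c \<Rightarrow> 'r \<Rightarrow> real" where "R \<equiv> \<lambda>\<sigma> \<tau>. real_of_int (M \<tau> \<sigma>)"

lemma finite_F: "finite F" using finite_E F_subset finite_subset by blast

lemma lattice_supp: "u \<in> column_lattice M A \<Longrightarrow> \<tau> \<notin> T \<Longrightarrow> u \<tau> = 0"
  by (elim column_latticeE) (simp add: supp)

lemma lattice_saturation: "u \<in> column_lattice M A \<Longrightarrow> u \<in> saturation T (column_lattice M A)"
  unfolding saturation_def using lattice_supp
  by (intro CollectI conjI exI[of _ 1]) auto

lemma coefficients_zero: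
  assumes "\<And>\<tau>. (\<Sum>\<sigma>\<in>F. a \<sigma> * M \<tau> \<sigma>) = 0" "\<sigma> \<in> F"
  shows "a \<sigma> = 0"
proof -
  have "(\<Sum>\<sigma>\<in>F. real_of_int (a \<sigma>) * R \<sigma> \<tau>) = 0" for \<tau>
    using arg_cong[OF assms(1)[of \<tau>], of real_of_int] by simp
  then show ?thesis
    using indep assms(2) unfolding real_independent_def by (metis of_int_eq_0_iff)
qed

text \<open>With \<open>t F = 1\<close> the map \<open>\<theta> F\<close> is constant on the
  saturation, so every member of the saturation is congruent to the zero vector.\<close>

lemma saturation_F: "saturation T (column_lattice M F) \<subseteq> column_lattice M F"
proof
  fix u assume u: "u \<in> saturation T (column_lattice M F)"
  have z: "(\<lambda>\<tau>. 0) \<in> saturation T (column_lattice M F)"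
    by (rule lattice_saturation[OF column_lattice_zero])
  from t_F t_eq[OF F_subset] obtain x where x: "\<theta> F ` saturation T (column_lattice M F) = {x}"
    by (metis card_1_singletonE)
  have "\<theta> F u = x" "\<theta> F (\<lambda>\<tau>. 0) = x"
    using imageI[OF u, of "\<theta> F"] imageI[OF z, of "\<theta> F"] unfolding x by simp_all
  then show "u \<in> column_lattice M F"
    using \<theta>_eq[OF F_subset u z] by simp
qed

lemma pairing_span_zero:
  assumes "x \<in> real_span R A" "\<And>\<sigma>. \<sigma> \<in> A \<Longrightarrow> (\<Sum>\<tau>\<in>T. y \<tau> * R \<sigma> \<tau>) = 0"
  shows "(\<Sum>\<tau>\<in>T. y \<tau> * x \<tau>) = 0"
proof -
  obtain a where a: "\<And>\<tau>. x \<tau> = (\<Sum>\<sigma>\<in>A. a \<sigma> * R \<sigma> \<tau>)" by (rule real_spanE[OF assms(1)]) blast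
  have "(\<Sum>\<tau>\<in>T. y \<tau> * x \<tau>) = (\<Sum>\<tau>\<in>T. \<Sum>\<sigma>\<in>A. a \<sigma> * (y \<tau> * R \<sigma> \<tau>))"
    unfolding a by (simp add: sum_distrib_left mult_ac)
  also have "\<dots> = (\<Sum>\<sigma>\<in>A. a \<sigma> * (\<Sum>\<tau>\<in>T. y \<tau> * R \<sigma> \<tau>))"
    by (subst sum.swap) (simp add: sum_distrib_left)
  finally show ?thesis using assms(2) by simp
qed

lemma of_int_pairing:
  "real_of_int (\<Sum>\<tau>\<in>T. y \<tau> * M \<tau> \<sigma>) = (\<Sum>\<tau>\<in>T. real_of_int (y \<tau>) * R \<sigma> \<tau>)"
  by simp

text \<open>An integer functional that kills the columns of \<open>F\<close> kills their real span
  and with it every column, so it cannot detect \<open>\<rho>\<close>. Hence a positive multiple of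
  the column lies in the lattice of \<open>F\<close>, and saturation removes the multiple.\<close>

lemma column_in_lattice:
  assumes "\<rho> \<in> E"
  shows "(\<lambda>\<tau>. M \<tau> \<rho>) \<in> column_lattice M F"
proof -
  from integral_Fredholm[OF finite_F finite_T, of "\<lambda>\<tau>. M \<tau> \<rho>" M] supp consider
    (sat) "\<exists>k>0. (\<lambda>\<tau>. k * M \<tau> \<rho>) \<in> column_lattice M F"
    | (sep) y where "\<forall>\<sigma>\<in>F. (\<Sum>\<tau>\<in>T. y \<tau> * M \<tau> \<sigma>) = 0" "(\<Sum>\<tau>\<in>T. y \<tau> * M \<tau> \<rho>) \<noteq> 0" by blast
  then show ?thesis
  proof cases
    case sat
    then have "(\<lambda>\<tau>. M \<tau> \<rho>) \<in> saturation T (column_lattice M F)"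
      unfolding saturation_def using supp by simp
    then show ?thesis using saturation_F by blast
  next
    case sep
    have "R \<rho> \<in> real_span R F"
      unfolding span by (rule real_span_base[OF finite_E assms])
    then have "(\<Sum>\<tau>\<in>T. real_of_int (y \<tau>) * R \<rho> \<tau>) = 0"
    proof (rule pairing_span_zero)
      fix \<sigma> assume "\<sigma> \<in> F"
      then show "(\<Sum>\<tau>\<in>T. real_of_int (y \<tau>) * R \<sigma> \<tau>) = 0"
        unfolding of_int_pairing[symmetric] of_int_eq_0_iff using sep(1) by blast
    qed
    then show ?thesis using sep(2) unfolding of_int_pairing[symmetric] by linarith
  qed
qed

text \<open>The choice affects only irrelevant arguments: for \<open>\<sigma>\<close> in
  \<open>F\<close> and \<open>\<rho>\<close> in \<open>E\<close>, independence of the columns of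
  \<open>F\<close> determines the value.\<close>

definition coef :: "'c \<Rightarrow> 'c \<Rightarrow> int" where
  "coef = (SOME c. \<forall>\<rho>\<in>E. \<forall>\<tau>. M \<tau> \<rho> = (\<Sum>\<sigma>\<in>F. c \<sigma> \<rho> * M \<tau> \<sigma>))"

lemma coef:
  assumes "\<rho> \<in> E"
  shows "M \<tau> \<rho> = (\<Sum>\<sigma>\<in>F. coef \<sigma> \<rho> * M \<tau> \<sigma>)"
proof -
  have "\<forall>\<rho>\<in>E. \<exists>a. \<forall>\<tau>. M \<tau> \<rho> = (\<Sum>\<sigma>\<in>F. a \<sigma> * M \<tau> \<sigma>)"
  proof
    fix \<rho> assume "\<rho> \<in> E"
    from column_in_lattice[OF this] obtain a where "\<And>\<tau>. M \<tau> \<rho> = (\<Sum>\<sigma>\<in>F. a \<sigma> * M \<tau> \<sigma>)"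
      by (rule column_latticeE) blast
    then show "\<exists>a. \<forall>\<tau>. M \<tau> \<rho> = (\<Sum>\<sigma>\<in>F. a \<sigma> * M \<tau> \<sigma>)" by blast
  qed
  then obtain a where "\<forall>\<rho>\<in>E. \<forall>\<tau>. M \<tau> \<rho> = (\<Sum>\<sigma>\<in>F. a \<rho> \<sigma> * M \<tau> \<sigma>)" by metis
  then have "\<exists>c. \<forall>\<rho>\<in>E. \<forall>\<tau>. M \<tau> \<rho> = (\<Sum>\<sigma>\<in>F. c \<sigma> \<rho> * M \<tau> \<sigma>)"
    by (intro exI[of _ "\<lambda>\<sigma> \<rho>. a \<rho> \<sigma>"])
  from someI_ex[OF this] show ?thesis using assms unfolding coef_def by blast
qed

lemma real_coef: "\<rho> \<in> E \<Longrightarrow> R \<rho> \<tau> = (\<Sum>\<sigma>\<in>F. real_of_int (coef \<sigma> \<rho>) * R \<sigma> \<tau>)"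
  by (subst coef) simp_all

lemma coef_F:
  assumes "\<sigma> \<in> F" "\<rho> \<in> F"
  shows "coef \<sigma> \<rho> = (if \<sigma> = \<rho> then 1 else 0)"
proof -
  have "coef \<sigma> \<rho> - (if \<sigma> = \<rho> then 1 else 0) = 0"
  proof (rule coefficients_zero[OF _ assms(1),
        where a = "\<lambda>\<sigma>. coef \<sigma> \<rho> - (if \<sigma> = \<rho> then 1 else 0)"])
    fix \<tau>
    have "(\<Sum>\<sigma>\<in>F. (if \<sigma> = \<rho> then 1 else 0) * M \<tau> \<sigma>) = M \<tau> \<rho>"
      using finite_F assms(2) by (simp add: if_distrib[where f = "\<lambda>x. x * _"] cong: if_cong)
    then show "(\<Sum>\<sigma>\<in>F. (coef \<sigma> \<rho> - (if \<sigma> = \<rho> then 1 else 0)) * M \<tau> \<sigma>) = 0"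
      using coef[of \<rho> \<tau>] assms(2) F_subset by (auto simp: left_diff_distrib sum_subtractf)
  qed
  then show ?thesis by simp
qed

section \<open>Exchange of one facet of the forest for another\<close>

lemma sum_exchange:
  fixes g :: "'c \<Rightarrow> 'a::comm_ring_1"
  assumes "\<sigma> \<in> F" "\<rho> \<notin> F"
  shows "(\<Sum>i\<in>insert \<rho> (F - {\<sigma>}). g i) = g \<rho> - g \<sigma> + (\<Sum>i\<in>F. g i)"
  using assms finite_F by (simp add: sum_diff1)

text \<open>Expanding the new column in the columns of \<open>F\<close> leaves
  \<open>a \<rho> * coef \<sigma> \<rho>\<close> as the whole coordinate at \<open>\<sigma>\<close>.
  This is why that single coefficient governs spanning, index and sign.\<close>

lemma real_combination_exchange:
  assumes "\<sigma> \<in> F" "\<rho> \<in> E" "\<rho> \<notin> F"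
  shows "(\<Sum>i\<in>insert \<rho> (F - {\<sigma>}). a i * R i \<tau>) =
    (\<Sum>i\<in>F. (a \<rho> * coef i \<rho> + (if i = \<sigma> then 0 else a i)) * R i \<tau>)"
proof -
  have "(\<Sum>i\<in>F. (if i = \<sigma> then 0 else a i) * R i \<tau>) = (\<Sum>i\<in>F. a i * R i \<tau>) - a \<sigma> * R \<sigma> \<tau>"
    using assms(1) finite_F
    by (simp add: sum.remove[of F \<sigma>] if_distrib[where f = "\<lambda>x. x * _"] cong: if_cong)
  moreover have "(\<Sum>i\<in>F. a \<rho> * coef i \<rho> * R i \<tau>) = a \<rho> * R \<rho> \<tau>"
    by (simp add: real_coef[OF assms(2), of \<tau>] sum_distrib_left mult.assoc)
  ultimately show ?thesis
    by (simp add: sum_exchange[OF assms(1,3)] distrib_right sum.distrib)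
qed

text \<open>If the coefficient vanishes, the new column is a combination of the columns that stay.
  Otherwise the coordinate at \<open>\<sigma>\<close> forces \<open>a \<rho> = 0\<close> in every
  relation, and dividing by the coefficient recovers the column that was removed.\<close>

lemma exchange_spanning:
  assumes "\<sigma> \<in> F" "\<rho> \<in> E" "\<rho> \<notin> F"
  shows "(real_independent R (insert \<rho> (F - {\<sigma>})) \<and> real_span R (insert \<rho> (F - {\<sigma>})) = real_span R E)
    \<longleftrightarrow> coef \<sigma> \<rho> \<noteq> 0"
proof
  assume *: "real_independent R (insert \<rho> (F - {\<sigma>})) \<and> real_span R (insert \<rho> (F - {\<sigma>})) = real_span R E"
  show "coef \<sigma> \<rho> \<noteq> 0"
  proof
    assume c0: "coef \<sigma> \<rho> = 0"
    let ?a = "\<lambda>i. if i = \<rho> then 1 else - real_of_int (coef i \<rho>)"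
    have "(\<Sum>i\<in>insert \<rho> (F - {\<sigma>}). ?a i * R i \<tau>) = 0" for \<tau>
      unfolding real_combination_exchange[OF assms]
      using assms(1,3) c0 by (intro sum.neutral) auto
    then have "?a \<rho> = 0"
      using *[THEN conjunct1, unfolded real_independent_def, rule_format, of ?a \<rho>] by blast
    then show False by simp
  qed
next
  assume c: "coef \<sigma> \<rho> \<noteq> 0"
  have fin: "finite (insert \<rho> (F - {\<sigma>}))" using finite_F by simp
  have "real_independent R (insert \<rho> (F - {\<sigma>}))"
    unfolding real_independent_def
  proof (intro allI impI ballI)
    fix a i assume 0: "\<forall>\<tau>. (\<Sum>i\<in>insert \<rho> (F - {\<sigma>}). a i * R i \<tau>) = 0" and i: "i \<in> insert \<rho> (F - {\<sigma>})"
    have *: "\<forall>i\<in>F. a \<rho> * coef i \<rho> + (if i = \<sigma> then 0 else a i) = 0"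
      using 0 indep[unfolded real_independent_def, rule_format,
          of "\<lambda>i. a \<rho> * coef i \<rho> + (if i = \<sigma> then 0 else a i)"]
      unfolding real_combination_exchange[OF assms] by blast
    then have "a \<rho> = 0" using assms(1) c by force
    with * i show "a i = 0" by force
  qed
  moreover have "real_span R (insert \<rho> (F - {\<sigma>})) = real_span R E"
  proof
    show "real_span R (insert \<rho> (F - {\<sigma>})) \<subseteq> real_span R E"
      using assms F_subset by (intro real_span_least fin real_span_base finite_E) auto
    have "R i \<in> real_span R (insert \<rho> (F - {\<sigma>}))" if "i \<in> F" for i
    proof (cases "i = \<sigma>")
      case False
      then show ?thesis using that by (intro real_span_base fin) auto
    next
      case True
      \<comment> \<open>The expansion of the column \<open>\<rho>\<close> solved for the column
        \<open>\<sigma>\<close>.\<close>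
      let ?a = "\<lambda>i. if i = \<rho> then 1 / real_of_int (coef \<sigma> \<rho>) else - (coef i \<rho> / coef \<sigma> \<rho>)"
      have "(\<Sum>j\<in>insert \<rho> (F - {\<sigma>}). ?a j * R j \<tau>) = (\<Sum>j\<in>F. (if j = \<sigma> then 1 else 0) * R j \<tau>)" for \<tau>
        unfolding real_combination_exchange[OF assms]
        using assms(3) c by (intro sum.cong) auto
      also have "(\<Sum>j\<in>F. (if j = \<sigma> then 1 else 0) * R j \<tau>) = R \<sigma> \<tau>" for \<tau>
        using finite_F assms(1) by (simp add: if_distrib[where f = "\<lambda>x. x * _"] cong: if_cong)
      finally have "R \<sigma> = (\<lambda>\<tau>. \<Sum>j\<in>insert \<rho> (F - {\<sigma>}). ?a j * R j \<tau>)" by (intro ext) simp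
      then have "R \<sigma> \<in> real_span R (insert \<rho> (F - {\<sigma>}))" by (rule real_spanI)
      with True show ?thesis by simp
    qed
    then show "real_span R E \<subseteq> real_span R (insert \<rho> (F - {\<sigma>}))"
      unfolding span[symmetric] by (intro real_span_least finite_F)
  qed
  ultimately show "real_independent R (insert \<rho> (F - {\<sigma>})) \<and> real_span R (insert \<rho> (F - {\<sigma>})) = real_span R E" ..
qed

text \<open>Only the column \<open>\<rho>\<close> contributes to the coordinate at
  \<open>\<sigma>\<close>, always in multiples of \<open>coef \<sigma> \<rho>\<close>. The other
  coordinates impose no condition, since their columns are still available.\<close>

lemma lattice_exchange_iff:
  assumes "\<sigma> \<in> F" "\<rho> \<in> E" "\<rho> \<notin> F" "\<And>\<tau>. u \<tau> = (\<Sum>i\<in>F. a i * M \<tau> i)"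
  shows "u \<in> column_lattice M (insert \<rho> (F - {\<sigma>})) \<longleftrightarrow> coef \<sigma> \<rho> dvd a \<sigma>"
proof -
  have int_exchange: "(\<Sum>i\<in>insert \<rho> (F - {\<sigma>}). b i * M \<tau> i) =
    (\<Sum>i\<in>F. (b \<rho> * coef i \<rho> + (if i = \<sigma> then 0 else b i)) * M \<tau> i)" for b \<tau>
  proof -
    have "real_of_int (\<Sum>i\<in>insert \<rho> (F - {\<sigma>}). b i * M \<tau> i) =
      real_of_int (\<Sum>i\<in>F. (b \<rho> * coef i \<rho> + (if i = \<sigma> then 0 else b i)) * M \<tau> i)"
      using real_combination_exchange[OF assms(1-3), of "\<lambda>i. real_of_int (b i)" \<tau>]
      by (simp add: if_distrib[where f = real_of_int] cong: if_cong)
    then show ?thesis by linarith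
  qed
  show ?thesis
  proof
    assume "u \<in> column_lattice M (insert \<rho> (F - {\<sigma>}))"
    then obtain b where b: "\<And>\<tau>. u \<tau> = (\<Sum>i\<in>insert \<rho> (F - {\<sigma>}). b i * M \<tau> i)"
      by (rule column_latticeE) blast
    have "a \<sigma> - (b \<rho> * coef \<sigma> \<rho> + (if \<sigma> = \<sigma> then 0 else b \<sigma>)) = 0"
    proof (rule coefficients_zero[OF _ assms(1),
          where a = "\<lambda>i. a i - (b \<rho> * coef i \<rho> + (if i = \<sigma> then 0 else b i))"])
      fix \<tau>
      show "(\<Sum>i\<in>F. (a i - (b \<rho> * coef i \<rho> + (if i = \<sigma> then 0 else b i))) * M \<tau> i) = 0"
        using b[of \<tau>] assms(4)[of \<tau>] unfolding int_exchange
        by (simp only: left_diff_distrib sum_subtractf)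
    qed
    then show "coef \<sigma> \<rho> dvd a \<sigma>" by simp
  next
    assume "coef \<sigma> \<rho> dvd a \<sigma>"
    then obtain q where q: "a \<sigma> = coef \<sigma> \<rho> * q" by (rule dvdE)
    \<comment> \<open>The column \<open>\<rho>\<close> taken \<open>q\<close> times settles the
      coordinate at \<open>\<sigma>\<close>; what it adds to the other coordinates is subtracted
      again.\<close>
    let ?b = "\<lambda>i. if i = \<rho> then q else a i - q * coef i \<rho>"
    have "(\<Sum>i\<in>insert \<rho> (F - {\<sigma>}). ?b i * M \<tau> i) = (\<Sum>i\<in>F. a i * M \<tau> i)" for \<tau>
      unfolding int_exchange using assms(3) q by (intro sum.cong) auto
    then show "u \<in> column_lattice M (insert \<rho> (F - {\<sigma>}))"
      using assms(4) by (intro column_latticeI[where a = ?b] ext) simp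
  qed
qed

text \<open>The exchanged lattice has the lattice of \<open>F\<close> as its saturation, and two
  members of the latter are congruent iff their coordinates at \<open>\<sigma>\<close> agree modulo
  \<open>coef \<sigma> \<rho>\<close>. So the classes correspond to the residues.\<close>

lemma t_exchange:
  assumes "\<sigma> \<in> F" "\<rho> \<in> E" "\<rho> \<notin> F" "coef \<sigma> \<rho> \<noteq> 0"
  shows "int (t (insert \<rho> (F - {\<sigma>}))) = \<bar>coef \<sigma> \<rho>\<bar>"
proof -
  let ?F' = "insert \<rho> (F - {\<sigma>})" and ?c = "coef \<sigma> \<rho>"
  have sub: "?F' \<subseteq> E" using assms F_subset by auto
  have sub_lattice: "column_lattice M ?F' \<subseteq> column_lattice M F"
    using assms F_subset finite_F by (intro column_lattice_least column_in_lattice) auto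
  have sat: "saturation T (column_lattice M ?F') = column_lattice M F"
  proof
    show "saturation T (column_lattice M ?F') \<subseteq> column_lattice M F"
      using sub_lattice saturation_F unfolding saturation_def by blast
    show "column_lattice M F \<subseteq> saturation T (column_lattice M ?F')"
    proof
      fix u assume u: "u \<in> column_lattice M F"
      then obtain a where a: "\<And>\<tau>. u \<tau> = (\<Sum>i\<in>F. a i * M \<tau> i)" by (rule column_latticeE) blast
      have "(\<lambda>\<tau>. \<bar>?c\<bar> * u \<tau>) \<in> column_lattice M ?F'"
        by (subst lattice_exchange_iff[OF assms(1-3), where a = "\<lambda>i. \<bar>?c\<bar> * a i"])
           (simp_all add: a sum_distrib_left mult.assoc)
      then show "u \<in> saturation T (column_lattice M ?F')"
        unfolding saturation_def using assms(4) lattice_supp[OF u]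
        by (intro CollectI conjI exI[of _ "\<bar>?c\<bar>"]) auto
    qed
  qed
  \<comment> \<open>The multiples of the column \<open>\<sigma>\<close> represent all classes, since
    the class depends only on the coordinate at \<open>\<sigma>\<close>.\<close>
  define g where "g = (\<lambda>m. \<theta> ?F' (\<lambda>\<tau>. m * M \<tau> \<sigma>))"
  have col: "(\<lambda>\<tau>. m * M \<tau> \<sigma>) \<in> column_lattice M F" for m
    using column_lattice_scale[OF column_lattice_column[OF finite_F assms(1)]] .
  have eq: "\<theta> ?F' u = g m \<longleftrightarrow> ?c dvd a \<sigma> - m"
    if "u \<in> column_lattice M F" "\<And>\<tau>. u \<tau> = (\<Sum>i\<in>F. a i * M \<tau> i)" for u a m
  proof -
    have "u \<tau> - m * M \<tau> \<sigma> = (\<Sum>i\<in>F. (a i - (if i = \<sigma> then m else 0)) * M \<tau> i)" for \<tau>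
      using finite_F assms(1)
      by (simp add: that(2) left_diff_distrib sum_subtractf if_distrib[where f = "\<lambda>x. x * _"] cong: if_cong)
    from lattice_exchange_iff[OF assms(1-3), where u = "\<lambda>\<tau>. u \<tau> - m * M \<tau> \<sigma>", OF this] show ?thesis
      unfolding g_def using \<theta>_eq[OF sub, unfolded sat, OF that(1) col] by simp
  qed
  have g_eq: "g m' = g m \<longleftrightarrow> ?c dvd m' - m" for m m'
  proof -
    have "\<theta> ?F' (\<lambda>\<tau>. m' * M \<tau> \<sigma>) = g m \<longleftrightarrow> ?c dvd (if \<sigma> = \<sigma> then m' else 0) - m"
      using finite_F assms(1)
      by (intro eq[OF col, where a = "\<lambda>i. if i = \<sigma> then m' else 0"])
         (simp add: if_distrib[where f = "\<lambda>x. x * _"] cong: if_cong)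
    then show ?thesis by (simp add: g_def)
  qed
  have "bij_betw g {0..<\<bar>?c\<bar>} (\<theta> ?F' ` column_lattice M F)"
  proof (rule bij_betw_imageI)
    show "inj_on g {0..<\<bar>?c\<bar>}"
    proof (rule inj_onI)
      fix m m' assume m: "m \<in> {0..<\<bar>?c\<bar>}" "m' \<in> {0..<\<bar>?c\<bar>}" "g m = g m'"
      then have "\<bar>?c\<bar> dvd m - m'" using g_eq by simp
      then have "m mod \<bar>?c\<bar> = m' mod \<bar>?c\<bar>" by (simp add: mod_eq_dvd_iff)
      then show "m = m'" using m by simp
    qed
    show "g ` {0..<\<bar>?c\<bar>} = \<theta> ?F' ` column_lattice M F"
    proof
      show "g ` {0..<\<bar>?c\<bar>} \<subseteq> \<theta> ?F' ` column_lattice M F"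
        unfolding g_def using col by blast
      show "\<theta> ?F' ` column_lattice M F \<subseteq> g ` {0..<\<bar>?c\<bar>}"
      proof
        fix z assume "z \<in> \<theta> ?F' ` column_lattice M F"
        then obtain u where u: "u \<in> column_lattice M F" "z = \<theta> ?F' u" by blast
        then obtain a where a: "\<And>\<tau>. u \<tau> = (\<Sum>i\<in>F. a i * M \<tau> i)" by (elim column_latticeE) blast
        have "?c dvd a \<sigma> - a \<sigma> mod \<bar>?c\<bar>"
          using dvd_minus_mod[of "\<bar>?c\<bar>" "a \<sigma>"] abs_dvd_iff by blast
        then have "z = g (a \<sigma> mod \<bar>?c\<bar>)" using eq[OF u(1) a] u(2) by simp
        moreover have "a \<sigma> mod \<bar>?c\<bar> \<in> {0..<\<bar>?c\<bar>}" using assms(4) by simp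
        ultimately show "z \<in> g ` {0..<\<bar>?c\<bar>}" by blast
      qed
    qed
  qed
  then have "card (\<theta> ?F' ` column_lattice M F) = card {0..<\<bar>?c\<bar>}"
    by (rule bij_betw_same_card[symmetric])
  then show ?thesis using t_eq[OF sub] sat by simp
qed

text \<open>A functional that vanishes on the columns of \<open>F - {\<sigma>}\<close> takes on the
  column \<open>\<rho>\<close> the value \<open>coef \<sigma> \<rho>\<close> times its value on the
  column \<open>\<sigma>\<close>. If the coefficient is 0 both sides are false, so nonvanishing need
  not be assumed.\<close>

lemma sign_exchange:
  assumes "\<sigma> \<in> F" "\<rho> \<in> E"
  shows "same_side T (real_span R E) (real_span R (F - {\<sigma>})) (R \<sigma>) (R \<rho>) \<longleftrightarrow> coef \<sigma> \<rho> > 0"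
    (is "?same \<longleftrightarrow> _")
proof -
  have fin: "finite (F - {\<sigma>})" using finite_F by simp
  have pair: "(\<Sum>\<tau>\<in>T. y \<tau> * x \<tau>) = a \<sigma> * (\<Sum>\<tau>\<in>T. y \<tau> * R \<sigma> \<tau>)"
    if "\<And>\<rho>. \<rho> \<in> F - {\<sigma>} \<Longrightarrow> (\<Sum>\<tau>\<in>T. y \<tau> * R \<rho> \<tau>) = 0"
      "\<And>\<tau>. x \<tau> = (\<Sum>i\<in>F. a i * R i \<tau>)" for x y a
  proof -
    have "(\<Sum>\<tau>\<in>T. y \<tau> * x \<tau>) = (\<Sum>\<tau>\<in>T. \<Sum>i\<in>F. a i * (y \<tau> * R i \<tau>))"
      unfolding that(2) by (simp add: sum_distrib_left mult_ac)
    also have "\<dots> = (\<Sum>i\<in>F. a i * (\<Sum>\<tau>\<in>T. y \<tau> * R i \<tau>))"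
      by (subst sum.swap) (simp add: sum_distrib_left)
    also have "\<dots> = a \<sigma> * (\<Sum>\<tau>\<in>T. y \<tau> * R \<sigma> \<tau>)"
      using that(1) by (simp add: sum.remove[OF finite_F assms(1)])
    finally show ?thesis .
  qed
  have "coef \<sigma> \<rho> > 0" if ?same
  proof -
    from that obtain y where y: "real_span R (F - {\<sigma>}) = {x \<in> real_span R E. (\<Sum>\<tau>\<in>T. y \<tau> * x \<tau>) = 0}"
      "(\<Sum>\<tau>\<in>T. y \<tau> * R \<sigma> \<tau>) > 0" "(\<Sum>\<tau>\<in>T. y \<tau> * R \<rho> \<tau>) > 0"
      unfolding same_side_def by blast
    have "(\<Sum>\<tau>\<in>T. y \<tau> * R \<rho>' \<tau>) = 0" if "\<rho>' \<in> F - {\<sigma>}" for \<rho>'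
      using real_span_base[OF fin that, of R] unfolding y(1) by blast
    from pair[OF this real_coef[OF assms(2)]] y(2,3)
    show "coef \<sigma> \<rho> > 0" by (simp add: zero_less_mult_iff)
  qed
  moreover have ?same if c: "coef \<sigma> \<rho> > 0"
  proof -
    have "\<not> (\<exists>k>0. (\<lambda>\<tau>. k * M \<tau> \<sigma>) \<in> column_lattice M (F - {\<sigma>}))"
    proof
      assume "\<exists>k>0. (\<lambda>\<tau>. k * M \<tau> \<sigma>) \<in> column_lattice M (F - {\<sigma>})"
      then obtain k where k: "k > 0" "(\<lambda>\<tau>. k * M \<tau> \<sigma>) \<in> column_lattice M (F - {\<sigma>})" by blast
      from k(2) obtain a where a: "\<And>\<tau>. k * M \<tau> \<sigma> = (\<Sum>i\<in>F - {\<sigma>}. a i * M \<tau> i)"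
        by (rule column_latticeE) blast
      have "(if \<sigma> = \<sigma> then - k else a \<sigma>) = 0"
      proof (rule coefficients_zero[OF _ assms(1), where a = "\<lambda>i. if i = \<sigma> then - k else a i"])
        fix \<tau>
        have "(\<Sum>i\<in>F. (if i = \<sigma> then - k else a i) * M \<tau> i) =
          - k * M \<tau> \<sigma> + (\<Sum>i\<in>F - {\<sigma>}. a i * M \<tau> i)"
          by (simp add: sum.remove[OF finite_F assms(1)])
        then show "(\<Sum>i\<in>F. (if i = \<sigma> then - k else a i) * M \<tau> i) = 0" using a[of \<tau>] by simp
      qed
      with k(1) show False by simp
    qed
    with integral_Fredholm[OF fin finite_T, of "\<lambda>\<tau>. M \<tau> \<sigma>" M] supp
    obtain z where z: "\<forall>\<rho>\<in>F - {\<sigma>}. (\<Sum>\<tau>\<in>T. z \<tau> * M \<tau> \<rho>) = 0" "(\<Sum>\<tau>\<in>T. z \<tau> * M \<tau> \<sigma>) \<noteq> 0" by blast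
    \<comment> \<open>The sign orients the functional so that it is positive on the column
      \<open>\<sigma>\<close>.\<close>
    define y where "y = (\<lambda>\<tau>. real_of_int (sgn (\<Sum>\<tau>\<in>T. z \<tau> * M \<tau> \<sigma>) * z \<tau>))"
    have y_pair: "(\<Sum>\<tau>\<in>T. y \<tau> * R \<rho> \<tau>) =
        real_of_int (sgn (\<Sum>\<tau>\<in>T. z \<tau> * M \<tau> \<sigma>) * (\<Sum>\<tau>\<in>T. z \<tau> * M \<tau> \<rho>))" for \<rho>
      by (simp add: y_def sum_distrib_left mult.assoc)
    have y0: "\<And>\<rho>. \<rho> \<in> F - {\<sigma>} \<Longrightarrow> (\<Sum>\<tau>\<in>T. y \<tau> * R \<rho> \<tau>) = 0" using z(1) by (simp add: y_pair)
    have ypos: "(\<Sum>\<tau>\<in>T. y \<tau> * R \<sigma> \<tau>) > 0"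
    proof -
      have "sgn k * k = \<bar>k\<bar>" for k :: int
        by (simp add: abs_sgn mult.commute)
      then show ?thesis
        unfolding y_pair of_int_0_less_iff using z(2) by (simp only: zero_less_abs_iff not_False_eq_True)
    qed
    have "real_span R (F - {\<sigma>}) = {x \<in> real_span R E. (\<Sum>\<tau>\<in>T. y \<tau> * x \<tau>) = 0}"
    proof (intro equalityI subsetI CollectI conjI)
      fix x assume x: "x \<in> real_span R (F - {\<sigma>})"
      have "real_span R (F - {\<sigma>}) \<subseteq> real_span R E"
        using F_subset by (intro real_span_least fin real_span_base finite_E) auto
      then show "x \<in> real_span R E" using x by blast
      show "(\<Sum>\<tau>\<in>T. y \<tau> * x \<tau>) = 0" by (rule pairing_span_zero[OF x y0])
    next
      fix x assume "x \<in> {x \<in> real_span R E. (\<Sum>\<tau>\<in>T. y \<tau> * x \<tau>) = 0}"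
      then have x: "x \<in> real_span R F" "(\<Sum>\<tau>\<in>T. y \<tau> * x \<tau>) = 0" using span by auto
      from x(1) obtain a where a: "\<And>\<tau>. x \<tau> = (\<Sum>i\<in>F. a i * R i \<tau>)" by (rule real_spanE) blast
      have "a \<sigma> = 0" using pair[OF y0 a] x(2) ypos by simp
      then have "x = (\<lambda>\<tau>. \<Sum>i\<in>F - {\<sigma>}. a i * R i \<tau>)"
        using a by (intro ext) (simp add: sum.remove[OF finite_F assms(1)])
      then show "x \<in> real_span R (F - {\<sigma>})" by (rule real_spanI)
    qed
    moreover have "(\<Sum>\<tau>\<in>T. y \<tau> * R \<rho> \<tau>) > 0"
      using pair[OF y0 real_coef[OF assms(2)]] ypos c by simp
    ultimately show "same_side T (real_span R E) (real_span R (F - {\<sigma>})) (R \<sigma>) (R \<rho>)"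
      using ypos unfolding same_side_def by blast
  qed
  ultimately show ?thesis by blast
qed

text \<open>The integral left inverse, in the form of prescribed values on \<open>F\<close>. The
  divisibility test is where saturation enters: if \<open>k\<close> divides the pairing of
  \<open>x\<close> with every row, the combination of columns with coefficients \<open>x\<close> is
  \<open>k\<close> times an integral vector \<open>q\<close>; then \<open>q\<close> lies in the
  saturation, so it is itself a combination of columns, and independence shows that \<open>k\<close>
  divides \<open>x\<close>.\<close>

lemma row_functional_exists: "\<exists>y. \<forall>\<sigma>\<in>F. (\<Sum>\<tau>\<in>T. y \<tau> * M \<tau> \<sigma>) = w \<sigma>"
proof -
  let ?L = "range (\<lambda>y \<sigma>. \<Sum>\<tau>\<in>T. y \<tau> * M \<tau> \<sigma>)"
  have "\<exists>u\<in>?L. \<forall>\<sigma>\<in>F. u \<sigma> = w \<sigma>"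
  proof (rule unimodular_lattice_full[OF finite_F])
    fix u v assume "u \<in> ?L" "v \<in> ?L"
    then obtain y z where "u = (\<lambda>\<sigma>. \<Sum>\<tau>\<in>T. y \<tau> * M \<tau> \<sigma>)" "v = (\<lambda>\<sigma>. \<Sum>\<tau>\<in>T. z \<tau> * M \<tau> \<sigma>)" by blast
    then show "(\<lambda>\<sigma>. u \<sigma> + v \<sigma>) \<in> ?L"
      by (intro range_eqI[of _ _ "\<lambda>\<tau>. y \<tau> + z \<tau>"]) (simp add: distrib_right sum.distrib)
  next
    fix u k assume "u \<in> ?L"
    then obtain y where "u = (\<lambda>\<sigma>. \<Sum>\<tau>\<in>T. y \<tau> * M \<tau> \<sigma>)" by blast
    then show "(\<lambda>\<sigma>. k * u \<sigma>) \<in> ?L"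
      by (intro range_eqI[of _ _ "\<lambda>\<tau>. k * y \<tau>"]) (simp add: sum_distrib_left mult.assoc)
  next
    show "(\<lambda>\<sigma>. 0) \<in> ?L" by (intro range_eqI[of _ _ "\<lambda>\<tau>. 0"]) simp
  next
    fix k x assume k: "\<And>u. u \<in> ?L \<Longrightarrow> k dvd (\<Sum>\<sigma>\<in>F. u \<sigma> * x \<sigma>)"
    have "k dvd (\<Sum>\<sigma>\<in>F. x \<sigma> * M \<tau> \<sigma>)" for \<tau>
    proof (cases "\<tau> \<in> T")
      case True
      \<comment> \<open>A coordinate functional exhibits each row of the matrix as a member of the
        row lattice.\<close>
      have "(\<lambda>\<sigma>. M \<tau> \<sigma>) \<in> ?L"
        using finite_T True
        by (intro range_eqI[of _ _ "\<lambda>\<tau>'. if \<tau>' = \<tau> then 1 else 0"])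
           (simp add: if_distrib[where f = "\<lambda>x. x * _"] cong: if_cong)
      from k[OF this] show ?thesis by (simp add: mult.commute)
    qed (simp add: supp)
    then obtain q where q: "\<And>\<tau>. (\<Sum>\<sigma>\<in>F. x \<sigma> * M \<tau> \<sigma>) = k * q \<tau>" unfolding dvd_def by metis
    show "\<forall>\<sigma>\<in>F. k dvd x \<sigma>"
    proof (cases "k = 0")
      case True
      then show ?thesis using q coefficients_zero by simp
    next
      case False
      have "(\<lambda>\<tau>. \<bar>k\<bar> * q \<tau>) \<in> column_lattice M F"
      proof (rule column_latticeI[where a = "\<lambda>\<sigma>. sgn k * x \<sigma>"], rule ext)
        fix \<tau>
        have "(\<Sum>\<sigma>\<in>F. sgn k * x \<sigma> * M \<tau> \<sigma>) = sgn k * (k * q \<tau>)"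
          unfolding q[symmetric] by (simp add: mult.assoc sum_distrib_left)
        also have "\<dots> = \<bar>k\<bar> * q \<tau>" by (simp add: sgn_if abs_if)
        finally show "\<bar>k\<bar> * q \<tau> = (\<Sum>\<sigma>\<in>F. sgn k * x \<sigma> * M \<tau> \<sigma>)" by (rule sym)
      qed
      moreover have "q \<tau> = 0" if "\<tau> \<notin> T" for \<tau>
        using q[of \<tau>] False that supp by simp
      ultimately have "q \<in> saturation T (column_lattice M F)"
        unfolding saturation_def using False by (intro CollectI conjI exI[of _ "\<bar>k\<bar>"]) auto
      then have "q \<in> column_lattice M F" using saturation_F by blast
      then obtain b where b: "\<And>\<tau>. q \<tau> = (\<Sum>\<sigma>\<in>F. b \<sigma> * M \<tau> \<sigma>)" by (rule column_latticeE) blast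
      have "x \<sigma> - k * b \<sigma> = 0" if "\<sigma> \<in> F" for \<sigma>
      proof (rule coefficients_zero[OF _ that, where a = "\<lambda>\<sigma>. x \<sigma> - k * b \<sigma>"])
        fix \<tau>
        show "(\<Sum>\<sigma>\<in>F. (x \<sigma> - k * b \<sigma>) * M \<tau> \<sigma>) = 0"
          using q[of \<tau>] by (simp add: left_diff_distrib sum_subtractf b sum_distrib_left mult.assoc)
      qed
      then have "x \<sigma> = k * b \<sigma>" if "\<sigma> \<in> F" for \<sigma> using that by simp
      then show ?thesis by simp
    qed
  qed
  then show ?thesis by auto
qed

text \<open>A functional \<open>y\<close> applied to all columns gives the combination of the rows
  of \<open>coef\<close> whose coefficients are the values of \<open>y\<close> on the columns of
  \<open>F\<close>. So spanning amounts to realizing arbitrary integer values on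
  \<open>F\<close>.\<close>

lemma integral_basis_coef:
  assumes "\<And>\<sigma> \<kappa>. \<sigma> \<in> F \<Longrightarrow> b \<sigma> \<kappa> = (if \<kappa> \<in> E then coef \<sigma> \<kappa> else 0)"
  shows "integral_basis b F {v. \<exists>y. v = (\<lambda>\<sigma>. if \<sigma> \<in> E then \<Sum>\<tau>\<in>T. M \<tau> \<sigma> * y \<tau> else 0)}"
  unfolding integral_basis_def
proof (intro conjI allI impI ballI)
  fix a \<sigma> assume 0: "\<forall>\<kappa>. (\<Sum>i\<in>F. a i * b i \<kappa>) = 0" and \<sigma>: "\<sigma> \<in> F"
  have "(\<Sum>i\<in>F. a i * b i \<sigma>) = (\<Sum>i\<in>F. if i = \<sigma> then a i else 0)"
    using \<sigma> F_subset by (intro sum.cong) (auto simp: assms coef_F)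
  then show "a \<sigma> = 0" using 0 \<sigma> finite_F by simp
next
  have expand: "(\<Sum>\<tau>\<in>T. M \<tau> \<kappa> * y \<tau>) = (\<Sum>i\<in>F. (\<Sum>\<tau>\<in>T. y \<tau> * M \<tau> i) * coef i \<kappa>)"
    if "\<kappa> \<in> E" for y \<kappa>
  proof -
    have "(\<Sum>\<tau>\<in>T. M \<tau> \<kappa> * y \<tau>) = (\<Sum>\<tau>\<in>T. \<Sum>i\<in>F. y \<tau> * M \<tau> i * coef i \<kappa>)"
      by (intro sum.cong refl) (simp add: coef[OF that] sum_distrib_left mult_ac)
    then show ?thesis by (simp add: sum.swap[of _ F] sum_distrib_right)
  qed
  have comb: "(\<lambda>\<kappa>. \<Sum>i\<in>F. a i * b i \<kappa>) = (\<lambda>\<kappa>. if \<kappa> \<in> E then \<Sum>i\<in>F. a i * coef i \<kappa> else 0)" for a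
    by (intro ext) (auto simp: assms)
  show "{v. \<exists>y. v = (\<lambda>\<sigma>. if \<sigma> \<in> E then \<Sum>\<tau>\<in>T. M \<tau> \<sigma> * y \<tau> else 0)} =
    {v. \<exists>a. v = (\<lambda>\<kappa>. \<Sum>i\<in>F. a i * b i \<kappa>)}"
  proof (intro equalityI subsetI CollectI)
    fix v assume "v \<in> {v. \<exists>y. v = (\<lambda>\<sigma>. if \<sigma> \<in> E then \<Sum>\<tau>\<in>T. M \<tau> \<sigma> * y \<tau> else 0)}"
    then obtain y where v: "v = (\<lambda>\<sigma>. if \<sigma> \<in> E then \<Sum>\<tau>\<in>T. M \<tau> \<sigma> * y \<tau> else 0)" by blast
    then show "\<exists>a. v = (\<lambda>\<kappa>. \<Sum>i\<in>F. a i * b i \<kappa>)"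
      unfolding comb by (intro exI[of _ "\<lambda>i. \<Sum>\<tau>\<in>T. y \<tau> * M \<tau> i"]) (auto simp: expand)
  next
    fix v assume "v \<in> {v. \<exists>a. v = (\<lambda>\<kappa>. \<Sum>i\<in>F. a i * b i \<kappa>)}"
    then obtain a where v: "v = (\<lambda>\<kappa>. if \<kappa> \<in> E then \<Sum>i\<in>F. a i * coef i \<kappa> else 0)"
      unfolding comb by blast
    obtain y where y: "\<forall>\<sigma>\<in>F. (\<Sum>\<tau>\<in>T. y \<tau> * M \<tau> \<sigma>) = a \<sigma>" using row_functional_exists by blast
    have "v = (\<lambda>\<sigma>. if \<sigma> \<in> E then \<Sum>\<tau>\<in>T. M \<tau> \<sigma> * y \<tau> else 0)"
      unfolding v using y by (intro ext) (auto simp: expand)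
    then show "\<exists>y. v = (\<lambda>\<sigma>. if \<sigma> \<in> E then \<Sum>\<tau>\<in>T. M \<tau> \<sigma> * y \<tau> else 0)" by blast
  qed
qed

end

section \<open>The ball and its radial expansion\<close>

text \<open>The product topology on functions \<open>nat \<Rightarrow> real\<close> is their type
  class topology, which makes \<open>compact\<close>, \<open>closed\<close> and
  \<open>continuous_on\<close> available for the ball.\<close>

lemma nball_top_of_set: "nball n = top_of_set {x. (\<forall>i\<ge>n. x i = 0) \<and> (\<Sum>i<n. x i ^ 2) \<le> 1}"
  by (simp add: nball_def Euclidean_space_def euclidean_product_topology subtopology_subtopology
      Collect_conj_eq)

lemma topspace_nball: "topspace (nball n) = {x. (\<forall>i\<ge>n. x i = 0) \<and> (\<Sum>i<n. x i ^ 2) \<le> 1}"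
  by (simp add: nball_top_of_set)

lemma ball_boundary_eq: "ball_boundary n = {x. (\<forall>i\<ge>n. x i = 0) \<and> (\<Sum>i<n. x i ^ 2) = 1}"
  by (auto simp: ball_boundary_def topspace_nball)

lemma ball_interior_eq: "ball_interior n = {x. (\<forall>i\<ge>n. x i = 0) \<and> (\<Sum>i<n. x i ^ 2) < 1}"
  by (auto simp: ball_interior_def topspace_nball)

lemma ball_boundary_Un_interior: "ball_boundary n \<union> ball_interior n = topspace (nball n)"
  by (auto simp: ball_boundary_eq ball_interior_eq topspace_nball)

lemma ball_boundary_Int_interior: "ball_boundary n \<inter> ball_interior n = {}"
  by (auto simp: ball_boundary_eq ball_interior_eq)

lemma ball_interior_subset: "ball_interior n \<subseteq> topspace (nball n)"
  using ball_boundary_Un_interior by blast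

lemma continuous_on_sum_squares:
  "continuous_on UNIV (\<lambda>x :: nat \<Rightarrow> real. \<Sum>i<n. x i ^ 2)"
  by (intro continuous_intros continuous_on_product_coordinates)

lemma compact_space_nball: "compact_space (nball n)"
proof -
  let ?D = "{x :: nat \<Rightarrow> real. (\<forall>i\<ge>n. x i = 0) \<and> (\<Sum>i<n. x i ^ 2) \<le> 1}"
  have "compactin (product_topology (\<lambda>i :: nat. euclideanreal) UNIV) (PiE UNIV (\<lambda>i. {-1..1}))"
    by (simp add: compactin_PiE)
  then have c: "compact (PiE UNIV (\<lambda>i :: nat. {-1..1 :: real}))"
    by (simp add: euclidean_product_topology)
  have "?D = (\<Inter>i\<in>{n..}. {x. x i = 0}) \<inter> {x. (\<Sum>i<n. x i ^ 2) \<le> 1}" by auto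
  moreover have "closed {x :: nat \<Rightarrow> real. (\<Sum>i<n. x i ^ 2) \<le> 1}"
    by (intro closed_Collect_le continuous_on_sum_squares continuous_on_const)
  moreover have "closed {x :: nat \<Rightarrow> real. x i = 0}" for i
    by (intro closed_Collect_eq continuous_on_product_coordinates continuous_on_const)
  ultimately have closed: "closed ?D" by (auto intro!: closed_Int closed_INT)
  have "?D \<subseteq> PiE UNIV (\<lambda>i :: nat. {-1..1 :: real})"
  proof (intro subsetI PiE_I)
    fix x :: "nat \<Rightarrow> real" and i assume x: "x \<in> ?D"
    have "x i ^ 2 \<le> 1"
    proof (cases "i < n")
      case True
      then have "x i ^ 2 \<le> (\<Sum>i<n. x i ^ 2)" by (intro member_le_sum) auto
      with x show ?thesis by simp
    qed (use x in simp)
    then show "x i \<in> {-1..1}" using abs_le_square_iff[of "x i" 1] by (auto simp: abs_le_iff)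
  qed simp
  then have "?D \<inter> PiE UNIV (\<lambda>i :: nat. {-1..1 :: real}) = ?D" by (rule inf.absorb1)
  with closed_Int_compact[OF closed c] have "compact ?D" by simp
  then show ?thesis by (simp add: nball_top_of_set compact_space_subtopology)
qed

text \<open>At time \<open>t\<close> the concentric ball of radius \<open>1 - t / 2\<close> is
  stretched linearly onto the whole ball, and the shell outside it is projected to the sphere. For
  \<open>t \<le> 1\<close> the denominator is at least 1/2, so the centre causes no
  discontinuity.\<close>

definition radial :: "nat \<Rightarrow> real \<Rightarrow> (nat \<Rightarrow> real) \<Rightarrow> nat \<Rightarrow> real" where
  "radial n t x = (\<lambda>i. x i / max (sqrt (\<Sum>i<n. x i ^ 2)) (1 - t / 2))"

lemma radial_sum_squares:
  "(\<Sum>i<n. radial n t x i ^ 2) = (\<Sum>i<n. x i ^ 2) / max (sqrt (\<Sum>i<n. x i ^ 2)) (1 - t / 2) ^ 2"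
  by (simp add: radial_def power_divide sum_divide_distrib)

lemma radial_in_nball:
  assumes "x \<in> topspace (nball n)" "t \<le> 1"
  shows "radial n t x \<in> topspace (nball n)"
proof -
  let ?q = "\<Sum>i<n. x i ^ 2" and ?m = "max (sqrt (\<Sum>i<n. x i ^ 2)) (1 - t / 2)"
  have "?m > 0" using assms(2) by (simp add: less_max_iff_disj)
  moreover have "?q \<le> ?m ^ 2"
    by (metis max.cobounded1 power_mono real_sqrt_ge_0_iff real_sqrt_pow2 sum_nonneg zero_le_power2)
  ultimately have "?q / ?m ^ 2 \<le> 1" by (simp add: divide_le_eq)
  then show ?thesis using assms(1) by (simp add: topspace_nball radial_sum_squares) (simp add: radial_def)
qed

lemma radial_boundary:
  assumes "x \<in> ball_boundary n" "0 \<le> t"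
  shows "radial n t x = x"
  using assms by (intro ext) (simp add: radial_def ball_boundary_eq)

lemma radial_0:
  assumes "x \<in> topspace (nball n)"
  shows "radial n 0 x = x"
  using assms by (intro ext) (simp add: radial_def topspace_nball max_def)

text \<open>The bound is on the square: radius at least 1/2, exactly the points that
  \<open>radial\<close> carries to the sphere at time 1.\<close>

definition ball_collar :: "nat \<Rightarrow> (nat \<Rightarrow> real) set" where
  "ball_collar n = {x \<in> topspace (nball n). (\<Sum>i<n. x i ^ 2) \<ge> 1/4}"

lemma ball_boundary_subset_collar: "ball_boundary n \<subseteq> ball_collar n"
  by (auto simp: ball_collar_def ball_boundary_def)

lemma radial_1_collar:
  assumes "x \<in> ball_collar n"
  shows "radial n 1 x \<in> ball_boundary n"
proof -
  have q: "(\<Sum>i<n. x i ^ 2) \<ge> 1/4" using assms by (simp add: ball_collar_def)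
  then have "sqrt (\<Sum>i<n. x i ^ 2) \<ge> 1/2"
    by (intro real_le_rsqrt) (simp add: power_divide)
  then have "(\<Sum>i<n. radial n 1 x i ^ 2) = 1"
    using q unfolding radial_sum_squares by (subst max.absorb1) simp_all
  then show ?thesis
    using radial_in_nball[of x n 1] assms by (simp add: ball_boundary_def ball_collar_def)
qed

text \<open>Inside the ball the denominator of \<open>radial\<close> is at most 1, so norms do not
  decrease.\<close>

lemma radial_collar:
  assumes "x \<in> ball_collar n" "0 \<le> t" "t \<le> 1"
  shows "radial n t x \<in> ball_collar n"
proof -
  let ?q = "\<Sum>i<n. x i ^ 2" and ?m = "max (sqrt (\<Sum>i<n. x i ^ 2)) (1 - t / 2)"
  have q: "?q \<ge> 1/4" "?q \<le> 1" using assms(1) by (auto simp: ball_collar_def topspace_nball)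
  have m: "?m > 0" "?m \<le> 1" using assms q by (auto simp: less_max_iff_disj)
  then have "?m ^ 2 \<le> 1" "?m ^ 2 > 0" by (auto intro: power_le_one)
  then have "?q \<le> ?q / ?m ^ 2" using q by (simp add: le_divide_eq mult_left_le)
  then have "(\<Sum>i<n. radial n t x i ^ 2) \<ge> 1/4" using q unfolding radial_sum_squares by linarith
  then show ?thesis
    using radial_in_nball[of x n t] assms by (simp add: ball_collar_def)
qed

lemma prod_interval_nball:
  "prod_topology (top_of_set {0..1 :: real}) (nball n) = top_of_set ({0..1} \<times> topspace (nball n))"
  by (simp add: nball_top_of_set prod_topology_subtopology_eu)

lemma continuous_map_radial:
  "continuous_map (prod_topology (top_of_set {0..1}) (nball n)) (nball n) (\<lambda>(t, x). radial n t x)"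
proof -
  let ?A = "{0..1 :: real} \<times> topspace (nball n)"
  have coord: "continuous_on ?A (\<lambda>p. snd p i)" for i
    by (rule continuous_on_compose2[OF continuous_on_product_coordinates[of i]])
       (auto intro: continuous_intros)
  have "continuous_on ?A (\<lambda>p. radial n (fst p) (snd p))"
  proof (rule continuous_on_coordinatewise_then_product)
    fix i
    have "max (sqrt (\<Sum>i<n. (snd p i)\<^sup>2)) (1 - fst p / 2) \<noteq> 0" if "p \<in> ?A" for p :: "real \<times> (nat \<Rightarrow> real)"
    proof -
      have "1 - fst p / 2 > 0" using that by auto
      then show ?thesis by linarith
    qed
    then show "continuous_on ?A (\<lambda>p. radial n (fst p) (snd p) i)"
      unfolding radial_def by (intro continuous_intros coord) auto
  qed
  moreover have "radial n t x \<in> topspace (nball n)" if "t \<in> {0..1}" "x \<in> topspace (nball n)" for t x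
    using that by (intro radial_in_nball) auto
  ultimately show ?thesis
    unfolding prod_interval_nball
    by (subst (2) nball_top_of_set) (auto simp: continuous_map_in_subtopology case_prod_unfold topspace_nball)
qed

lemma closedin_nball_ge: "closedin (nball n) {x \<in> topspace (nball n). (\<Sum>i<n. x i ^ 2) \<ge> c}"
proof -
  have "closed {x :: nat \<Rightarrow> real. c \<le> (\<Sum>i<n. x i ^ 2)}"
    by (intro closed_Collect_le continuous_on_sum_squares continuous_on_const)
  moreover have "{x \<in> topspace (nball n). (\<Sum>i<n. x i ^ 2) \<ge> c} =
      {x. (\<forall>i\<ge>n. x i = 0) \<and> (\<Sum>i<n. x i ^ 2) \<le> 1} \<inter> {x. c \<le> (\<Sum>i<n. x i ^ 2)}"
    by (auto simp: topspace_nball)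
  ultimately show ?thesis by (simp add: nball_top_of_set closedin_closed_Int)
qed

lemma closedin_nball_le: "closedin (nball n) {x \<in> topspace (nball n). (\<Sum>i<n. x i ^ 2) \<le> c}"
proof -
  have "closed {x :: nat \<Rightarrow> real. (\<Sum>i<n. x i ^ 2) \<le> c}"
    by (intro closed_Collect_le continuous_on_sum_squares continuous_on_const)
  moreover have "{x \<in> topspace (nball n). (\<Sum>i<n. x i ^ 2) \<le> c} =
      {x. (\<forall>i\<ge>n. x i = 0) \<and> (\<Sum>i<n. x i ^ 2) \<le> 1} \<inter> {x. (\<Sum>i<n. x i ^ 2) \<le> c}"
    by (auto simp: topspace_nball)
  ultimately show ?thesis by (simp add: nball_top_of_set closedin_closed_Int)
qed

lemma closedin_ball_boundary: "closedin (nball n) (ball_boundary n)"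
proof -
  have "ball_boundary n = {x \<in> topspace (nball n). (\<Sum>i<n. x i ^ 2) \<ge> 1}"
    by (auto simp: ball_boundary_eq topspace_nball)
  then show ?thesis using closedin_nball_ge[of n 1] by simp
qed

lemma contractible_space_nball: "contractible_space (nball n)"
proof -
  let ?h = "\<lambda>(t :: real, x :: nat \<Rightarrow> real) i. (1 - t) * x i"
  let ?A = "{0..1 :: real} \<times> topspace (nball n)"
  have coord: "continuous_on ?A (\<lambda>p. snd p i)" for i
    by (rule continuous_on_compose2[OF continuous_on_product_coordinates[of i]])
       (auto intro: continuous_intros)
  have "continuous_on ?A (\<lambda>p i. (1 - fst p) * snd p i)"
    by (intro continuous_on_coordinatewise_then_product continuous_intros coord)
  moreover have "(\<lambda>i. (1 - t) * x i) \<in> topspace (nball n)"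
    if "t \<in> {0..1}" "x \<in> topspace (nball n)" for t and x :: "nat \<Rightarrow> real"
  proof -
    have "(\<Sum>i<n. ((1 - t) * x i) ^ 2) = (1 - t) ^ 2 * (\<Sum>i<n. x i ^ 2)"
      by (simp add: power_mult_distrib sum_distrib_left)
    also have "\<dots> \<le> 1 * 1"
      using that by (intro mult_mono power_le_one sum_nonneg) (auto simp: topspace_nball)
    finally show ?thesis using that by (simp add: topspace_nball)
  qed
  ultimately have "continuous_map (prod_topology (top_of_set {0..1}) (nball n)) (nball n) ?h"
    unfolding prod_interval_nball
    by (subst (2) nball_top_of_set) (auto simp: continuous_map_in_subtopology case_prod_unfold topspace_nball)
  then show ?thesis
    unfolding contractible_space_def homotopic_with_def
    by (intro exI[of _ "\<lambda>i. 0"] exI[of _ ?h]) auto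
qed

lemma subtopology_ball_boundary: "subtopology (nball (Suc n)) (ball_boundary (Suc n)) = nsphere n"
proof -
  have "subtopology (nball (Suc n)) (ball_boundary (Suc n)) =
      top_of_set ({x. (\<forall>i\<ge>Suc n. x i = 0) \<and> (\<Sum>i<Suc n. x i ^ 2) \<le> 1} \<inter> ball_boundary (Suc n))"
    by (simp only: nball_top_of_set subtopology_subtopology)
  also have "{x. (\<forall>i\<ge>Suc n. x i = 0) \<and> (\<Sum>i<Suc n. x i ^ 2) \<le> 1} \<inter> ball_boundary (Suc n) =
      {x. \<forall>i\<ge>Suc n. x i = 0} \<inter> {x. (\<Sum>i\<le>n. x i ^ 2) = 1}"
    unfolding ball_boundary_eq lessThan_Suc_atMost by auto
  finally show ?thesis
    by (simp add: nsphere_def Euclidean_space_def euclidean_product_topology subtopology_subtopology)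
qed

section \<open>Attaching one cell\<close>

text \<open>The space \<open>Y\<close> defined below is a subspace of the ambient \<open>X\<close>,
  not a quotient of a disjoint union. Compactness of the ball and the Hausdorff property replace the
  quotient topology.\<close>

locale cell_attachment =
  fixes X :: "'a topology" and B :: "'a set" and n :: nat and \<Phi> :: "(nat \<Rightarrow> real) \<Rightarrow> 'a"
  assumes Hausdorff: "Hausdorff_space X"
    and closed_base: "closedin X B"
    and continuous: "continuous_map (nball n) X \<Phi>"
    and embedding: "embedding_map (subtopology (nball n) (ball_interior n)) X \<Phi>"
    and boundary: "\<Phi> ` ball_boundary n \<subseteq> B"
    and interior: "\<Phi> ` ball_interior n \<inter> B = {}"
begin

definition Y :: "'a topology" where "Y = subtopology X (B \<union> \<Phi> ` ball_interior n)"

lemma base_subset: "B \<subseteq> topspace X"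
  using closed_base closedin_subset by blast

lemma image_subset: "\<Phi> ` topspace (nball n) \<subseteq> topspace X"
  using continuous continuous_map_image_subset_topspace by blast

lemma topspace_Y: "topspace Y = B \<union> \<Phi> ` ball_interior n"
  using base_subset image_subset ball_interior_subset[of n] unfolding Y_def topspace_subtopology by blast

lemma Hausdorff_Y: "Hausdorff_space Y"
  unfolding Y_def by (rule Hausdorff_space_subtopology[OF Hausdorff])

lemma image_in_Y: "x \<in> topspace (nball n) \<Longrightarrow> \<Phi> x \<in> topspace Y"
  using boundary ball_boundary_Un_interior[of n] unfolding topspace_Y by blast

lemma continuous_Y: "continuous_map (nball n) Y \<Phi>"
  unfolding Y_def continuous_map_in_subtopology
  using continuous image_in_Y unfolding topspace_Y by auto

lemma closedin_base_Y: "closedin Y B"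
  unfolding Y_def using closed_base by (intro closedin_subset_topspace) auto

lemma inj_interior: "inj_on \<Phi> (ball_interior n)"
  using embedding ball_interior_subset[of n]
  by (auto simp: embedding_map_def dest!: homeomorphic_imp_injective_map simp: Int_absorb1)

text \<open>The radial expansion carried over to \<open>Y\<close>. The inverse is taken on the
  interior of the ball only, where \<open>\<Phi>\<close> is injective.\<close>

definition push :: "real \<Rightarrow> 'a \<Rightarrow> 'a" where
  "push t y = (if y \<in> B then y else \<Phi> (radial n t (inv_into (ball_interior n) \<Phi> y)))"

text \<open>On the sphere \<open>radial\<close> is the identity and \<open>\<Phi>\<close> lands in
  the base, so the two clauses of \<open>push\<close> are compatible. Hence \<open>\<Phi>\<close>
  intertwines the deformations on the whole closed ball although it may identify boundary
  points.\<close>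

lemma push_image:
  assumes "x \<in> topspace (nball n)" "0 \<le> t"
  shows "push t (\<Phi> x) = \<Phi> (radial n t x)"
proof (cases "x \<in> ball_boundary n")
  case True
  then show ?thesis using boundary assms by (auto simp: push_def radial_boundary)
next
  case False
  then have "x \<in> ball_interior n" using assms ball_boundary_Un_interior[of n] by blast
  then show ?thesis using interior inj_interior by (auto simp: push_def)
qed

lemma push_base: "y \<in> B \<Longrightarrow> push t y = y"
  by (simp add: push_def)

lemma topspace_Y_cases:
  assumes "y \<in> topspace Y"
  obtains "y \<in> B" | x where "x \<in> ball_interior n" "y = \<Phi> x"
  using assms unfolding topspace_Y by blast

lemma push_in_Y:
  assumes "y \<in> topspace Y" "0 \<le> t" "t \<le> 1"
  shows "push t y \<in> topspace Y"
  using assms(1)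
proof (cases rule: topspace_Y_cases)
  case 1
  then show ?thesis by (simp add: push_base topspace_Y)
next
  case (2 x)
  then have "x \<in> topspace (nball n)" using ball_interior_subset by blast
  then show ?thesis using 2 assms(2,3) by (simp add: push_image image_in_Y radial_in_nball)
qed

text \<open>The preimage of a closed set splits into its part over \<open>B\<close> and the image of a compact
  subset of the cylinder over the ball.\<close>

lemma continuous_map_push:
  "continuous_map (prod_topology (top_of_set {0..1}) Y) Y (\<lambda>(t, y). push t y)"
  unfolding continuous_map_closedin
proof (intro conjI allI impI)
  let ?I = "top_of_set {0..1 :: real}"
  show "(\<lambda>(t, y). push t y) \<in> topspace (prod_topology ?I Y) \<rightarrow> topspace Y"
    by (auto intro: push_in_Y)
  fix C assume C: "closedin Y C"
  define K where "K = {p \<in> topspace (prod_topology ?I (nball n)). (\<Phi> \<circ> (\<lambda>(t, x). radial n t x)) p \<in> C}"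
  define g where "g = (\<lambda>p :: real \<times> (nat \<Rightarrow> real). (fst p, \<Phi> (snd p)))"
  have "closedin (prod_topology ?I (nball n)) K"
    unfolding K_def
    by (rule closedin_continuous_map_preimage[OF continuous_map_compose[OF continuous_map_radial continuous_Y] C])
  moreover have "compact_space (prod_topology ?I (nball n))"
    by (simp add: compact_space_prod_topology compact_space_nball compact_space_subtopology)
  ultimately have "compactin (prod_topology ?I (nball n)) K" by (rule closedin_compact_space[rotated])
  moreover have "continuous_map (prod_topology ?I (nball n)) (prod_topology ?I Y) g"
    unfolding g_def
    by (intro continuous_map_pairedI continuous_map_fst continuous_map_compose[OF continuous_map_snd continuous_Y, unfolded o_def])
  ultimately have "compactin (prod_topology ?I Y) (g ` K)" by (rule image_compactin)
  moreover have "Hausdorff_space (prod_topology ?I Y)"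
    by (simp add: Hausdorff_space_prod_topology Hausdorff_Y Hausdorff_space_subtopology)
  ultimately have "closedin (prod_topology ?I Y) (g ` K)" by (rule compactin_imp_closedin[rotated])
  moreover have "closedin (prod_topology ?I Y) ({0..1} \<times> (B \<inter> C))"
    unfolding closedin_prod_Times_iff using C closedin_base_Y by (auto intro: closedin_Int)
  moreover have "{p \<in> topspace (prod_topology ?I Y). (case p of (t, y) \<Rightarrow> push t y) \<in> C} =
      {0..1} \<times> (B \<inter> C) \<union> g ` K"
  proof (intro equalityI subsetI)
    fix p assume p: "p \<in> {p \<in> topspace (prod_topology ?I Y). (case p of (t, y) \<Rightarrow> push t y) \<in> C}"
    obtain t y where ty: "p = (t, y)" by fastforce
    with p have *: "t \<in> {0..1}" "y \<in> topspace Y" "push t y \<in> C" by auto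
    from *(2) show "p \<in> {0..1} \<times> (B \<inter> C) \<union> g ` K"
    proof (cases rule: topspace_Y_cases)
      case 1
      then show ?thesis using * ty by (simp add: push_base)
    next
      case (2 x)
      then have x: "x \<in> topspace (nball n)" using ball_interior_subset by blast
      then have "(t, x) \<in> K" using * 2 by (simp add: K_def push_image)
      then have "g (t, x) \<in> g ` K" by (rule imageI)
      then show ?thesis using 2 ty by (simp add: g_def)
    qed
  next
    fix p assume "p \<in> {0..1} \<times> (B \<inter> C) \<union> g ` K"
    then show "p \<in> {p \<in> topspace (prod_topology ?I Y). (case p of (t, y) \<Rightarrow> push t y) \<in> C}"
    proof
      assume "p \<in> {0..1} \<times> (B \<inter> C)"
      then show ?thesis by (auto simp: push_base topspace_Y)
    next
      assume "p \<in> g ` K"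
      then obtain t x where "p = (t, \<Phi> x)" "(t, x) \<in> K" by (auto simp: g_def)
      then show ?thesis by (auto simp: K_def push_image image_in_Y)
    qed
  qed
  ultimately show "closedin (prod_topology ?I Y)
      {p \<in> topspace (prod_topology ?I Y). (case p of (t, y) \<Rightarrow> push t y) \<in> C}"
    by (simp add: closedin_Un)
qed

definition N :: "'a set" where "N = B \<union> \<Phi> ` ball_collar n"

lemma push_N:
  assumes "y \<in> N" "0 \<le> t" "t \<le> 1"
  shows "push t y \<in> N"
  using assms radial_collar push_image push_base unfolding N_def ball_collar_def by fastforce

lemma push_1_N:
  assumes "y \<in> N"
  shows "push 1 y \<in> B"
proof (cases "y \<in> B")
  case False
  then obtain x where x: "x \<in> ball_collar n" "y = \<Phi> x" using assms by (auto simp: N_def)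
  then have "push 1 y = \<Phi> (radial n 1 x)" by (simp add: push_image ball_collar_def)
  then show ?thesis using radial_1_collar[OF x(1)] boundary by auto
qed (simp add: push_base)

lemma push_0:
  assumes "y \<in> topspace Y"
  shows "push 0 y = y"
  using assms
proof (cases rule: topspace_Y_cases)
  case (2 x)
  then have "x \<in> topspace (nball n)" using ball_interior_subset by blast
  then show ?thesis using 2 by (simp add: push_image radial_0)
qed (simp add: push_base)

end

section \<open>Deformations of pairs and their effect on relative homology\<close>

lemma homotopic_with_id_final_map:
  fixes h :: "real \<Rightarrow> 'a \<Rightarrow> 'a"
  assumes "continuous_map (prod_topology (top_of_set {0..1}) X) X (\<lambda>(t, x). h t x)"
    and "\<And>x. x \<in> topspace X \<Longrightarrow> h 0 x = x"
    and "\<And>t x. \<lbrakk>x \<in> S; 0 \<le> t; t \<le> 1\<rbrakk> \<Longrightarrow> h t x \<in> S" and "S \<subseteq> topspace X"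
  shows "homotopic_with (\<lambda>k. k \<in> S \<rightarrow> S) X X (h 1) id"
proof -
  have "homotopic_with (\<lambda>k. k \<in> S \<rightarrow> S) X X (h 0) (h 1)"
    unfolding homotopic_with_def using assms(1,3)
    by (intro exI[of _ "\<lambda>(t, x). h t x"]) auto
  then have "homotopic_with (\<lambda>k. k \<in> S \<rightarrow> S) X X (h 1) (h 0)"
    by (simp add: homotopic_with_sym)
  moreover have "homotopic_with (\<lambda>k. k \<in> S \<rightarrow> S) X X (h 0) id"
    using assms homotopic_with_imp_continuous_maps[OF calculation]
    by (intro homotopic_with_equal) auto
  ultimately show ?thesis by (rule homotopic_with_trans)
qed

text \<open>The final map \<open>h 1\<close> is a homotopy inverse of the inclusion of pairs: both
  composites are \<open>h 1\<close>, and \<open>h\<close> connects it to the identity while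
  preserving \<open>S\<close> and \<open>T\<close>.\<close>

lemma deformation_relative_homology_iso:
  fixes h :: "real \<Rightarrow> 'a \<Rightarrow> 'a"
  assumes "continuous_map (prod_topology (top_of_set {0..1}) X) X (\<lambda>(t, x). h t x)"
    and "\<And>x. x \<in> topspace X \<Longrightarrow> h 0 x = x"
    and "S \<subseteq> T" "T \<subseteq> topspace X"
    and "\<And>t x. \<lbrakk>x \<in> S; 0 \<le> t; t \<le> 1\<rbrakk> \<Longrightarrow> h t x \<in> S"
    and "\<And>t x. \<lbrakk>x \<in> T; 0 \<le> t; t \<le> 1\<rbrakk> \<Longrightarrow> h t x \<in> T"
    and "\<And>x. x \<in> T \<Longrightarrow> h 1 x \<in> S"
  shows "hom_induced p X S X T id \<in> iso (relative_homology_group p X S) (relative_homology_group p X T)"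
proof (rule homotopy_equivalence_relative_homology_group_isomorphism[where g = "h 1"])
  have S: "homotopic_with (\<lambda>k. k \<in> S \<rightarrow> S) X X (h 1) id"
    using assms by (intro homotopic_with_id_final_map) auto
  have T: "homotopic_with (\<lambda>k. k \<in> T \<rightarrow> T) X X (h 1) id"
    using assms by (intro homotopic_with_id_final_map) auto
  show "homotopic_with (\<lambda>k. k \<in> S \<rightarrow> S) X X (h 1 \<circ> id) id" using S by simp
  show "homotopic_with (\<lambda>k. k \<in> T \<rightarrow> T) X X (id \<circ> h 1) id" using T by simp
  show "continuous_map X X (h 1)" using homotopic_with_imp_continuous_maps[OF S] by blast
qed (use assms in auto)

lemma iso_cancel_left:
  assumes "g \<in> hom G H" "f \<in> iso H K" "f \<circ> g \<in> iso G K"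
  shows "g \<in> iso G H"
proof -
  have "g ` carrier G \<subseteq> carrier H" using assms(1) by (auto simp: hom_def)
  then show ?thesis
    using assms bij_betw_comp_iff2[of f "carrier H" "carrier K" g "carrier G"] by (auto simp: iso_def)
qed

lemma iso_cancel_right:
  assumes "f \<in> hom H K" "g \<in> iso G H" "f \<circ> g \<in> iso G K"
  shows "f \<in> iso H K"
  using assms bij_betw_comp_iff[of g "carrier G" "carrier H" f "carrier K"] by (auto simp: iso_def)

context cell_attachment
begin

lemma base_subset_N: "B \<subseteq> N" by (simp add: N_def)

lemma N_subset: "N \<subseteq> topspace Y"
  using image_in_Y unfolding N_def ball_collar_def by (auto simp: topspace_Y)

lemma collar_image: "\<Phi> ` (ball_collar n - ball_boundary n) = N - B"
proof -
  have "ball_collar n - ball_boundary n \<subseteq> ball_interior n"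
    using ball_boundary_Un_interior[of n] unfolding ball_collar_def by blast
  then show ?thesis using interior boundary unfolding N_def by blast
qed

text \<open>The hypothesis of excision. The ball of radius 1/2 is compact, so its image is closed in
  \<open>Y\<close>; the complement of that image is an open neighbourhood of \<open>B\<close> inside
  \<open>N\<close>.\<close>

lemma nbhd_base: "Y closure_of B \<subseteq> Y interior_of N"
proof -
  let ?K = "{x \<in> topspace (nball n). (\<Sum>i<n. x i ^ 2) \<le> 1/4}"
  have "compactin (nball n) ?K"
    by (rule closedin_compact_space[OF compact_space_nball closedin_nball_le])
  then have "closedin Y (\<Phi> ` ?K)"
    by (intro compactin_imp_closedin[OF Hausdorff_Y] image_compactin[OF _ continuous_Y])
  then have ope: "openin Y (topspace Y - \<Phi> ` ?K)" by blast
  have sub: "topspace Y - \<Phi> ` ?K \<subseteq> N"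
  proof
    fix y assume "y \<in> topspace Y - \<Phi> ` ?K"
    then have y: "y \<in> topspace Y" "y \<notin> \<Phi> ` ?K" by auto
    from y(1) show "y \<in> N"
    proof (cases rule: topspace_Y_cases)
      case (2 x)
      then have x: "x \<in> topspace (nball n)" using ball_interior_subset by blast
      then have "x \<in> ball_collar n" using y(2) 2 by (auto simp: ball_collar_def)
      then show ?thesis using 2 by (simp add: N_def)
    qed (simp add: N_def)
  qed
  have "B \<subseteq> topspace Y - \<Phi> ` ?K"
  proof -
    have "?K \<subseteq> ball_interior n" by (auto simp: ball_interior_def)
    then have "\<Phi> ` ?K \<subseteq> \<Phi> ` ball_interior n" by (rule image_mono)
    then have "B \<inter> \<Phi> ` ?K \<subseteq> B \<inter> \<Phi> ` ball_interior n" by (rule Int_mono[OF subset_refl])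
    then have "B \<inter> \<Phi> ` ?K = {}" using interior by (simp only: Int_commute[of B "\<Phi> ` ball_interior n"] subset_empty)
    then show ?thesis unfolding topspace_Y by auto
  qed
  also have "\<dots> \<subseteq> Y interior_of N" by (rule interior_of_maximal[OF sub ope])
  finally have "B \<subseteq> Y interior_of N" .
  then show ?thesis using closedin_base_Y by (simp add: closure_of_closedin)
qed

lemma nbhd_boundary: "nball n closure_of ball_boundary n \<subseteq> nball n interior_of ball_collar n"
proof -
  have "closedin (nball n) {x \<in> topspace (nball n). (\<Sum>i<n. x i ^ 2) \<le> 1/4}" by (rule closedin_nball_le)
  then have "openin (nball n) (topspace (nball n) - {x \<in> topspace (nball n). (\<Sum>i<n. x i ^ 2) \<le> 1/4})"
    by blast
  moreover have "topspace (nball n) - {x \<in> topspace (nball n). (\<Sum>i<n. x i ^ 2) \<le> 1/4} \<subseteq> ball_collar n"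
    by (auto simp: ball_collar_def)
  moreover have "ball_boundary n \<subseteq> topspace (nball n) - {x \<in> topspace (nball n). (\<Sum>i<n. x i ^ 2) \<le> 1/4}"
    by (auto simp: ball_boundary_def)
  ultimately have "ball_boundary n \<subseteq> nball n interior_of ball_collar n"
    using interior_of_maximal by blast
  then show ?thesis using closedin_ball_boundary by (simp add: closure_of_closedin)
qed

theorem characteristic_map_iso:
  "hom_induced p (nball n) (ball_boundary n) Y B \<Phi>
    \<in> iso (relative_homology_group p (nball n) (ball_boundary n)) (relative_homology_group p Y B)"
proof -
  let ?D = "nball n" and ?S = "ball_boundary n" and ?C = "ball_collar n"
  have \<alpha>: "hom_induced p ?D ?S ?D ?C id \<in> iso (relative_homology_group p ?D ?S) (relative_homology_group p ?D ?C)"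
  proof (rule deformation_relative_homology_iso[OF continuous_map_radial])
    show "?C \<subseteq> topspace ?D" by (auto simp: ball_collar_def)
    show "radial n t x \<in> ?S" if "x \<in> ?S" "0 \<le> t" for t x
      using that radial_boundary by simp
  qed (auto simp: radial_0 radial_collar radial_1_collar ball_boundary_subset_collar)
  have \<beta>: "hom_induced p Y B Y N id \<in> iso (relative_homology_group p Y B) (relative_homology_group p Y N)"
    by (rule deformation_relative_homology_iso[OF continuous_map_push])
       (auto simp: push_0 push_base push_N push_1_N base_subset_N N_subset subsetD[OF base_subset_N] subsetD[OF N_subset])
  have collar: "\<Phi> \<in> ?C \<rightarrow> N" by (auto simp: N_def)
  have bdry: "\<Phi> \<in> ?S \<rightarrow> B" using boundary by auto
  let ?D' = "subtopology ?D (topspace ?D - ?S)" and ?Y' = "subtopology Y (topspace Y - B)"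
  have exc_D: "hom_induced p ?D' (?C - ?S) ?D ?C id
      \<in> iso (relative_homology_group p ?D' (?C - ?S)) (relative_homology_group p ?D ?C)"
    using homology_excision_axiom[OF nbhd_boundary, of "topspace ?D" p] by (simp add: ball_collar_def)
  have exc_Y: "hom_induced p ?Y' (N - B) Y N id
      \<in> iso (relative_homology_group p ?Y' (N - B)) (relative_homology_group p Y N)"
    using homology_excision_axiom[OF nbhd_base N_subset, of p] by simp
  have int: "topspace ?D - ?S = ball_interior n"
    using ball_boundary_Un_interior[of n] ball_boundary_Int_interior[of n] by blast
  have ext: "topspace Y - B = \<Phi> ` ball_interior n" using interior unfolding topspace_Y by blast
  have Y': "?Y' = subtopology X (\<Phi> ` ball_interior n)"
    unfolding ext unfolding Y_def subtopology_subtopology by (simp add: Int_absorb1)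
  have homeo: "homeomorphic_map ?D' ?Y' \<Phi>"
    using embedding ball_interior_subset[of n] unfolding embedding_map_def int Y'
    by (simp add: Int_absorb1)
  have \<phi>: "hom_induced p ?D' (?C - ?S) ?Y' (N - B) \<Phi>
      \<in> iso (relative_homology_group p ?D' (?C - ?S)) (relative_homology_group p ?Y' (N - B))"
    by (rule homeomorphic_map_relative_homology_iso[OF homeo _ collar_image]) (auto simp: ball_collar_def)
  have cont': "continuous_map ?D' ?Y' \<Phi>" using homeo by (rule homeomorphic_imp_continuous_map)
  \<comment> \<open>Naturality of excision: in this square the excisions and the homeomorphism of
    the open cell are isomorphisms, hence so is the remaining side.\<close>
  have "hom_induced p ?D ?C Y N \<Phi> \<circ> hom_induced p ?D' (?C - ?S) ?D ?C id =
      hom_induced p ?Y' (N - B) Y N id \<circ> hom_induced p ?D' (?C - ?S) ?Y' (N - B) \<Phi>"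
    using collar collar_image continuous_Y cont'
    by (subst (1 2) hom_induced_compose[symmetric]) (auto intro: continuous_map_from_subtopology)
  moreover have "\<dots> \<in> iso (relative_homology_group p ?D' (?C - ?S)) (relative_homology_group p Y N)"
    using \<phi> exc_Y by (rule iso_set_trans)
  ultimately have \<psi>: "hom_induced p ?D ?C Y N \<Phi> \<in> iso (relative_homology_group p ?D ?C) (relative_homology_group p Y N)"
    using exc_D hom_induced_hom by (metis iso_cancel_right)
  \<comment> \<open>The square that shrinks the collars again; the deformations supply two of the
    three known sides, the previous square the third.\<close>
  have "hom_induced p Y B Y N id \<circ> hom_induced p ?D ?S Y B \<Phi> =
      hom_induced p ?D ?C Y N \<Phi> \<circ> hom_induced p ?D ?S ?D ?C id"
    using collar bdry continuous_Y base_subset_N ball_boundary_subset_collar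
    by (subst (1 2) hom_induced_compose[symmetric]) (auto dest: subsetD[OF ball_boundary_subset_collar])
  moreover have "\<dots> \<in> iso (relative_homology_group p ?D ?S) (relative_homology_group p Y N)"
    using \<alpha> \<psi> by (rule iso_set_trans)
  ultimately show ?thesis
    using \<beta> hom_induced_hom by (metis iso_cancel_left)
qed

end

section \<open>Free families in abelian groups\<close>

text \<open>The same product of powers that occurs in \<open>cell_coeffs\<close>, for an arbitrary
  family.\<close>

definition int_comb :: "('g, 'm) monoid_scheme \<Rightarrow> ('i \<Rightarrow> 'g) \<Rightarrow> 'i set \<Rightarrow> ('i \<Rightarrow> int) \<Rightarrow> 'g" where
  "int_comb G g A k = finprod G (\<lambda>i. g i [^]\<^bsub>G\<^esub> k i) A"

definition free_family :: "('g, 'm) monoid_scheme \<Rightarrow> ('i \<Rightarrow> 'g) \<Rightarrow> 'i set \<Rightarrow> bool" where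
  "free_family G g A \<longleftrightarrow> finite A \<and> g ` A \<subseteq> carrier G \<and>
     (\<forall>z\<in>carrier G. \<exists>k. z = int_comb G g A k) \<and>
     (\<forall>k. int_comb G g A k = \<one>\<^bsub>G\<^esub> \<longrightarrow> (\<forall>i\<in>A. k i = 0))"

lemma free_family_independent:
  "\<lbrakk>free_family G g A; int_comb G g A k = \<one>\<^bsub>G\<^esub>; i \<in> A\<rbrakk> \<Longrightarrow> k i = 0"
  by (simp add: free_family_def)

lemma free_family_spanning:
  "\<lbrakk>free_family G g A; z \<in> carrier G\<rbrakk> \<Longrightarrow> \<exists>k. z = int_comb G g A k"
  by (simp add: free_family_def)

context comm_group
begin

lemma int_comb_closed: "g ` A \<subseteq> carrier G \<Longrightarrow> int_comb G g A k \<in> carrier G"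
  unfolding int_comb_def by (intro finprod_closed) auto

lemma int_comb_cong:
  assumes "g' ` A \<subseteq> carrier G" "\<And>i. i \<in> A \<Longrightarrow> g i = g' i" "\<And>i. i \<in> A \<Longrightarrow> k i = k' i"
  shows "int_comb G g A k = int_comb G g' A k'"
  unfolding int_comb_def using assms by (intro finprod_cong') auto

lemma int_comb_insert:
  assumes "finite A" "a \<notin> A" "g ` insert a A \<subseteq> carrier G"
  shows "int_comb G g (insert a A) k = g a [^] k a \<otimes> int_comb G g A k"
  unfolding int_comb_def using assms by (intro finprod_insert) auto

lemma int_comb_singleton: "g c \<in> carrier G \<Longrightarrow> int_comb G g {c} k = g c [^] k c"
  by (simp add: int_comb_def)

lemma int_comb_add:
  assumes "g ` A \<subseteq> carrier G"
  shows "int_comb G g A (\<lambda>i. k i + l i) = int_comb G g A k \<otimes> int_comb G g A l"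
proof -
  have "int_comb G g A (\<lambda>i. k i + l i) = finprod G (\<lambda>i. g i [^] k i \<otimes> g i [^] l i) A"
    unfolding int_comb_def using assms by (intro finprod_cong') (auto simp: int_pow_mult)
  also have "\<dots> = int_comb G g A k \<otimes> int_comb G g A l"
    unfolding int_comb_def using assms by (intro finprod_multf) auto
  finally show ?thesis .
qed

lemma int_comb_zero: "g ` A \<subseteq> carrier G \<Longrightarrow> int_comb G g A (\<lambda>i. 0) = \<one>"
  by (simp add: int_comb_def)

lemma int_comb_scale:
  assumes "finite A" "g ` A \<subseteq> carrier G"
  shows "int_comb G g A (\<lambda>i. m * k i) = int_comb G g A k [^] m"
  using assms
proof (induction A rule: finite_induct)
  case empty
  then show ?case by (simp add: int_comb_def)
next
  case (insert a A)
  then have "g a \<in> carrier G" "int_comb G g A k \<in> carrier G" by (auto intro: int_comb_closed)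
  with insert show ?case
    by (simp add: int_comb_insert int_pow_distrib int_pow_pow mult.commute)
qed

lemma int_comb_neg:
  assumes "finite A" "g ` A \<subseteq> carrier G"
  shows "int_comb G g A (\<lambda>i. - k i) = inv (int_comb G g A k)"
  using int_comb_scale[OF assms, of "-1" k] int_comb_closed[OF assms(2), of k]
  by (simp add: int_pow_neg)

lemma int_comb_diff:
  assumes "finite A" "g ` A \<subseteq> carrier G"
  shows "int_comb G g A (\<lambda>i. k i - l i) = int_comb G g A k \<otimes> inv (int_comb G g A l)"
  using int_comb_add[OF assms(2), of k "\<lambda>i. - l i"] int_comb_neg[OF assms] by simp

lemma int_comb_hom:
  assumes "h \<in> hom G H" "comm_group H" "finite A" "g ` A \<subseteq> carrier G"
  shows "h (int_comb G g A k) = int_comb H (h \<circ> g) A k"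
proof -
  interpret H: comm_group H by (rule assms(2))
  interpret h: group_hom G H h by (simp add: group_hom_def group_hom_axioms_def assms(1) H.is_group is_group)
  show ?thesis using assms(3,4)
  proof (induction A rule: finite_induct)
    case empty
    then show ?case by (simp add: int_comb_def)
  next
    case (insert a A)
    then have "g a \<in> carrier G" "int_comb G g A k \<in> carrier G" "(h \<circ> g) ` insert a A \<subseteq> carrier H"
      by (auto intro: int_comb_closed)
    with insert show ?case by (simp add: int_comb_insert H.int_comb_insert h.hom_int_pow)
  qed
qed

text \<open>Compatibility with the matrix product; it turns membership in a column lattice into
  membership in a subgroup generated by boundaries.\<close>

lemma int_comb_columns:
  assumes "finite A" "finite T" "f ` T \<subseteq> carrier G"
  shows "int_comb G f T (\<lambda>\<tau>. \<Sum>\<sigma>\<in>A. a \<sigma> * M \<tau> \<sigma>) = int_comb G (\<lambda>\<sigma>. int_comb G f T (\<lambda>\<tau>. M \<tau> \<sigma>)) A a"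
  using assms(1)
proof (induction A rule: finite_induct)
  case empty
  then show ?case using assms int_comb_zero by (simp add: int_comb_def[of _ _ "{}"])
next
  case (insert s A)
  have "int_comb G f T (\<lambda>\<tau>. \<Sum>\<sigma>\<in>insert s A. a \<sigma> * M \<tau> \<sigma>) =
      int_comb G f T (\<lambda>\<tau>. a s * M \<tau> s + (\<Sum>\<sigma>\<in>A. a \<sigma> * M \<tau> \<sigma>))"
    using insert.hyps by simp
  also have "\<dots> = int_comb G f T (\<lambda>\<tau>. M \<tau> s) [^] a s \<otimes> int_comb G (\<lambda>\<sigma>. int_comb G f T (\<lambda>\<tau>. M \<tau> \<sigma>)) A a"
    by (simp only: int_comb_add[OF assms(3)] int_comb_scale[OF assms(2,3)] insert.IH)
  also have "\<dots> = int_comb G (\<lambda>\<sigma>. int_comb G f T (\<lambda>\<tau>. M \<tau> \<sigma>)) (insert s A) a"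
    using insert.hyps assms(3) by (subst int_comb_insert) (auto intro: int_comb_closed)
  finally show ?case .
qed

lemma free_family_unique:
  assumes "free_family G g A" "int_comb G g A k = int_comb G g A l" "i \<in> A"
  shows "k i = l i"
proof -
  have A: "finite A" "g ` A \<subseteq> carrier G" using assms(1) by (auto simp: free_family_def)
  have "int_comb G g A (\<lambda>i. k i - l i) = \<one>"
    using assms(2) A by (simp add: int_comb_diff int_comb_closed)
  then have "k i - l i = 0" by (rule free_family_independent[OF assms(1) _ assms(3)])
  then show ?thesis by simp
qed

text \<open>Vanishing outside \<open>A\<close> makes the coefficient function unique as a function,
  which is the form that the definite description in \<open>cell_coeffs\<close> requires.\<close>

lemma free_family_coeffs:
  assumes "free_family G g A" "z \<in> carrier G"
  shows "\<exists>!k. (\<forall>i. i \<notin> A \<longrightarrow> k i = 0) \<and> z = int_comb G g A k"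
proof (rule ex_ex1I)
  have A: "finite A" "g ` A \<subseteq> carrier G" using assms(1) by (auto simp: free_family_def)
  obtain k where k: "z = int_comb G g A k" using free_family_spanning[OF assms] by blast
  also have "\<dots> = int_comb G g A (\<lambda>i. if i \<in> A then k i else 0)"
    using A(2) by (intro int_comb_cong) auto
  finally show "\<exists>k. (\<forall>i. i \<notin> A \<longrightarrow> k i = 0) \<and> z = int_comb G g A k"
    by (intro exI[of _ "\<lambda>i. if i \<in> A then k i else 0"]) simp
  fix k l
  assume "(\<forall>i. i \<notin> A \<longrightarrow> k i = 0) \<and> z = int_comb G g A k" "(\<forall>i. i \<notin> A \<longrightarrow> l i = 0) \<and> z = int_comb G g A l"
  then show "k = l"
    using free_family_unique[OF assms(1), of k l] by (intro ext) (metis (no_types, lifting))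
qed

lemma free_family_cong:
  assumes "free_family G g A" "\<And>i. i \<in> A \<Longrightarrow> g i = g' i"
  shows "free_family G g' A"
proof -
  have A: "finite A" "g ` A \<subseteq> carrier G" using assms(1) by (auto simp: free_family_def)
  then have "int_comb G g' A k = int_comb G g A k" for k using assms(2) by (intro int_comb_cong) auto
  moreover have "g' ` A = g ` A" using assms(2) by force
  ultimately show ?thesis using assms(1) by (simp add: free_family_def)
qed

lemma int_comb_Some:
  assumes "g ` A \<subseteq> carrier G"
  shows "int_comb G (\<lambda>\<tau>. g (the \<tau>)) (Some ` A) k = int_comb G g A (\<lambda>i. k (Some i))"
  unfolding int_comb_def using assms by (subst finprod_reindex) auto

text \<open>Rows of the boundary matrix are wrapped in \<open>Some\<close> to make room for the
  (-1)-cell; the basis of cells has to be indexed in the same way.\<close>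

lemma free_family_Some:
  assumes "free_family G g A"
  shows "free_family G (\<lambda>\<tau>. g (the \<tau>)) (Some ` A)"
proof -
  have A: "finite A" "g ` A \<subseteq> carrier G" using assms by (auto simp: free_family_def)
  have "\<exists>k. z = int_comb G g A (\<lambda>i. k (Some i))" if z: "z \<in> carrier G" for z
  proof -
    obtain k where "z = int_comb G g A k" using free_family_spanning[OF assms z] by (rule exE)
    then show ?thesis by (intro exI[of _ "\<lambda>\<tau>. k (the \<tau>)"]) simp
  qed
  moreover have "k (Some i) = 0" if "int_comb G g A (\<lambda>i. k (Some i)) = \<one>" "i \<in> A" for k i
    using free_family_independent[OF assms that] .
  ultimately show ?thesis unfolding free_family_def int_comb_Some[OF A(2)] using A by auto
qed

lemma free_family_torsion:
  assumes "free_family G g A"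
  shows "torsion G = {\<one>}"
proof
  have A: "finite A" "g ` A \<subseteq> carrier G" using assms by (auto simp: free_family_def)
  show "torsion G \<subseteq> {\<one>}"
  proof
    fix x assume "x \<in> torsion G"
    then obtain k :: nat where k: "x \<in> carrier G" "k > 0" "x [^] k = \<one>" by (auto simp: torsion_def)
    obtain l where l: "x = int_comb G g A l" using free_family_spanning[OF assms k(1)] by blast
    have "int_comb G g A (\<lambda>i. int k * l i) = \<one>"
      using k(3) by (simp add: int_comb_scale[OF A] int_pow_int flip: l)
    then have "int k * l i = 0" if "i \<in> A" for i by (rule free_family_independent[OF assms _ that])
    then have "int_comb G g A l = int_comb G g A (\<lambda>i. 0)" using A k(2) by (intro int_comb_cong) auto
    then show "x \<in> {\<one>}" using l A by (simp add: int_comb_zero)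
  qed
  show "{\<one>} \<subseteq> torsion G" by (auto simp: torsion_def intro!: exI[of _ "1::nat"])
qed

end

section \<open>Torsion and bases under homomorphisms and extensions\<close>

lemma trivial_group_torsion: "trivial_group G \<Longrightarrow> torsion G = {\<one>\<^bsub>G\<^esub>}"
  using group.is_monoid monoid.nat_pow_one by (fastforce simp: torsion_def trivial_group_def)

lemma torsion_mono_hom:
  assumes "group G" "group H" "h \<in> hom G H" "inj_on h (carrier G)" "torsion H = {\<one>\<^bsub>H\<^esub>}"
  shows "torsion G = {\<one>\<^bsub>G\<^esub>}"
proof
  interpret h: group_hom G H h using assms by (simp add: group_hom_def group_hom_axioms_def)
  show "torsion G \<subseteq> {\<one>\<^bsub>G\<^esub>}"
  proof
    fix x assume "x \<in> torsion G"
    then obtain k :: nat where k: "x \<in> carrier G" "k > 0" "x [^]\<^bsub>G\<^esub> k = \<one>\<^bsub>G\<^esub>" by (auto simp: torsion_def)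
    then have "h x [^]\<^bsub>H\<^esub> k = \<one>\<^bsub>H\<^esub>" using h.hom_nat_pow[of x k] by simp
    then have "h x \<in> torsion H" using k by (auto simp: torsion_def)
    then have "h x = h \<one>\<^bsub>G\<^esub>" using assms(5) by simp
    from inj_onD[OF assms(4) this] show "x \<in> {\<one>\<^bsub>G\<^esub>}" using k(1) by simp
  qed
  show "{\<one>\<^bsub>G\<^esub>} \<subseteq> torsion G" by (auto simp: torsion_def intro!: exI[of _ "1::nat"])
qed

lemma free_family_iso:
  assumes h: "h \<in> iso G H" and "comm_group G" "comm_group H" and g: "free_family G g A"
  shows "free_family H (\<lambda>i. h (g i)) A"
proof -
  interpret G: comm_group G by (rule assms(2))
  interpret H: comm_group H by (rule assms(3))
  have h_hom: "h \<in> hom G H" and h_inj: "inj_on h (carrier G)" and h_surj: "h ` carrier G = carrier H"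
    using h by (auto simp: iso_def bij_betw_def)
  interpret h: group_hom G H h using h_hom by (simp add: group_hom_def group_hom_axioms_def)
  have A: "finite A" "g ` A \<subseteq> carrier G" using g by (auto simp: free_family_def)
  have comb: "int_comb H (\<lambda>i. h (g i)) A k = h (int_comb G g A k)" for k
    using G.int_comb_hom[OF h_hom assms(3) A] by (simp add: comp_def)
  have "\<exists>k. z = h (int_comb G g A k)" if z: "z \<in> carrier H" for z
  proof -
    obtain x where x: "z = h x" "x \<in> carrier G" using z unfolding h_surj[symmetric] by (rule imageE)
    obtain k where "x = int_comb G g A k" using free_family_spanning[OF g x(2)] by (rule exE)
    with x(1) show ?thesis by (intro exI[of _ k]) simp
  qed
  moreover have "\<forall>i\<in>A. k i = 0" if "h (int_comb G g A k) = \<one>\<^bsub>H\<^esub>" for k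
  proof -
    have "h (int_comb G g A k) = h \<one>\<^bsub>G\<^esub>" using that by simp
    from inj_onD[OF h_inj this] have "int_comb G g A k = \<one>\<^bsub>G\<^esub>" using G.int_comb_closed[OF A(2)] by simp
    then show ?thesis using free_family_independent[OF g] by blast
  qed
  ultimately show ?thesis unfolding free_family_def comb using A by auto
qed

text \<open>An extension by an infinite cyclic group splits: a lift \<open>x\<close> of the
  generator completes a basis of the subgroup. This is the algebra of attaching one cell.\<close>

lemma free_family_extension:
  assumes "comm_group G" "comm_group H" "comm_group K"
    and i: "i \<in> hom G H" "inj_on i (carrier G)"
    and p: "p \<in> hom H K" and exact: "kernel H K p = i ` carrier G"
    and g: "free_family G g A" and x: "x \<in> carrier H" and px: "free_family K (\<lambda>_. p x) {c}"
    and c: "c \<notin> A" and g': "\<And>a. a \<in> A \<Longrightarrow> g' a = i (g a)" "g' c = x"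
  shows "free_family H g' (insert c A)"
proof -
  interpret G: comm_group G by (rule assms(1))
  interpret H: comm_group H by (rule assms(2))
  interpret K: comm_group K by (rule assms(3))
  interpret i: group_hom G H i using i by (simp add: group_hom_def group_hom_axioms_def)
  interpret p: group_hom H K p using p by (simp add: group_hom_def group_hom_axioms_def)
  have A: "finite A" "g ` A \<subseteq> carrier G" using g by (auto simp: free_family_def)
  have g'_carrier: "g' ` insert c A \<subseteq> carrier H" using A g' x by auto
  have split: "int_comb H g' (insert c A) k = x [^]\<^bsub>H\<^esub> k c \<otimes>\<^bsub>H\<^esub> i (int_comb G g A k)" for k
  proof -
    have "int_comb H g' A k = int_comb H (i \<circ> g) A k"
      using A g' by (intro H.int_comb_cong) auto
    also have "\<dots> = i (int_comb G g A k)" using A by (simp add: G.int_comb_hom[OF i(1) assms(2)])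
    finally show ?thesis using H.int_comb_insert[OF A(1) c g'_carrier] g'(2) by simp
  qed
  have K_comb: "int_comb K (\<lambda>_. p x) {c} k = p (x [^]\<^bsub>H\<^esub> k c)" for k
    using x by (simp add: int_comb_def p.hom_int_pow)
  have pi: "p (i z) = \<one>\<^bsub>K\<^esub>" if "z \<in> carrier G" for z
    using exact that by (auto simp: kernel_def)
  have "\<exists>k. z = int_comb H g' (insert c A) k" if z: "z \<in> carrier H" for z
  proof -
    obtain m where m: "p z = p (x [^]\<^bsub>H\<^esub> (m c :: int))"
      using free_family_spanning[OF px p.hom_closed[OF z]] unfolding K_comb by blast
    have "z \<otimes>\<^bsub>H\<^esub> inv\<^bsub>H\<^esub> (x [^]\<^bsub>H\<^esub> m c) \<in> kernel H K p"
      using m x z by (simp add: kernel_def)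
    then obtain w where w: "w \<in> carrier G" "z \<otimes>\<^bsub>H\<^esub> inv\<^bsub>H\<^esub> (x [^]\<^bsub>H\<^esub> m c) = i w" unfolding exact by blast
    obtain k where k: "w = int_comb G g A k" using free_family_spanning[OF g w(1)] by blast
    have "z = x [^]\<^bsub>H\<^esub> m c \<otimes>\<^bsub>H\<^esub> i w"
      unfolding w(2)[symmetric] using x z by (simp add: H.m_comm[of z] flip: H.m_assoc)
    \<comment> \<open>As \<open>c\<close> is not in \<open>A\<close>, the coefficient there is free
      to record the exponent of \<open>x\<close>.\<close>
    also have "w = int_comb G g A (k(c := m c))"
      unfolding k using A c by (intro G.int_comb_cong) auto
    finally have "z = int_comb H g' (insert c A) (k(c := m c))" by (simp add: split)
    then show ?thesis by blast
  qed
  moreover have "\<forall>j\<in>insert c A. k j = 0" if 0: "int_comb H g' (insert c A) k = \<one>\<^bsub>H\<^esub>" for k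
  proof -
    have w: "int_comb G g A k \<in> carrier G" using A by (intro G.int_comb_closed)
    have "p (x [^]\<^bsub>H\<^esub> k c \<otimes>\<^bsub>H\<^esub> i (int_comb G g A k)) = \<one>\<^bsub>K\<^esub>" using 0 split[of k] by simp
    then have "p (x [^]\<^bsub>H\<^esub> k c) = \<one>\<^bsub>K\<^esub>" using x w pi by simp
    then have "k c = 0" using px unfolding free_family_def K_comb by blast
    then have "i (int_comb G g A k) = i \<one>\<^bsub>G\<^esub>" using 0 split[of k] w by simp
    from inj_onD[OF i(2) this] have "int_comb G g A k = \<one>\<^bsub>G\<^esub>" using w by simp
    then show ?thesis using g \<open>k c = 0\<close> unfolding free_family_def by blast
  qed
  ultimately show ?thesis using A g'_carrier unfolding free_family_def by simp
qed

text \<open>Applied to \<open>P = H\<^sub>n(X\<^sup>n)\<close>, the cellular chain group \<open>C = H\<^sub>n(X\<^sup>n, X\<^sup>n\<^sup>-\<^sup>1)\<close> and \<open>G = H\<^sub>n(X\<^sup>n \<union> A)\<close>.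
  Since \<open>P\<close> is a subgroup of \<open>C\<close> with torsion-free cokernel, torsion in \<open>G\<close> is torsion in the cokernel
  of the boundary matrix.\<close>

lemma torsion_quotient_saturation:
  fixes M :: "'r \<Rightarrow> 'c \<Rightarrow> int"
  assumes "comm_group R" "comm_group P" "comm_group G" "comm_group C" "comm_group Q"
    and i: "i \<in> hom P G" "i ` carrier P = carrier G" "kernel P G i = \<delta> ` carrier R"
    and \<delta>: "\<delta> \<in> hom R P"
    and j: "j \<in> hom P C" "inj_on j (carrier P)" "kernel C Q d = j ` carrier P"
    and d: "d \<in> hom C Q" "torsion Q = {\<one>\<^bsub>Q\<^esub>}"
    and f: "free_family C f T"
    and r: "finite A" "r ` A \<subseteq> carrier R" "\<And>z. z \<in> carrier R \<Longrightarrow> \<exists>a. z = int_comb R r A a"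
    and M: "\<And>\<sigma>. \<sigma> \<in> A \<Longrightarrow> j (\<delta> (r \<sigma>)) = int_comb C f T (\<lambda>\<tau>. M \<tau> \<sigma>)"
    and supp: "\<And>\<tau> \<sigma>. \<tau> \<notin> T \<Longrightarrow> M \<tau> \<sigma> = 0"
  shows "\<exists>\<theta>. \<theta> ` saturation T (column_lattice M A) = torsion G \<and>
    (\<forall>u \<in> saturation T (column_lattice M A). \<forall>v \<in> saturation T (column_lattice M A).
      \<theta> u = \<theta> v \<longleftrightarrow> (\<lambda>\<tau>. u \<tau> - v \<tau>) \<in> column_lattice M A)"
proof -
  interpret R: comm_group R by (rule assms(1))
  interpret P: comm_group P by (rule assms(2))
  interpret G: comm_group G by (rule assms(3))
  interpret C: comm_group C by (rule assms(4))
  interpret Q: comm_group Q by (rule assms(5))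
  interpret i: group_hom P G i using i by (simp add: group_hom_def group_hom_axioms_def)
  interpret \<delta>: group_hom R P \<delta> using \<delta> by (simp add: group_hom_def group_hom_axioms_def)
  interpret j: group_hom P C j using j by (simp add: group_hom_def group_hom_axioms_def)
  interpret d: group_hom C Q d using d by (simp add: group_hom_def group_hom_axioms_def)
  let ?L = "column_lattice M A" let ?Sat = "saturation T ?L"
  define E where "E = int_comb C f T"
  have T: "finite T" "f ` T \<subseteq> carrier C" using f by (auto simp: free_family_def)
  have E_closed: "E u \<in> carrier C" for u unfolding E_def by (rule C.int_comb_closed[OF T(2)])
  have E_scale: "E (\<lambda>\<tau>. k * u \<tau>) = E u [^]\<^bsub>C\<^esub> k" for k u unfolding E_def by (rule C.int_comb_scale[OF T])
  have E_diff: "E (\<lambda>\<tau>. u \<tau> - v \<tau>) = E u \<otimes>\<^bsub>C\<^esub> inv\<^bsub>C\<^esub> E v" for u v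
    unfolding E_def by (rule C.int_comb_diff[OF T])
  have E_inj: "u = v" if "E u = E v" "\<And>\<tau>. \<tau> \<notin> T \<Longrightarrow> u \<tau> = 0" "\<And>\<tau>. \<tau> \<notin> T \<Longrightarrow> v \<tau> = 0" for u v
    using C.free_family_unique[OF f that(1)[unfolded E_def]] that(2,3) by (intro ext) metis
  have supp_L: "u \<tau> = 0" if "u \<in> ?L" "\<tau> \<notin> T" for u \<tau>
    using that by (elim column_latticeE) (simp add: supp)
  have boundary_comb: "j (\<delta> (int_comb R r A a)) = E (\<lambda>\<tau>. \<Sum>\<sigma>\<in>A. a \<sigma> * M \<tau> \<sigma>)" for a
  proof -
    have "j (\<delta> (int_comb R r A a)) = int_comb C ((j \<circ> \<delta>) \<circ> r) A a"
      using R.int_comb_hom[OF hom_compose[OF \<delta> j(1)] assms(4) r(1,2)] by simp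
    also have "\<dots> = int_comb C (\<lambda>\<sigma>. E (\<lambda>\<tau>. M \<tau> \<sigma>)) A a"
      using M E_closed by (intro C.int_comb_cong) (auto simp: E_def)
    also have "\<dots> = E (\<lambda>\<tau>. \<Sum>\<sigma>\<in>A. a \<sigma> * M \<tau> \<sigma>)"
      unfolding E_def by (rule C.int_comb_columns[OF r(1) T, symmetric])
    finally show ?thesis .
  qed
  \<comment> \<open>Columns are the coordinates of boundaries, so the lattice is the image of
    \<open>R\<close> read in coordinates.\<close>
  have lattice_iff: "u \<in> ?L \<longleftrightarrow> (\<exists>z\<in>carrier R. E u = j (\<delta> z))" if "\<And>\<tau>. \<tau> \<notin> T \<Longrightarrow> u \<tau> = 0" for u
  proof
    assume "u \<in> ?L"
    then obtain a where "\<And>\<tau>. u \<tau> = (\<Sum>\<sigma>\<in>A. a \<sigma> * M \<tau> \<sigma>)" by (rule column_latticeE) blast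
    then have "u = (\<lambda>\<tau>. \<Sum>\<sigma>\<in>A. a \<sigma> * M \<tau> \<sigma>)" by (rule ext)
    then have "E u = j (\<delta> (int_comb R r A a))" using boundary_comb by simp
    then show "\<exists>z\<in>carrier R. E u = j (\<delta> z)" using R.int_comb_closed[OF r(2)] by blast
  next
    assume "\<exists>z\<in>carrier R. E u = j (\<delta> z)"
    then obtain a where "E u = E (\<lambda>\<tau>. \<Sum>\<sigma>\<in>A. a \<sigma> * M \<tau> \<sigma>)" using r(3) boundary_comb by metis
    then have "u = (\<lambda>\<tau>. \<Sum>\<sigma>\<in>A. a \<sigma> * M \<tau> \<sigma>)" using that supp by (intro E_inj) auto
    then show "u \<in> ?L" by (rule column_latticeI)
  qed
  define w where "w = (\<lambda>u. inv_into (carrier P) j (E u))"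
  have w: "w u \<in> carrier P \<and> j (w u) = E u" if u: "u \<in> ?Sat" for u
  proof -
    obtain k where k: "k > 0" "(\<lambda>\<tau>. k * u \<tau>) \<in> ?L" using u by (auto simp: saturation_def)
    obtain z where z: "z \<in> carrier R" "E u [^]\<^bsub>C\<^esub> k = j (\<delta> z)"
      using lattice_iff[of "\<lambda>\<tau>. k * u \<tau>"] supp_L k(2) E_scale by metis
    \<comment> \<open>A multiple of \<open>E u\<close> is a boundary and hence a cycle. Since
      \<open>Q\<close> has no torsion, \<open>E u\<close> is itself a cycle and comes from a class
      in \<open>P\<close>.\<close>
    have "j (\<delta> z) \<in> kernel C Q d" unfolding j(3) using z(1) by simp
    then have "d (E u [^]\<^bsub>C\<^esub> k) = \<one>\<^bsub>Q\<^esub>" using z(2) by (simp add: kernel_def)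
    then have "d (E u) [^]\<^bsub>Q\<^esub> nat k = \<one>\<^bsub>Q\<^esub>"
      using k(1) d.hom_int_pow[OF E_closed, of u k] by (simp flip: int_pow_int)
    then have "d (E u) \<in> torsion Q"
      using k(1) E_closed by (auto simp: torsion_def intro!: exI[of _ "nat k"])
    then have "E u \<in> j ` carrier P" using d(2) E_closed unfolding j(3)[symmetric] kernel_def by simp
    then show ?thesis unfolding w_def by (simp add: inv_into_into f_inv_into_f)
  qed
  define \<theta> where "\<theta> = (\<lambda>u. i (w u))"
  have "\<theta> ` ?Sat = torsion G"
  proof (intro equalityI subsetI)
    fix x assume "x \<in> \<theta> ` ?Sat"
    then obtain u where u: "u \<in> ?Sat" "x = i (w u)" unfolding \<theta>_def by blast
    obtain k where k: "k > 0" "(\<lambda>\<tau>. k * u \<tau>) \<in> ?L" using u by (auto simp: saturation_def)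
    obtain z where z: "z \<in> carrier R" "E u [^]\<^bsub>C\<^esub> k = j (\<delta> z)"
      using lattice_iff[of "\<lambda>\<tau>. k * u \<tau>"] supp_L k(2) E_scale by metis
    have "j (w u [^]\<^bsub>P\<^esub> k) = j (\<delta> z)" using w[OF u(1)] z by (simp add: j.hom_int_pow)
    then have "w u [^]\<^bsub>P\<^esub> k = \<delta> z" using j(2) w[OF u(1)] z(1) by (auto dest: inj_onD)
    then have "w u [^]\<^bsub>P\<^esub> k \<in> kernel P G i" unfolding i(3) using z(1) by blast
    then have "x [^]\<^bsub>G\<^esub> nat k = \<one>\<^bsub>G\<^esub>"
      using k(1) w[OF u(1)] u(2) i.hom_int_pow[of "w u" k] by (simp add: kernel_def flip: int_pow_int)
    then show "x \<in> torsion G"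
      using k(1) w[OF u(1)] u(2) by (auto simp: torsion_def intro!: exI[of _ "nat k"])
  next
    fix x assume "x \<in> torsion G"
    then obtain k :: nat where k: "x \<in> carrier G" "k > 0" "x [^]\<^bsub>G\<^esub> k = \<one>\<^bsub>G\<^esub>" by (auto simp: torsion_def)
    obtain v where v: "v \<in> carrier P" "x = i v" using k(1) i(2) by blast
    have "v [^]\<^bsub>P\<^esub> k \<in> kernel P G i" using v k by (simp add: kernel_def i.hom_nat_pow)
    then obtain z where z: "z \<in> carrier R" "v [^]\<^bsub>P\<^esub> k = \<delta> z" unfolding i(3) by blast
    obtain u where u: "\<And>\<tau>. \<tau> \<notin> T \<Longrightarrow> u \<tau> = 0" "j v = E u"
      using C.free_family_coeffs[OF f j.hom_closed[OF v(1)]] unfolding E_def by blast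
    have "E (\<lambda>\<tau>. int k * u \<tau>) = j (\<delta> z)"
      unfolding E_scale u(2)[symmetric] using v z(2) by (simp add: int_pow_int flip: j.hom_nat_pow)
    then have "(\<lambda>\<tau>. int k * u \<tau>) \<in> ?L" using lattice_iff[of "\<lambda>\<tau>. int k * u \<tau>"] u(1) z(1) by auto
    then have Sat: "u \<in> ?Sat" unfolding saturation_def using k(2) u(1)
      by (intro CollectI conjI exI[of _ "int k"]) auto
    then have "w u = v" using inj_onD[OF j(2), of "w u" v] w[OF Sat] u(2) v(1) by simp
    then show "x \<in> \<theta> ` ?Sat" using Sat v(2) unfolding \<theta>_def by blast
  qed
  moreover have "\<theta> u = \<theta> v \<longleftrightarrow> (\<lambda>\<tau>. u \<tau> - v \<tau>) \<in> ?L" if u: "u \<in> ?Sat" and v: "v \<in> ?Sat" for u v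
  proof -
    let ?x = "w u \<otimes>\<^bsub>P\<^esub> inv\<^bsub>P\<^esub> w v"
    have x: "?x \<in> carrier P" "j ?x = E (\<lambda>\<tau>. u \<tau> - v \<tau>)" using w[OF u] w[OF v] E_diff by auto
    have "\<theta> u = \<theta> v \<longleftrightarrow> \<theta> u \<otimes>\<^bsub>G\<^esub> inv\<^bsub>G\<^esub> \<theta> v = \<one>\<^bsub>G\<^esub>"
      using w[OF u] w[OF v] unfolding \<theta>_def
      by (metis G.inv_closed G.inv_equality G.inv_inv G.r_inv i.hom_closed)
    also have "\<dots> \<longleftrightarrow> ?x \<in> kernel P G i"
      using w[OF u] w[OF v] unfolding \<theta>_def kernel_def by simp
    also have "\<dots> \<longleftrightarrow> (\<exists>z\<in>carrier R. ?x = \<delta> z)" unfolding i(3) by blast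
    also have "\<dots> \<longleftrightarrow> (\<exists>z\<in>carrier R. j ?x = j (\<delta> z))"
      using j(2) x(1) by (auto dest: inj_onD)
    also have "\<dots> \<longleftrightarrow> (\<lambda>\<tau>. u \<tau> - v \<tau>) \<in> ?L"
      unfolding x(2) using u v by (subst lattice_iff) (auto simp: saturation_def)
    finally show ?thesis .
  qed
  ultimately show ?thesis by blast
qed

section \<open>Attaching several cells of one dimension\<close>

lemma triple_kernel_boundary:
  assumes "T \<subseteq> S"
  shows "kernel (relative_homology_group p X S) (relative_homology_group (p - 1) (subtopology X S) T)
      (hom_relboundary p X S T) = hom_induced p X T X S id ` carrier (relative_homology_group p X T)"
  using homology_exactness_triple_1[OF assms, of p X] by simp

lemma triple_kernel_inclusion:
  assumes "T \<subseteq> S"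
  shows "kernel (relative_homology_group p (subtopology X S) T) (relative_homology_group p X T)
      (hom_induced p (subtopology X S) T X T id) =
    hom_relboundary (p + 1) X S T ` carrier (relative_homology_group (p + 1) X S)"
  using homology_exactness_triple_2[OF assms, of "p + 1" X] by simp

lemma triple_kernel_relativization:
  assumes "T \<subseteq> S"
  shows "kernel (relative_homology_group p X T) (relative_homology_group p X S) (hom_induced p X T X S id) =
    hom_induced p (subtopology X S) T X T id ` carrier (relative_homology_group p (subtopology X S) T)"
  using homology_exactness_triple_3[OF assms, of p X] by simp

lemma trivial_group_iso: "f \<in> iso G H \<Longrightarrow> group G \<Longrightarrow> group H \<Longrightarrow> trivial_group G \<longleftrightarrow> trivial_group H"
  using isomorphic_group_triviality is_isoI by blast

lemma trivial_group_exact: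
  assumes "group H" "f \<in> hom G H" "g \<in> hom H K" "kernel H K g = f ` carrier G"
    and "trivial_group G" "trivial_group K"
  shows "trivial_group H"
proof -
  have K: "carrier K = {\<one>\<^bsub>K\<^esub>}" and G: "carrier G = {\<one>\<^bsub>G\<^esub>}" "group G" "group K"
    using assms(5,6) by (auto simp: trivial_group_def)
  have "g x = \<one>\<^bsub>K\<^esub>" if "x \<in> carrier H" for x using hom_in_carrier[OF assms(3) that] K by simp
  then have "carrier H = f ` carrier G" unfolding assms(4)[symmetric] kernel_def by auto
  also have "\<dots> = {\<one>\<^bsub>H\<^esub>}" using G assms(1,2) hom_one by simp
  finally show ?thesis using assms(1) by (simp add: trivial_group_def)
qed

lemma trivial_homology_pair_ball:
  assumes "p \<noteq> int n"
  shows "trivial_group (relative_homology_group p (nball n) (ball_boundary n))"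
proof (cases n)
  case 0
  then have "topspace (nball n) = {\<lambda>i. 0}" "ball_boundary n = {}"
    by (auto simp: topspace_nball ball_boundary_eq)
  then show ?thesis using homology_dimension_axiom assms 0 by simp
next
  case (Suc m)
  \<comment> \<open>A unit vector shows that the sphere is nonempty, as the comparison with its
    reduced homology demands.\<close>
  have "(\<lambda>i. if i = 0 then 1 else 0) \<in> topspace (nball n) \<inter> ball_boundary n"
    by (simp add: Suc topspace_nball ball_boundary_eq if_distrib[where f = "\<lambda>x. x ^ 2"] lessThan_Suc_atMost
        cong: if_cong del: sum.lessThan_Suc)
  then have "hom_boundary p (nball n) (ball_boundary n) \<in> iso (relative_homology_group p (nball n) (ball_boundary n))
      (reduced_homology_group (p - 1) (subtopology (nball n) (ball_boundary n)))"
    by (intro iso_relative_homology_of_contractible contractible_space_nball) blast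
  moreover have "trivial_group (reduced_homology_group (p - 1) (subtopology (nball n) (ball_boundary n)))"
    using assms by (simp add: Suc subtopology_ball_boundary trivial_reduced_homology_group_nsphere)
  ultimately show ?thesis using trivial_group_iso by fastforce
qed

lemma homology_pair_ball_integer:
  "relative_homology_group (int n) (nball n) (ball_boundary n) \<cong> integer_group"
proof (cases n)
  case 0
  then have "topspace (nball n) = {\<lambda>i. 0}" "ball_boundary n = {}"
    by (auto simp: topspace_nball ball_boundary_eq)
  then show ?thesis using homology_coefficients 0 by simp
next
  case (Suc m)
  have "(\<lambda>i. if i = 0 then 1 else 0) \<in> topspace (nball n) \<inter> ball_boundary n"
    by (simp add: Suc topspace_nball ball_boundary_eq if_distrib[where f = "\<lambda>x. x ^ 2"] lessThan_Suc_atMost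
        cong: if_cong del: sum.lessThan_Suc)
  then have "relative_homology_group (int n) (nball n) (ball_boundary n) \<cong>
      reduced_homology_group (int n - 1) (subtopology (nball n) (ball_boundary n))"
    by (intro isomorphic_group_relative_homology_of_contractible contractible_space_nball) blast
  also have "\<dots> \<cong> integer_group"
    using reduced_homology_group_nsphere(1)[of m] by (simp add: Suc subtopology_ball_boundary)
  finally (iso_trans) show ?thesis .
qed

text \<open>Since the group is infinite cyclic, the generator described by \<open>SOME\<close>
  exists; an isomorphism with the integers sends it to a nonzero number, so none of its nonzero
  powers is trivial.\<close>

lemma free_family_ball_orientation:
  "free_family (relative_homology_group (int n) (nball n) (ball_boundary n)) (\<lambda>_. ball_orientation n) {c}"
proof -
  let ?G = "relative_homology_group (int n) (nball n) (ball_boundary n)"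
  let ?o = "ball_orientation n"
  interpret G: comm_group ?G by simp
  have "cyclic_group ?G"
    using isomorphic_group_cyclicity[OF homology_pair_ball_integer] by simp
  then have "\<exists>g. g \<in> carrier ?G \<and> subgroup_generated ?G {g} = ?G" unfolding cyclic_group_def by blast
  then have o: "?o \<in> carrier ?G" "subgroup_generated ?G {?o} = ?G"
    unfolding ball_orientation_def Let_def by (metis (mono_tags, lifting) someI_ex)+
  then have gen: "carrier ?G = range (\<lambda>k::int. ?o [^]\<^bsub>?G\<^esub> k)"
    using G.carrier_subgroup_generated_by_singleton by metis
  obtain f where f: "f \<in> iso ?G integer_group" using homology_pair_ball_integer unfolding is_iso_def by blast
  then have f_hom: "f \<in> hom ?G integer_group" and f_surj: "f ` carrier ?G = UNIV"
    by (auto simp: iso_def bij_betw_def)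
  have f_pow: "f (?o [^]\<^bsub>?G\<^esub> k) = k * f ?o" for k :: int
    using hom_int_pow[OF f_hom o(1)] by simp
  have "f ?o \<noteq> 0"
  proof
    assume "f ?o = 0"
    then have "f ` carrier ?G \<subseteq> {0}" unfolding gen using f_pow by auto
    then have "(UNIV :: int set) \<subseteq> {0}" using f_surj by simp
    then show False by (metis UNIV_I singletonD subsetD zero_neq_one)
  qed
  then have "k = 0" if "?o [^]\<^bsub>?G\<^esub> k = \<one>\<^bsub>?G\<^esub>" for k :: int
    using that f_pow[of k] hom_one[OF f_hom] by simp
  moreover have comb: "int_comb ?G (\<lambda>_. ?o) {c} k = ?o [^]\<^bsub>?G\<^esub> k c" for k
    using o(1) by (rule G.int_comb_singleton)
  moreover have "\<exists>k. z = ?o [^]\<^bsub>?G\<^esub> (k c :: int)" if z: "z \<in> carrier ?G" for z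
  proof -
    obtain m :: int where "z = ?o [^]\<^bsub>?G\<^esub> m" using z unfolding gen by (rule imageE)
    then show ?thesis by (intro exI[of _ "\<lambda>_. m"])
  qed
  ultimately show ?thesis unfolding free_family_def using o(1) by auto
qed

locale cells_attachment =
  fixes X :: "'a topology" and B :: "'a set" and n :: nat
    and \<Phi> :: "'c \<Rightarrow> (nat \<Rightarrow> real) \<Rightarrow> 'a" and A :: "'c set"
  assumes Hausdorff: "Hausdorff_space X"
    and closed_base: "closedin X B"
    and finite_cells: "finite A"
    and continuous: "\<And>c. c \<in> A \<Longrightarrow> continuous_map (nball n) X (\<Phi> c)"
    and embedding: "\<And>c. c \<in> A \<Longrightarrow> embedding_map (subtopology (nball n) (ball_interior n)) X (\<Phi> c)"
    and boundary: "\<And>c. c \<in> A \<Longrightarrow> \<Phi> c ` ball_boundary n \<subseteq> B"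
    and interior: "\<And>c. c \<in> A \<Longrightarrow> \<Phi> c ` ball_interior n \<inter> B = {}"
    and disjoint: "disjoint_family_on (\<lambda>c. \<Phi> c ` ball_interior n) A"
begin

definition carrier_set :: "'c set \<Rightarrow> 'a set" where
  "carrier_set A' = B \<union> (\<Union>c\<in>A'. \<Phi> c ` ball_interior n)"

definition attached :: "'c set \<Rightarrow> 'a topology" where "attached A' = subtopology X (carrier_set A')"

text \<open>Cell boundaries lie in \<open>B\<close>, so closed cells may replace open ones. This
  exhibits the set as a finite union of closed sets.\<close>

lemma carrier_set_closed_cells:
  assumes "A' \<subseteq> A"
  shows "carrier_set A' = B \<union> (\<Union>c\<in>A'. \<Phi> c ` topspace (nball n))"
proof -
  have "\<Phi> c ` topspace (nball n) = \<Phi> c ` ball_boundary n \<union> \<Phi> c ` ball_interior n" for c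
    by (simp add: image_Un flip: ball_boundary_Un_interior)
  moreover have absorb: "B \<union> (\<Union>c\<in>A'. P c \<union> Q c) = B \<union> (\<Union>c\<in>A'. Q c)"
    if "\<And>c. c \<in> A' \<Longrightarrow> P c \<subseteq> B" for P Q :: "'c \<Rightarrow> 'a set"
    using that by blast
  ultimately show ?thesis
    using absorb[of "\<lambda>c. \<Phi> c ` ball_boundary n", OF boundary[OF subsetD[OF assms]]] unfolding carrier_set_def by simp
qed

lemma closedin_carrier_set:
  assumes "A' \<subseteq> A"
  shows "closedin X (carrier_set A')"
proof -
  have "closedin X (\<Phi> c ` topspace (nball n))" if "c \<in> A'" for c
    using that assms compact_space_nball continuous unfolding compact_space_def
    by (intro compactin_imp_closedin[OF Hausdorff] image_compactin) auto
  moreover have "finite A'" using assms finite_cells finite_subset by blast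
  ultimately show ?thesis
    unfolding carrier_set_closed_cells[OF assms] by (intro closedin_Un closed_base closedin_Union) auto
qed

lemma continuous_attached:
  assumes "A' \<subseteq> A" "c \<in> A'"
  shows "continuous_map (nball n) (attached A') (\<Phi> c)"
  unfolding attached_def continuous_map_in_subtopology
  using continuous assms unfolding carrier_set_closed_cells[OF assms(1)] by auto

lemma boundary_map: "c \<in> A \<Longrightarrow> \<Phi> c \<in> ball_boundary n \<rightarrow> B"
  using boundary by blast

definition attached_class :: "'c set \<Rightarrow> 'c \<Rightarrow> 'a chain set" where
  "attached_class A' c =
    hom_induced (int n) (nball n) (ball_boundary n) (attached A') B (\<Phi> c) (ball_orientation n)"

text \<open>The cells attached so far are absorbed into the base; disjointness of the open cells
  keeps the new one off it.\<close>

lemma attached_step: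
  assumes "A' \<subseteq> A" "c \<in> A" "c \<notin> A'"
  shows "hom_induced p (nball n) (ball_boundary n) (attached (insert c A')) (carrier_set A') (\<Phi> c)
    \<in> iso (relative_homology_group p (nball n) (ball_boundary n))
        (relative_homology_group p (attached (insert c A')) (carrier_set A'))"
proof -
  have "\<Phi> c ` ball_interior n \<inter> \<Phi> c' ` ball_interior n = {}" if "c' \<in> A'" for c'
    using disjoint_family_onD[OF disjoint, of c c'] assms that by blast
  then interpret cell_attachment X "carrier_set A'" n "\<Phi> c"
    using Hausdorff closedin_carrier_set[OF assms(1)] continuous[OF assms(2)] embedding[OF assms(2)]
      boundary[OF assms(2)] interior[OF assms(2)]
    by unfold_locales (auto simp: carrier_set_def)
  have "Y = attached (insert c A')"
    by (simp only: Y_def attached_def) (simp add: carrier_set_def Un_ac)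
  then show ?thesis using characteristic_map_iso by simp
qed

lemma subtopology_attached:
  assumes "A' \<subseteq> A''"
  shows "subtopology (attached A'') (carrier_set A') = attached A'"
proof -
  have "carrier_set A'' \<inter> carrier_set A' = carrier_set A'" using assms by (auto simp: carrier_set_def)
  then show ?thesis by (simp add: attached_def subtopology_subtopology)
qed

lemma base_subset_carrier_set: "B \<subseteq> carrier_set A'" by (simp add: carrier_set_def)

text \<open>Induction over the triple formed by the new space, the space before the last cell, and
  \<open>B\<close>. The outer terms are known from the induction hypothesis and from the ball. The
  degree varies in the induction because the conclusion in degree \<open>n\<close> and vanishing in
  the others are carried together.\<close>

lemma attached_homology:
  assumes "A' \<subseteq> A"
  shows "(p \<noteq> int n \<longrightarrow> trivial_group (relative_homology_group p (attached A') B)) \<and>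
    free_family (relative_homology_group (int n) (attached A') B) (attached_class A') A'"
  using finite_subset[OF assms finite_cells] assms
proof (induction A' arbitrary: p rule: finite_subset_induct')
  case empty
  have "attached {} = subtopology X B" by (simp add: attached_def carrier_set_def)
  moreover have "topspace (subtopology X B) = B"
    using closed_base closedin_subset by (auto simp: topspace_subtopology)
  ultimately have triv: "trivial_group (relative_homology_group q (attached {}) B)" for q
    using trivial_relative_homology_group_topspace[of q "subtopology X B"] by simp
  interpret G: comm_group "relative_homology_group (int n) (attached {}) B" by simp
  show ?case
    using triv[of p] triv[of "int n"] by (simp add: free_family_def int_comb_def trivial_group_def)
next
  case (insert c A')
  let ?Y = "attached (insert c A')" and ?B = "carrier_set A'"
  have sub: "subtopology ?Y ?B = attached A'" by (rule subtopology_attached) auto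
  have A'c: "insert c A' \<subseteq> A" using insert by simp
  have step: "hom_induced q (nball n) (ball_boundary n) ?Y ?B (\<Phi> c)
      \<in> iso (relative_homology_group q (nball n) (ball_boundary n)) (relative_homology_group q ?Y ?B)" for q
    using insert by (intro attached_step) auto
  then have step_trivial: "trivial_group (relative_homology_group q ?Y ?B)" if "q \<noteq> int n" for q
    using trivial_homology_pair_ball[OF that] trivial_group_iso[OF step] by simp
  have incl_continuous: "continuous_map (attached A') ?Y id"
    using continuous_map_from_subtopology[OF continuous_map_id, of ?Y ?B] by (simp add: sub)
  have incl: "hom_induced q (attached A') B ?Y B id
      \<in> hom (relative_homology_group q (attached A') B) (relative_homology_group q ?Y B)" for q
    by (rule hom_induced_hom)
  have rel: "hom_induced q ?Y B ?Y ?B id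
      \<in> hom (relative_homology_group q ?Y B) (relative_homology_group q ?Y ?B)" for q
    by (rule hom_induced_hom)
  have exact: "kernel (relative_homology_group q ?Y B) (relative_homology_group q ?Y ?B) (hom_induced q ?Y B ?Y ?B id) =
      hom_induced q (attached A') B ?Y B id ` carrier (relative_homology_group q (attached A') B)" for q
    using triple_kernel_relativization[OF base_subset_carrier_set, of q ?Y A'] by (simp add: sub)
  have boundary_one: "hom_relboundary (int n + 1) ?Y ?B B \<one>\<^bsub>relative_homology_group (int n + 1) ?Y ?B\<^esub> =
      \<one>\<^bsub>relative_homology_group (int n) (attached A') B\<^esub>"
    using hom_one[OF group_homomorphism_hom_relboundary[of "int n + 1" ?Y ?B B]] by (simp add: sub)
  have "trivial_group (relative_homology_group p ?Y B)" if "p \<noteq> int n"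
    using trivial_group_exact[OF _ incl rel exact] insert.IH[of p] step_trivial[OF that] that by simp
  moreover have "free_family (relative_homology_group (int n) ?Y B) (attached_class (insert c A')) (insert c A')"
  proof (rule free_family_extension)
    show "hom_induced (int n) (attached A') B ?Y B id
      \<in> hom (relative_homology_group n (attached A') B) (relative_homology_group n ?Y B)" by (rule incl)
    show "hom_induced (int n) ?Y B ?Y ?B id
      \<in> hom (relative_homology_group n ?Y B) (relative_homology_group n ?Y ?B)" by (rule rel)
    show "kernel (relative_homology_group n ?Y B) (relative_homology_group n ?Y ?B) (hom_induced n ?Y B ?Y ?B id) =
      hom_induced n (attached A') B ?Y B id ` carrier (relative_homology_group n (attached A') B)" by (rule exact)
    \<comment> \<open>The kernel is the image of the relative group one degree higher, which
      vanishes because the cell has dimension \<open>n\<close>.\<close>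
    show "inj_on (hom_induced (int n) (attached A') B ?Y B id) (carrier (relative_homology_group n (attached A') B))"
    proof -
      interpret group_hom "relative_homology_group n (attached A') B" "relative_homology_group n ?Y B"
        "hom_induced (int n) (attached A') B ?Y B id"
        using incl by (simp add: group_hom_def group_hom_axioms_def)
      have "carrier (relative_homology_group (int n + 1) ?Y ?B) = {\<one>\<^bsub>relative_homology_group (int n + 1) ?Y ?B\<^esub>}"
        using step_trivial[of "int n + 1"] by (simp add: trivial_group_def)
      with boundary_one have "kernel (relative_homology_group n (attached A') B) (relative_homology_group n ?Y B)
          (hom_induced (int n) (attached A') B ?Y B id) = {\<one>\<^bsub>relative_homology_group (int n) (attached A') B\<^esub>}"
        using triple_kernel_inclusion[OF base_subset_carrier_set, of "int n" ?Y A'] by (simp add: sub)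
      then show ?thesis using inj_iff_trivial_ker by simp
    qed
    show "free_family (relative_homology_group (int n) (attached A') B) (attached_class A') A'"
      using insert.IH by simp
    show "attached_class (insert c A') c \<in> carrier (relative_homology_group n ?Y B)"
      unfolding attached_class_def by (rule hom_induced_carrier)
    \<comment> \<open>By functoriality the class of the new cell lifts the generator of the infinite
      cyclic quotient.\<close>
    have "hom_induced n ?Y B ?Y ?B id (attached_class (insert c A') c) =
        hom_induced n (nball n) (ball_boundary n) ?Y ?B (\<Phi> c) (ball_orientation n)"
      unfolding attached_class_def
      using continuous_attached[OF A'c, of c] boundary_map insert.hyps base_subset_carrier_set[of A']
      by (subst hom_induced_compose') auto
    moreover have "free_family (relative_homology_group n ?Y ?B)
        (\<lambda>_. hom_induced n (nball n) (ball_boundary n) ?Y ?B (\<Phi> c) (ball_orientation n)) {c}"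
      using free_family_iso[OF step _ _ free_family_ball_orientation[of n c]] by simp
    ultimately show "free_family (relative_homology_group n ?Y ?B)
        (\<lambda>_. hom_induced n ?Y B ?Y ?B id (attached_class (insert c A') c)) {c}" by simp
    show "attached_class (insert c A') a = hom_induced n (attached A') B ?Y B id (attached_class A' a)"
      if "a \<in> A'" for a
      unfolding attached_class_def
      using continuous_attached[of A' a] boundary_map insert.hyps that A'c
      by (subst hom_induced_compose'[OF _ _ incl_continuous]) auto
  qed (use insert.hyps in auto)
  ultimately show ?case by blast
qed

end

section \<open>Skeleta and subcomplexes\<close>

lemma torsion_integer_group: "torsion integer_group = {0}"
  by (auto simp: torsion_def intro: exI[of _ 1])

lemma torsion_homology_point: "torsion (homology_group p (discrete_topology {()})) = {\<one>\<^bsub>homology_group p (discrete_topology {()})\<^esub>}"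
proof (cases "p = 0")
  case True
  have "homology_group 0 (discrete_topology {()}) \<cong> integer_group"
    by (rule homology_coefficients) simp
  then obtain f where f: "f \<in> iso (homology_group 0 (discrete_topology {()})) integer_group"
    unfolding is_iso_def by blast
  then have "f \<in> hom (homology_group 0 (discrete_topology {()})) integer_group"
    "inj_on f (carrier (homology_group 0 (discrete_topology {()})))"
    by (auto simp: iso_def bij_betw_def)
  from torsion_mono_hom[OF _ _ this] show ?thesis using True torsion_integer_group by simp
next
  case False
  then show ?thesis by (intro trivial_group_torsion homology_dimension_axiom) simp_all
qed

text \<open>Reduced homology is the kernel of the map to the homology of a point. That group is
  torsion-free, so all torsion already lies in the kernel.\<close>

lemma torsion_reduced_homology_group: "torsion (reduced_homology_group p X) = torsion (homology_group p X)"
proof -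
  let ?G = "homology_group p X" and ?H = "homology_group p (discrete_topology {()})"
  let ?h = "hom_induced p X {} (discrete_topology {()}) {} (\<lambda>x. ())"
  interpret h: group_hom ?G ?H ?h
    by (simp add: group_hom_def group_hom_axioms_def hom_induced_hom)
  have "x \<in> carrier (reduced_homology_group p X)" if "x \<in> torsion ?G" for x
  proof -
    obtain k :: nat where k: "x \<in> carrier ?G" "k > 0" "x [^]\<^bsub>?G\<^esub> k = \<one>\<^bsub>?G\<^esub>"
      using \<open>x \<in> torsion ?G\<close> by (auto simp: torsion_def)
    then have "?h x [^]\<^bsub>?H\<^esub> k = \<one>\<^bsub>?H\<^esub>" using h.hom_nat_pow[of x k] by simp
    then have "?h x \<in> torsion ?H" using k by (auto simp: torsion_def)
    then show ?thesis
      using k(1) unfolding torsion_homology_point carrier_reduced_homology_group kernel_def by simp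
  qed
  moreover have "x [^]\<^bsub>reduced_homology_group p X\<^esub> k = x [^]\<^bsub>?G\<^esub> k" for x and k :: nat
    by (simp add: reduced_homology_group_def pow_subgroup_generated)
  ultimately show ?thesis
    using carrier_reduced_homology_group_subset[of p X]
    by (auto simp: torsion_def one_reduced_homology_group)
qed

locale cw =
  fixes S :: "('a, 'c) cell_structure"
  assumes CW: "finite_CW_complex S"
begin

abbreviation X :: "'a topology" where "X \<equiv> cw_space S"

lemma Hausdorff: "Hausdorff_space X" using CW by (simp add: finite_CW_complex_def)

lemma finite_cells: "finite (cells S)" using CW by (simp add: finite_CW_complex_def)

lemma char_map_continuous: "c \<in> cells S \<Longrightarrow> continuous_map (nball (cell_dim S c)) X (char_map S c)"
  using CW by (simp add: finite_CW_complex_def)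

lemma char_map_embedding:
  "c \<in> cells S \<Longrightarrow> embedding_map (subtopology (nball (cell_dim S c)) (ball_interior (cell_dim S c))) X (char_map S c)"
  using CW by (simp add: finite_CW_complex_def)

lemma char_map_boundary:
  "c \<in> cells S \<Longrightarrow> char_map S c ` ball_boundary (cell_dim S c) \<subseteq> skeleton S (int (cell_dim S c) - 1)"
  using CW by (simp add: finite_CW_complex_def)

lemma disjoint_open_cells: "disjoint_family_on (open_cell S) (cells S)"
  using CW by (simp add: finite_CW_complex_def)

lemma skeleton_mono: "m \<le> n \<Longrightarrow> skeleton S m \<subseteq> skeleton S n"
  unfolding skeleton_def by fastforce

lemma skeleton_negative: "m < 0 \<Longrightarrow> skeleton S m = {}"
  unfolding skeleton_def by auto

lemma skeleton_step: "skeleton S n = skeleton S (n - 1) \<union> (\<Union>c\<in>cells_of_dim S n. open_cell S c)"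
proof -
  have "{c \<in> cells S. int (cell_dim S c) \<le> n} = {c \<in> cells S. int (cell_dim S c) \<le> n - 1} \<union> cells_of_dim S n"
    by (auto simp: cells_of_dim_def)
  then show ?thesis by (simp add: skeleton_def)
qed

lemma skeleton_closed_cells:
  "skeleton S m = (\<Union>c \<in> {c \<in> cells S. int (cell_dim S c) \<le> m}. char_map S c ` topspace (nball (cell_dim S c)))"
proof -
  have "char_map S c ` topspace (nball (cell_dim S c)) =
      char_map S c ` ball_boundary (cell_dim S c) \<union> open_cell S c" for c
    by (simp add: open_cell_def image_Un flip: ball_boundary_Un_interior)
  moreover have "char_map S c ` ball_boundary (cell_dim S c) \<subseteq> skeleton S m"
    if "c \<in> {c \<in> cells S. int (cell_dim S c) \<le> m}" for c
    using that by (intro order_trans[OF char_map_boundary skeleton_mono]) auto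
  moreover have absorb: "(\<Union>c\<in>I. P c \<union> Q c) = (\<Union>c\<in>I. Q c)"
    if "\<And>c. c \<in> I \<Longrightarrow> P c \<subseteq> (\<Union>c\<in>I. Q c)" for P Q :: "'c \<Rightarrow> 'a set" and I
    using that by blast
  ultimately show ?thesis
    using absorb[of "{c \<in> cells S. int (cell_dim S c) \<le> m}" "\<lambda>c. char_map S c ` ball_boundary (cell_dim S c)" "open_cell S"]
    unfolding skeleton_def by simp
qed

lemma closedin_skeleton: "closedin X (skeleton S m)"
proof -
  have "closedin X (char_map S c ` topspace (nball (cell_dim S c)))" if "c \<in> cells S" for c
    using compact_space_nball char_map_continuous[OF that] unfolding compact_space_def
    by (intro compactin_imp_closedin[OF Hausdorff] image_compactin)
  then show ?thesis
    unfolding skeleton_closed_cells using finite_cells by (intro closedin_Union) auto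
qed

lemma finite_cells_of_dim: "finite (cells_of_dim S n)"
  using finite_cells by (simp add: cells_of_dim_def)

lemma cells_attachment:
  assumes "A \<subseteq> cells_of_dim S (int n)"
  shows "cells_attachment X (skeleton S (int n - 1)) n (char_map S) A"
proof
  have cell: "c \<in> cells S" "cell_dim S c = n" if "c \<in> A" for c
    using assms that by (auto simp: cells_of_dim_def)
  show "Hausdorff_space X" by (rule Hausdorff)
  show "closedin X (skeleton S (int n - 1))" by (rule closedin_skeleton)
  show "finite A" using assms finite_cells_of_dim finite_subset by blast
  show "continuous_map (nball n) X (char_map S c)" if "c \<in> A" for c
    using char_map_continuous[of c] cell[OF that] by simp
  show "embedding_map (subtopology (nball n) (ball_interior n)) X (char_map S c)" if "c \<in> A" for c
    using char_map_embedding[of c] cell[OF that] by simp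
  show "char_map S c ` ball_boundary n \<subseteq> skeleton S (int n - 1)" if "c \<in> A" for c
    using char_map_boundary[of c] cell[OF that] by simp
  have open_cell: "char_map S c ` ball_interior n = open_cell S c" if "c \<in> A" for c
    using cell(2)[OF that] by (simp add: open_cell_def)
  have "open_cell S c \<inter> skeleton S (int n - 1) = {}" if "c \<in> A" for c
  proof -
    have "open_cell S c \<inter> open_cell S e = {}" if "e \<in> {e \<in> cells S. int (cell_dim S e) \<le> int n - 1}" for e
      using that cell[OF \<open>c \<in> A\<close>] by (intro disjoint_family_onD[OF disjoint_open_cells]) auto
    then show ?thesis unfolding skeleton_def by blast
  qed
  then show "char_map S c ` ball_interior n \<inter> skeleton S (int n - 1) = {}" if "c \<in> A" for c
    using that open_cell by simp
  have "disjoint_family_on (open_cell S) A"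
    using disjoint_family_on_mono[OF _ disjoint_open_cells] cell by blast
  then show "disjoint_family_on (\<lambda>c. char_map S c ` ball_interior n) A"
    unfolding disjoint_family_on_def using open_cell by simp
qed

section \<open>Subcomplexes and skeleta as results of attaching cells\<close>

lemma subcomplex_attached:
  assumes "A \<subseteq> cells_of_dim S (int n)"
  shows "cells_attachment.attached X (skeleton S (int n - 1)) n (char_map S) A = subcomplex S n A"
proof -
  interpret cells_attachment X "skeleton S (int n - 1)" n "char_map S" A
    by (rule cells_attachment[OF assms])
  have "(\<Union>c\<in>A. char_map S c ` ball_interior n) = (\<Union>c\<in>A. open_cell S c)"
    using assms by (intro SUP_cong) (auto simp: cells_of_dim_def open_cell_def)
  then show ?thesis by (simp add: attached_def carrier_set_def subcomplex_def)
qed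

definition subcomplex_class :: "nat \<Rightarrow> 'c set \<Rightarrow> 'c \<Rightarrow> 'a chain set" where
  "subcomplex_class n A c = hom_induced (int n) (nball n) (ball_boundary n)
     (subcomplex S n A) (skeleton S (int n - 1)) (char_map S c) (ball_orientation n)"

lemma subcomplex_homology:
  assumes "A \<subseteq> cells_of_dim S (int n)"
  shows "p \<noteq> int n \<Longrightarrow> trivial_group (relative_homology_group p (subcomplex S n A) (skeleton S (int n - 1)))"
    and "free_family (relative_homology_group (int n) (subcomplex S n A) (skeleton S (int n - 1)))
      (subcomplex_class n A) A"
proof -
  interpret cells_attachment X "skeleton S (int n - 1)" n "char_map S" A
    by (rule cells_attachment[OF assms])
  have eq: "attached A = subcomplex S n A" by (rule subcomplex_attached[OF assms])
  have "attached_class A = subcomplex_class n A"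
    by (intro ext) (simp only: attached_class_def subcomplex_class_def eq)
  then show "p \<noteq> int n \<Longrightarrow> trivial_group (relative_homology_group p (subcomplex S n A) (skeleton S (int n - 1)))"
    and "free_family (relative_homology_group (int n) (subcomplex S n A) (skeleton S (int n - 1)))
      (subcomplex_class n A) A"
    using attached_homology[OF subset_refl, of p] by (simp_all add: eq)
qed

lemma char_map_subcomplex:
  assumes "A \<subseteq> cells_of_dim S (int n)" "c \<in> A"
  shows "continuous_map (nball n) (subcomplex S n A) (char_map S c)"
    and "char_map S c \<in> ball_boundary n \<rightarrow> skeleton S (int n - 1)"
proof -
  interpret cells_attachment X "skeleton S (int n - 1)" n "char_map S" A
    by (rule cells_attachment[OF assms(1)])
  show "continuous_map (nball n) (subcomplex S n A) (char_map S c)"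
    using continuous_attached[OF subset_refl assms(2)] subcomplex_attached[OF assms(1)] by simp
  show "char_map S c \<in> ball_boundary n \<rightarrow> skeleton S (int n - 1)" by (rule boundary_map[OF assms(2)])
qed

lemma subcomplex_all: "subcomplex S n (cells_of_dim S (int n)) = subtopology X (skeleton S (int n))"
  using skeleton_step[of "int n"] by (simp add: subcomplex_def)

lemma subtopology_subcomplex:
  "subtopology (subcomplex S n A) (skeleton S (int n - 1)) = subtopology X (skeleton S (int n - 1))"
  by (simp add: subcomplex_def subtopology_subtopology Int_absorb1)

lemma subtopology_skeleton:
  "m \<le> n \<Longrightarrow> subtopology (subtopology X (skeleton S n)) (skeleton S m) = subtopology X (skeleton S m)"
  using skeleton_mono[of m n] by (simp add: subtopology_subtopology Int_absorb1)

lemma subcomplex_class_all: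
  assumes "c \<in> cells_of_dim S (int n)"
  shows "subcomplex_class n (cells_of_dim S (int n)) c = cell_class S c"
proof -
  have "cell_dim S c = n" using assms by (simp add: cells_of_dim_def)
  then show ?thesis by (simp add: subcomplex_class_def cell_class_def subcomplex_all Let_def)
qed

lemma cellular_chain_group_free:
  "free_family (cellular_chain_group S (int n)) (cell_class S) (cells_of_dim S (int n))"
proof -
  have "free_family (cellular_chain_group S (int n)) (subcomplex_class n (cells_of_dim S (int n))) (cells_of_dim S (int n))"
    using subcomplex_homology(2)[OF subset_refl, of n] by (simp add: cellular_chain_group_def subcomplex_all)
  moreover have "comm_group (cellular_chain_group S (int n))" by (simp add: cellular_chain_group_def)
  ultimately show ?thesis using comm_group.free_family_cong subcomplex_class_all by blast
qed

lemma cell_coeffs: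
  assumes "z \<in> carrier (cellular_chain_group S (int n))"
  shows "z = int_comb (cellular_chain_group S (int n)) (cell_class S) (cells_of_dim S (int n)) (cell_coeffs S (int n) z)"
proof -
  have "comm_group (cellular_chain_group S (int n))" by (simp add: cellular_chain_group_def)
  from theI'[OF comm_group.free_family_coeffs[OF this cellular_chain_group_free assms]]
  show ?thesis unfolding cell_coeffs_def Let_def int_comb_def by blast
qed

text \<open>The shift to \<open>int m - 1\<close> lets the induction start at the empty skeleton. In
  each step the homology lies between that of the smaller skeleton and a relative group concentrated
  in the dimension of the new cells.\<close>

lemma skeleton_homology_trivial:
  "p \<ge> int m \<Longrightarrow> trivial_group (homology_group p (subtopology X (skeleton S (int m - 1))))"
proof (induction m)
  case 0
  then show ?case by (intro trivial_homology_group_empty) (simp add: skeleton_negative)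
next
  case (Suc m)
  let ?Y = "subtopology X (skeleton S (int m))" and ?B = "skeleton S (int m - 1)"
  have sub: "subtopology ?Y ?B = subtopology X ?B" by (rule subtopology_skeleton) simp
  have base: "trivial_group (homology_group p (subtopology X ?B))" using Suc by simp
  have rel: "trivial_group (relative_homology_group p ?Y ?B)"
    using subcomplex_homology(1)[OF subset_refl, of p m] Suc.prems by (simp add: subcomplex_all)
  have "kernel (homology_group p ?Y) (relative_homology_group p ?Y ?B) (hom_induced p ?Y {} ?Y ?B id) =
      hom_induced p (subtopology X ?B) {} ?Y {} id ` carrier (homology_group p (subtopology X ?B))"
    using triple_kernel_relativization[of "{}" ?B p ?Y] by (simp only: sub empty_subsetI)
  from trivial_group_exact[OF group_relative_homology_group hom_induced_hom hom_induced_hom this base rel]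
  show ?case by simp
qed

text \<open>The kernel comes from the homology of the next lower skeleton in degree
  \<open>n\<close>, which is above its dimension.\<close>

lemma skeleton_relativization_inj:
  "inj_on (hom_induced (int n) (subtopology X (skeleton S (int n))) {}
      (subtopology X (skeleton S (int n))) (skeleton S (int n - 1)) id)
    (carrier (homology_group (int n) (subtopology X (skeleton S (int n)))))"
proof -
  let ?Y = "subtopology X (skeleton S (int n))" and ?B = "skeleton S (int n - 1)"
  have sub: "subtopology ?Y ?B = subtopology X ?B" by (rule subtopology_skeleton) simp
  have one: "hom_induced (int n) (subtopology X ?B) {} ?Y {} id \<one>\<^bsub>homology_group (int n) (subtopology X ?B)\<^esub> =
      \<one>\<^bsub>homology_group (int n) ?Y\<^esub>"
    by (rule hom_one[OF hom_induced_hom]) simp_all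
  interpret group_hom "homology_group (int n) ?Y" "relative_homology_group (int n) ?Y ?B"
    "hom_induced (int n) ?Y {} ?Y ?B id"
    by (simp add: group_hom_def group_hom_axioms_def hom_induced_hom)
  have "carrier (homology_group (int n) (subtopology X ?B)) = {\<one>\<^bsub>homology_group (int n) (subtopology X ?B)\<^esub>}"
    using skeleton_homology_trivial[of n "int n"] by (simp add: trivial_group_def)
  then have "kernel (homology_group (int n) ?Y) (relative_homology_group (int n) ?Y ?B)
      (hom_induced (int n) ?Y {} ?Y ?B id) = {\<one>\<^bsub>homology_group (int n) ?Y\<^esub>}"
    using triple_kernel_relativization[of "{}" ?B "int n" ?Y] one unfolding sub by simp
  then show ?thesis using inj_iff_trivial_ker by simp
qed

text \<open>Homology of a skeleton in its own dimension embeds into the free group of cellular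
  chains; for \<open>n = 0\<close> the degree is negative.\<close>

lemma skeleton_homology_torsion_free:
  "torsion (homology_group (int n - 1) (subtopology X (skeleton S (int n - 1)))) =
    {\<one>\<^bsub>homology_group (int n - 1) (subtopology X (skeleton S (int n - 1)))\<^esub>}"
proof (cases n)
  case 0
  then show ?thesis by (intro trivial_group_torsion trivial_homology_group) simp
next
  case (Suc m)
  have "torsion (cellular_chain_group S (int m)) = {\<one>\<^bsub>cellular_chain_group S (int m)\<^esub>}"
    using cellular_chain_group_free by (intro comm_group.free_family_torsion) (simp add: cellular_chain_group_def)
  from torsion_mono_hom[OF _ _ hom_induced_hom skeleton_relativization_inj this[unfolded cellular_chain_group_def]]
  show ?thesis using Suc by simp
qed

text \<open>By naturality both sides are the image, under the characteristic map, of the boundary of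
  the ball orientation. The boundary lives on the skeleton and does not see which other facets are
  present, so one matrix serves all subcomplexes.\<close>

lemma boundary_subcomplex_class:
  assumes "A \<subseteq> cells_of_dim S (int (Suc n))" "c \<in> A"
  shows "hom_relboundary (int n + 1) (subcomplex S (Suc n) A) (skeleton S (int n)) (skeleton S (int n - 1))
      (subcomplex_class (Suc n) A c) = cellular_boundary S (int (Suc n)) (cell_class S c)"
proof -
  have key: "hom_relboundary (int n + 1) (subcomplex S (Suc n) A') (skeleton S (int n)) (skeleton S (int n - 1))
      (subcomplex_class (Suc n) A' c) =
    hom_induced (int n + 1 - 1) (subtopology (nball (Suc n)) (ball_boundary (Suc n))) {}
      (subtopology X (skeleton S (int n))) (skeleton S (int n - 1)) (char_map S c)
      (hom_relboundary (int n + 1) (nball (Suc n)) (ball_boundary (Suc n)) {} (ball_orientation (Suc n)))"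
    if A': "A' \<subseteq> cells_of_dim S (int (Suc n))" "c \<in> A'" for A'
  proof -
    have "subtopology (subcomplex S (Suc n) A') (skeleton S (int n)) = subtopology X (skeleton S (int n))"
      using subtopology_subcomplex[of "Suc n" A'] by simp
    moreover have "char_map S c \<in> ball_boundary (Suc n) \<rightarrow> skeleton S (int n)"
      using char_map_subcomplex(2)[OF A'] by simp
    ultimately show ?thesis
      using fun_cong[OF naturality_hom_induced_relboundary[OF char_map_subcomplex(1)[OF A'],
            of "ball_boundary (Suc n)" "skeleton S (int n)" "{}" "skeleton S (int n - 1)" "int n + 1"],
          of "ball_orientation (Suc n)"]
      by (simp add: subcomplex_class_def add.commute)
  qed
  have c: "c \<in> cells_of_dim S (int (Suc n))" using assms by blast
  have "cellular_boundary S (int (Suc n)) (cell_class S c) =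
      hom_relboundary (int n + 1) (subcomplex S (Suc n) (cells_of_dim S (int (Suc n)))) (skeleton S (int n))
        (skeleton S (int n - 1)) (subcomplex_class (Suc n) (cells_of_dim S (int (Suc n))) c)"
    unfolding subcomplex_class_all[OF c] subcomplex_all cellular_boundary_def by (simp add: add.commute)
  then show ?thesis using key[OF assms] key[OF subset_refl c] by simp
qed

text \<open>The missing entries of the diagram are the homology of the subcomplex modulo its
  skeleton in degree \<open>n + 1\<close>, in the role of \<open>R\<close>, and the homology of the
  \<open>n - 1\<close> skeleton in degree \<open>n - 1\<close>, in the role of
  \<open>Q\<close>.\<close>

lemma torsion_subcomplex_Suc:
  assumes A: "A \<subseteq> facets S (Suc n)"
  shows "\<exists>\<theta>. \<theta> ` saturation (faces S (Suc n)) (column_lattice (bd S (Suc n)) A) =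
      torsion (homology_group (int n) (subcomplex S (Suc n) A)) \<and>
    (\<forall>u \<in> saturation (faces S (Suc n)) (column_lattice (bd S (Suc n)) A).
      \<forall>v \<in> saturation (faces S (Suc n)) (column_lattice (bd S (Suc n)) A).
      \<theta> u = \<theta> v \<longleftrightarrow> (\<lambda>\<tau>. u \<tau> - v \<tau>) \<in> column_lattice (bd S (Suc n)) A)"
proof -
  let ?Y = "subcomplex S (Suc n) A" and ?Xn = "subtopology X (skeleton S (int n))"
  let ?K = "skeleton S (int n)" and ?K' = "skeleton S (int n - 1)"
  let ?C = "cellular_chain_group S (int n)" and ?cells = "cells_of_dim S (int n)"
  have A': "A \<subseteq> cells_of_dim S (int (Suc n))" using A by (simp add: facets_def)
  have sub: "subtopology ?Y ?K = ?Xn" using subtopology_subcomplex[of "Suc n" A] by simp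
  have sub': "subtopology ?Xn ?K' = subtopology X ?K'" by (rule subtopology_skeleton) simp
  have C: "?C = relative_homology_group (int n) ?Xn ?K'" by (simp add: cellular_chain_group_def)
  have faces: "faces S (Suc n) = Some ` ?cells" by (simp add: faces_def)
  have free: "free_family ?C (cell_class S) ?cells" by (rule cellular_chain_group_free)
  interpret C: comm_group ?C by (simp add: C)
  show ?thesis
  proof (rule torsion_quotient_saturation)
    show "comm_group (relative_homology_group (int n + 1) ?Y ?K)" "comm_group (homology_group (int n) ?Xn)"
      "comm_group (homology_group (int n) ?Y)" "comm_group ?C"
      "comm_group (homology_group (int n - 1) (subtopology X ?K'))"
      by (simp_all add: C)
    show "hom_induced (int n) ?Xn {} ?Y {} id \<in> hom (homology_group (int n) ?Xn) (homology_group (int n) ?Y)"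
      by (rule hom_induced_hom)
    show "hom_induced (int n) ?Xn {} ?Y {} id ` carrier (homology_group (int n) ?Xn) = carrier (homology_group (int n) ?Y)"
    proof -
      \<comment> \<open>The attached cells have dimension \<open>n + 1\<close> and contribute
        nothing in degree \<open>n\<close>; so every class of the subcomplex comes from the
        skeleton.\<close>
      have "trivial_group (relative_homology_group (int n) ?Y ?K)"
        using subcomplex_homology(1)[OF A', of "int n"] by simp
      then have "kernel (homology_group (int n) ?Y) (relative_homology_group (int n) ?Y ?K)
          (hom_induced (int n) ?Y {} ?Y ?K id) = carrier (homology_group (int n) ?Y)"
        by (intro group_hom.kernel_to_trivial_group)
           (simp_all add: group_hom_def group_hom_axioms_def hom_induced_hom)
      then show ?thesis using triple_kernel_relativization[of "{}" ?K "int n" ?Y] by (simp add: sub)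
    qed
    show "kernel (homology_group (int n) ?Xn) (homology_group (int n) ?Y) (hom_induced (int n) ?Xn {} ?Y {} id) =
        hom_boundary (int n + 1) ?Y ?K ` carrier (relative_homology_group (int n + 1) ?Y ?K)"
      using triple_kernel_inclusion[of "{}" ?K "int n" ?Y] by (simp add: sub hom_relboundary_empty)
    show "hom_boundary (int n + 1) ?Y ?K
        \<in> hom (relative_homology_group (int n + 1) ?Y ?K) (homology_group (int n) ?Xn)"
      using hom_boundary_hom[of "int n + 1" ?Y ?K] by (simp add: sub)
    show "hom_induced (int n) ?Xn {} ?Xn ?K' id \<in> hom (homology_group (int n) ?Xn) ?C"
      unfolding C by (rule hom_induced_hom)
    show "inj_on (hom_induced (int n) ?Xn {} ?Xn ?K' id) (carrier (homology_group (int n) ?Xn))"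
      by (rule skeleton_relativization_inj)
    show "kernel ?C (homology_group (int n - 1) (subtopology X ?K')) (hom_boundary (int n) ?Xn ?K') =
        hom_induced (int n) ?Xn {} ?Xn ?K' id ` carrier (homology_group (int n) ?Xn)"
      using triple_kernel_boundary[of "{}" ?K' "int n" ?Xn] by (simp add: sub' C hom_relboundary_empty)
    show "hom_boundary (int n) ?Xn ?K' \<in> hom ?C (homology_group (int n - 1) (subtopology X ?K'))"
      using hom_boundary_hom[of "int n" ?Xn ?K'] by (simp add: sub' C)
    show "torsion (homology_group (int n - 1) (subtopology X ?K')) =
        {\<one>\<^bsub>homology_group (int n - 1) (subtopology X ?K')\<^esub>}"
      by (rule skeleton_homology_torsion_free)
    show "free_family ?C (\<lambda>\<tau>. cell_class S (the \<tau>)) (faces S (Suc n))"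
      unfolding faces by (rule C.free_family_Some[OF free])
    have R: "free_family (relative_homology_group (int n + 1) ?Y ?K) (subcomplex_class (Suc n) A) A"
      using subcomplex_homology(2)[OF A'] by (simp add: add.commute)
    show "finite A" "subcomplex_class (Suc n) A ` A \<subseteq> carrier (relative_homology_group (int n + 1) ?Y ?K)"
      using R by (simp_all add: free_family_def)
    show "\<exists>a. z = int_comb (relative_homology_group (int n + 1) ?Y ?K) (subcomplex_class (Suc n) A) A a"
      if "z \<in> carrier (relative_homology_group (int n + 1) ?Y ?K)" for z
      by (rule free_family_spanning[OF R that])
    show "hom_induced (int n) ?Xn {} ?Xn ?K' id (hom_boundary (int n + 1) ?Y ?K (subcomplex_class (Suc n) A \<sigma>)) =
        int_comb ?C (\<lambda>\<tau>. cell_class S (the \<tau>)) (faces S (Suc n)) (\<lambda>\<tau>. bd S (Suc n) \<tau> \<sigma>)" if "\<sigma> \<in> A" for \<sigma>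
    proof -
      let ?z = "cellular_boundary S (int (Suc n)) (cell_class S \<sigma>)"
      have "hom_induced (int n) ?Xn {} ?Xn ?K' id (hom_boundary (int n + 1) ?Y ?K (subcomplex_class (Suc n) A \<sigma>)) = ?z"
        using boundary_subcomplex_class[OF A' that] by (simp add: hom_relboundary_def sub)
      moreover have "?z \<in> carrier ?C"
        using hom_relboundary[of "int n + 1" "subtopology X (skeleton S (int n + 1))" ?K ?K' "cell_class S \<sigma>"]
          subtopology_skeleton[of "int n" "int n + 1"]
        by (simp add: cellular_boundary_def C add.commute)
      then have "?z = int_comb ?C (cell_class S) ?cells (cell_coeffs S (int n) ?z)" by (rule cell_coeffs)
      moreover have "\<dots> = int_comb ?C (cell_class S) ?cells (\<lambda>t. bd S (Suc n) (Some t) \<sigma>)"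
        using free by (intro C.int_comb_cong) (auto simp: free_family_def bd_def faces)
      moreover have "\<dots> = int_comb ?C (\<lambda>\<tau>. cell_class S (the \<tau>)) (Some ` ?cells) (\<lambda>\<tau>. bd S (Suc n) \<tau> \<sigma>)"
        using free by (intro C.int_comb_Some[symmetric]) (simp add: free_family_def)
      ultimately show ?thesis unfolding faces by simp
    qed
    show "bd S (Suc n) \<tau> \<sigma> = 0" if "\<tau> \<notin> faces S (Suc n)" for \<tau> \<sigma>
      using that by (simp add: bd_def)
  qed
qed

text \<open>For \<open>d = 0\<close> the only row is that of the (-1)-cell and all its entries are
  1, so the lattice is zero or everything and in both cases saturated. This matches the vanishing of
  reduced homology in degree -1, and a constant map serves as \<open>\<theta>\<close>.\<close>

lemma torsion_subcomplex:
  assumes A: "A \<subseteq> facets S d"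
  shows "\<exists>\<theta>. \<theta> ` saturation (faces S d) (column_lattice (bd S d) A) =
      torsion (reduced_homology_group (int d - 1) (subcomplex S d A)) \<and>
    (\<forall>u \<in> saturation (faces S d) (column_lattice (bd S d) A).
      \<forall>v \<in> saturation (faces S d) (column_lattice (bd S d) A).
      \<theta> u = \<theta> v \<longleftrightarrow> (\<lambda>\<tau>. u \<tau> - v \<tau>) \<in> column_lattice (bd S d) A)"
proof (cases d)
  case (Suc n)
  then show ?thesis
    using torsion_subcomplex_Suc[of A n] A by (simp add: torsion_reduced_homology_group)
next
  case 0
  let ?G = "reduced_homology_group (int d - 1) (subcomplex S d A)"
  have "torsion ?G = {\<one>\<^bsub>?G\<^esub>}"
    using 0 by (intro trivial_group_torsion trivial_reduced_homology_group) simp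
  moreover have bd: "bd S d \<tau> \<sigma> = (if \<tau> = None then 1 else 0)" for \<tau> \<sigma>
    by (simp add: bd_def 0 faces_def)
  have faces: "faces S d = {None}" by (simp add: 0 faces_def)
  have sat: "u \<in> column_lattice (bd S d) A" if u: "u \<in> saturation {None} (column_lattice (bd S d) A)" for u
  proof (cases "A = {}")
    case True
    obtain k where k: "k > 0" "(\<lambda>\<tau>. k * u \<tau>) \<in> column_lattice (bd S d) {}"
      using u True by (auto simp: saturation_def)
    from k(2) have "\<And>\<tau>. k * u \<tau> = 0" by (elim column_latticeE) simp
    then have "u = (\<lambda>\<tau>. 0)" using k(1) by (intro ext) simp
    then show ?thesis by (simp add: column_lattice_zero)
  next
    case False
    then obtain a where a: "a \<in> A" by blast
    have "finite A" using A finite_cells_of_dim finite_subset unfolding facets_def by blast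
    then have "(\<lambda>\<tau>. u None * bd S d \<tau> a) \<in> column_lattice (bd S d) A"
      by (rule column_lattice_scale[OF column_lattice_column[OF _ a]])
    moreover have "u = (\<lambda>\<tau>. u None * bd S d \<tau> a)"
      using u by (intro ext) (auto simp: bd saturation_def)
    ultimately show ?thesis by simp
  qed
  have "(\<lambda>\<tau>. 0) \<in> saturation {None} (column_lattice (bd S d) A)"
    using column_lattice_zero by (auto simp: saturation_def intro!: exI[of _ 1])
  then have "(\<lambda>_. \<one>\<^bsub>?G\<^esub>) ` saturation (faces S d) (column_lattice (bd S d) A) = {\<one>\<^bsub>?G\<^esub>}"
    unfolding faces by (intro image_constant)
  ultimately show ?thesis
    unfolding faces using column_lattice_diff[OF sat sat] by (intro exI[of _ "\<lambda>_. \<one>\<^bsub>?G\<^esub>"]) simp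
qed

end

section \<open>Calibrated characteristic vectors\<close>

theorem theorem6p1:
  fixes S :: "('a, 'c) cell_structure" and d :: nat and F :: "'c set"
  assumes "finite_CW_complex S"
    and "CW_dimension S d"
    and "CSF S d F"
    and "torsion (reduced_homology_group (int d - 1) (subcomplex S d F)) =
           {\<one>\<^bsub>reduced_homology_group (int d - 1) (subcomplex S d F)\<^esub>}"
  shows "integral_basis (char_vector S d F) F (cut_lattice S d)"
proof -
  interpret cw S by standard (rule assms(1))
  have column: "real_column S d = (\<lambda>\<sigma> \<tau>. real_of_int (bd S d \<tau> \<sigma>))"
    by (intro ext) (simp add: real_column_def)
  have forest: "F \<subseteq> facets S d" "real_independent (real_column S d) F"
      "real_span (real_column S d) F = real_span (real_column S d) (facets S d)"
    using assms(3) by (auto simp: CSF_def)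
  let ?Sat = "\<lambda>A. saturation (faces S d) (column_lattice (bd S d) A)"
  have "\<forall>A\<in>Pow (facets S d). \<exists>\<theta>. \<theta> ` ?Sat A = torsion (reduced_homology_group (int d - 1) (subcomplex S d A)) \<and>
    (\<forall>u\<in>?Sat A. \<forall>v\<in>?Sat A. \<theta> u = \<theta> v \<longleftrightarrow> (\<lambda>\<tau>. u \<tau> - v \<tau>) \<in> column_lattice (bd S d) A)"
    using torsion_subcomplex by (intro ballI) simp
  \<comment> \<open>All torsion elements have the same type of chain classes, so one family
    \<open>\<theta>\<close> can serve all sets of facets.\<close>
  from bchoice[OF this] obtain \<theta> where
    "\<forall>A\<in>Pow (facets S d). \<theta> A ` ?Sat A = torsion (reduced_homology_group (int d - 1) (subcomplex S d A)) \<and>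
      (\<forall>u\<in>?Sat A. \<forall>v\<in>?Sat A. \<theta> A u = \<theta> A v \<longleftrightarrow> (\<lambda>\<tau>. u \<tau> - v \<tau>) \<in> column_lattice (bd S d) A)"
    by (rule exE)
  note \<theta> = bspec[OF this PowI]
  interpret saturated_forest "bd S d" "faces S d" "facets S d" F \<theta> "torsion_number S d"
  proof
    show "finite (faces S d)" using finite_cells_of_dim by (simp add: faces_def)
    show "finite (facets S d)" using finite_cells_of_dim by (simp add: facets_def)
    show "bd S d \<tau> \<sigma> = 0" if "\<tau> \<notin> faces S d" for \<tau> \<sigma> using that by (simp add: bd_def)
    show "F \<subseteq> facets S d" by (rule forest(1))
    show "real_independent (\<lambda>\<sigma> \<tau>. real_of_int (bd S d \<tau> \<sigma>)) F" using forest(2) by (simp only: column)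
    show "real_span (\<lambda>\<sigma> \<tau>. real_of_int (bd S d \<tau> \<sigma>)) F =
        real_span (\<lambda>\<sigma> \<tau>. real_of_int (bd S d \<tau> \<sigma>)) (facets S d)" using forest(3) by (simp only: column)
    show "torsion_number S d A = card (\<theta> A ` saturation (faces S d) (column_lattice (bd S d) A))"
      if "A \<subseteq> facets S d" for A using \<theta>[OF that] by (simp add: torsion_number_def)
    show "\<theta> A u = \<theta> A v \<longleftrightarrow> (\<lambda>\<tau>. u \<tau> - v \<tau>) \<in> column_lattice (bd S d) A"
      if "A \<subseteq> facets S d" "u \<in> saturation (faces S d) (column_lattice (bd S d) A)"
        "v \<in> saturation (faces S d) (column_lattice (bd S d) A)" for A u v
      using \<theta>[OF that(1)] that(2,3) by blast
    show "torsion_number S d F = 1" using assms(4) by (simp add: torsion_number_def)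
  qed
  have "char_vector S d F \<sigma> \<kappa> = (if \<kappa> \<in> facets S d then coef \<sigma> \<kappa> else 0)" if \<sigma>: "\<sigma> \<in> F" for \<sigma> \<kappa>
  proof -
    let ?w = "\<lambda>\<rho>. relative_sign S d (F - {\<sigma>}) \<sigma> \<rho> * int (torsion_number S d (insert \<rho> (F - {\<sigma>})))"
    have bond_subset: "bond S d F \<sigma> \<subseteq> facets S d" using \<sigma> forest(1) by (auto simp: bond_def)
    then have "finite (bond S d F \<sigma>)" using finite_E finite_subset by blast
    then have vec: "char_vector S d F \<sigma> \<kappa> = (if \<kappa> \<in> bond S d F \<sigma> then ?w \<kappa> else 0)"
      by (simp add: char_vector_def std_basis_def if_distrib[where f = "\<lambda>x. _ * x"] cong: if_cong)
    show ?thesis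
    proof (cases "\<kappa> \<in> facets S d")
      case False
      then show ?thesis using vec bond_subset by auto
    next
      case True
      have sign: "relative_sign S d (F - {\<sigma>}) \<sigma> \<kappa> = (if coef \<sigma> \<kappa> > 0 then 1 else -1)"
        unfolding relative_sign_def column using sign_exchange[OF \<sigma> True] by simp
      show ?thesis
      proof (cases "\<kappa> \<in> F")
        case in_F: True
        then have "\<kappa> \<in> bond S d F \<sigma> \<longleftrightarrow> \<kappa> = \<sigma>" by (auto simp: bond_def)
        \<comment> \<open>Putting \<open>\<sigma>\<close> back restores \<open>F\<close>, whose
          torsion number is 1; the sign is positive because
          \<open>coef \<sigma> \<sigma> = 1\<close>.\<close>
        moreover have "?w \<sigma> = 1" if "\<kappa> = \<sigma>"
          using sign that t_F coef_F[OF \<sigma> \<sigma>] \<sigma> by (simp add: insert_absorb)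
        ultimately show ?thesis using vec True coef_F[OF \<sigma> in_F] by auto
      next
        case not_F: False
        have "insert \<kappa> (F - {\<sigma>}) \<subseteq> facets S d" using True forest(1) by blast
        then have bond: "\<kappa> \<in> bond S d F \<sigma> \<longleftrightarrow> coef \<sigma> \<kappa> \<noteq> 0"
          using exchange_spanning[OF \<sigma> True not_F] True not_F \<sigma>
          by (auto simp: bond_def CSF_def column)
        \<comment> \<open>Sign times absolute value; outside the bond the coefficient is 0, in
          agreement with the missing term of the sum.\<close>
        moreover have "?w \<kappa> = coef \<sigma> \<kappa>" if "coef \<sigma> \<kappa> \<noteq> 0"
          using sign t_exchange[OF \<sigma> True not_F that] by simp
        ultimately show ?thesis using vec True by simp
      qed
    qed
  qed
  from integral_basis_coef[of "char_vector S d F", OF this] show ?thesis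
    by (simp add: cut_lattice_def)
qed

end
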